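(* Let $n\ge3$. Let $U\subset\mathcal S^{n\times n}$ be an open set and $F\in C^1(U)\cap C^0(\overline U)$ satisfy: (1) $O^{-1}UO=U$ for all $O\in O(n)$; (2) $M\in U$ and $N\in\mathcal S^{n\times n}_+$ imply $M+N\in U$; (3) $M\in U$ implies $aM\in U$ for all constants $a>0$; (4) $\{aI : a>0\}\cap\partial U=\emptyset$; (5) $F(O^{-1}MO)=F(M)$ for all $M\in U$, $O\in O(n)$; (6) the matrix $(F_{ij}(M))$ is positive definite for all $M\in U$, where $F_{ij}(M)=\frac{\partial F}{\partial M_{ij}}(M)$; (7) $F>0$ in $U$ and $F=0$ on $\partial U$. Assume that a positive function $u\in C^1(\mathbb R^n\setminus\{0\})$ is a weak solution of $F(A^u)=0$ in $\mathbb R^n\setminus\{0\}$ and satisfies $\Delta u\le0$ in $\mathbb R^n\setminus\{0\}$ in the distribution sense. Then $$u_{x,\lambda}(y)\le u(y)\qquad\text{for all } x\in\mathbb R^n\setminus\{0\},\ 0<\lambda<|x|,\ |y-x|\ge\lambda,\ y\ne0 .$$ Consequently, $u$ is radially symmetric about the origin.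
   Context: $\mathcal S^{n\times n}$ is the set of $n\times n$ real symmetric matrices, $\mathcal S^{n\times n}_+$ the subset of positive definite matrices, $O(n)$ the set of $n\times n$ real orthogonal matrices, $I$ the identity matrix. For a positive $C^2$ function $u$, $$A^u=-\frac{2}{n-2}u^{-\frac{n+2}{n-2}}\nabla^2u+\frac{2n}{(n-2)^2}u^{-\frac{2n}{n-2}}\nabla u\otimes\nabla u-\frac{2}{(n-2)^2}u^{-\frac{2n}{n-2}}|\nabla u|^2I .$$ Weak solution: a positive continuous function $u$ on an open set $\Omega\subset\mathbb R^n$ is a weak solution of $F(A^u)=0$ in $\Omega$ if there exist sequences $\{u_i\}$ in $C^2(\Omega)$ and $\{\beta_i\}$ in $C^0(\Omega,\mathcal S^{n\times n})$ such that $u_i>0$ and $A^{u_i}+\beta_i\in U$ in $\Omega$, and, for any compact subset $K$ of $\Omega$, $u_i\to u$, $\beta_i\to0$ and $F(A^{u_i}+\beta_i)\to0$ in $C^0(K)$. Kelvin transformation: for $x\in\mathbb R^n$, $\lambda>0$, $$u_{x,\lambda}(y):=\frac{\lambda^{n-2}}{|y-x|^{n-2}}\,u\!\left(x+\frac{\lambda^2(y-x)}{|y-x|^2}\right).$$ *)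

theory Defs
  imports "HOL-Analysis.Analysis"
begin

definition sym_matrices :: "(real^'n^'n) set" where
  "sym_matrices = {M. transpose M = M}"

definition pos_def_matrix :: "real^'n^'n \<Rightarrow> bool" where
  "pos_def_matrix M \<longleftrightarrow> M \<in> sym_matrices \<and> (\<forall>x. x \<noteq> 0 \<longrightarrow> 0 < x \<bullet> (M *v x))"

definition matrix_unit :: "'n \<Rightarrow> 'n \<Rightarrow> real^'n^'n" where
  "matrix_unit i j = (\<chi> k l. if k = i \<and> l = j then 1 else 0)"

text \<open>
  The function \<open>F\<close> lives on symmetric matrices, and \<open>F\<^sub>i\<^sub>j = \<partial>F/\<partial>M\<^sub>i\<^sub>j\<close> follows the usual convention
  in which the \<open>n\<^sup>2\<close> entries are treated as independent variables of \<open>M \<mapsto> F ((M + M\<^sup>T)/2)\<close>.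
  Thus \<open>(F\<^sub>i\<^sub>j)\<close> is symmetric and \<open>dF(M) H = (\<Sum>i j. F\<^sub>i\<^sub>j(M) H\<^sub>i\<^sub>j)\<close> for symmetric \<open>H\<close>; there is no
  factor 2 off the diagonal.
\<close>

definition matrix_partials :: "(real^'n^'n \<Rightarrow> real) \<Rightarrow> real^'n^'n \<Rightarrow> real^'n^'n" where
  "matrix_partials F M =
     (\<chi> i j. deriv (\<lambda>t. F (M + t *\<^sub>R ((1/2) *\<^sub>R (matrix_unit i j + matrix_unit j i)))) 0)"

text \<open>Here \<open>U\<close> is meant to be open relative to \<^const>\<open>sym_matrices\<close>, so that differentiability
  within \<open>U\<close> is differentiability along all symmetric directions.\<close>

definition C1_on_sym :: "(real^'n^'n) set \<Rightarrow> (real^'n^'n \<Rightarrow> real) \<Rightarrow> bool" where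
  "C1_on_sym U F \<longleftrightarrow>
     (\<forall>M\<in>U. F differentiable (at M within U)) \<and> continuous_on U (matrix_partials F)"

definition partial :: "'n \<Rightarrow> (real^'n \<Rightarrow> real) \<Rightarrow> real^'n \<Rightarrow> real" where
  "partial i u x = frechet_derivative u (at x) (axis i 1)"

definition gradient :: "(real^'n \<Rightarrow> real) \<Rightarrow> real^'n \<Rightarrow> real^'n" where
  "gradient u x = (\<chi> i. partial i u x)"

definition hessian :: "(real^'n \<Rightarrow> real) \<Rightarrow> real^'n \<Rightarrow> real^'n^'n" where
  "hessian u x = (\<chi> i j. partial i (partial j u) x)"

definition laplacian :: "(real^'n \<Rightarrow> real) \<Rightarrow> real^'n \<Rightarrow> real" where
  "laplacian u x = (\<Sum>i\<in>UNIV. partial i (partial i u) x)"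

text \<open>\<open>Ck_on k \<Omega> u\<close> is \<open>u \<in> C\<^sup>k(\<Omega>)\<close> for open \<open>\<Omega>\<close>; values of \<open>u\<close> off \<open>\<Omega>\<close> play no role.\<close>

primrec Ck_on :: "nat \<Rightarrow> (real^'n) set \<Rightarrow> (real^'n \<Rightarrow> real) \<Rightarrow> bool" where
  "Ck_on 0 \<Omega> u \<longleftrightarrow> continuous_on \<Omega> u"
| "Ck_on (Suc k) \<Omega> u \<longleftrightarrow>
     (\<forall>x\<in>\<Omega>. u differentiable (at x)) \<and> (\<forall>i. Ck_on k \<Omega> (partial i u))"

definition test_function :: "(real^'n) set \<Rightarrow> (real^'n \<Rightarrow> real) \<Rightarrow> bool" where
  "test_function \<Omega> \<phi> \<longleftrightarrow>
     (\<forall>k. Ck_on k UNIV \<phi>) \<and> compact (closure {x. \<phi> x \<noteq> 0}) \<and> closure {x. \<phi> x \<noteq> 0} \<subseteq> \<Omega>"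

text \<open>\<open>\<Delta>u \<le> 0\<close> in the distribution sense, for \<open>u\<close> locally integrable on the open set \<open>\<Omega>\<close>
  (in particular for continuous \<open>u\<close>, where the integrand below is always integrable).\<close>

definition laplacian_nonpos_distr :: "(real^'n) set \<Rightarrow> (real^'n \<Rightarrow> real) \<Rightarrow> bool" where
  "laplacian_nonpos_distr \<Omega> u \<longleftrightarrow>
     (\<forall>\<phi>. test_function \<Omega> \<phi> \<and> (\<forall>x. 0 \<le> \<phi> x) \<longrightarrow>
        (LINT x:\<Omega>|lborel. u x * laplacian \<phi> x) \<le> 0)"

definition conf_hessian :: "(real^'n \<Rightarrow> real) \<Rightarrow> real^'n \<Rightarrow> real^'n^'n" where
  "conf_hessian u x =
     (let n = real CARD('n) in
        (- (2 / (n - 2)) * u x powr (- ((n + 2) / (n - 2)))) *\<^sub>R hessian u x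
      + (2 * n / (n - 2)^2 * u x powr (- (2 * n / (n - 2)))) *\<^sub>R
          (\<chi> i j. gradient u x $ i * gradient u x $ j)
      - (2 / (n - 2)^2 * u x powr (- (2 * n / (n - 2))) * (norm (gradient u x))^2) *\<^sub>R mat 1)"

definition weak_solution ::
  "(real^'n^'n) set \<Rightarrow> (real^'n^'n \<Rightarrow> real) \<Rightarrow> (real^'n) set \<Rightarrow> (real^'n \<Rightarrow> real) \<Rightarrow> bool" where
  "weak_solution U F \<Omega> u \<longleftrightarrow>
     open \<Omega> \<and> continuous_on \<Omega> u \<and> (\<forall>x\<in>\<Omega>. 0 < u x) \<and>
     (\<exists>(v :: nat \<Rightarrow> real^'n \<Rightarrow> real) (\<beta> :: nat \<Rightarrow> real^'n \<Rightarrow> real^'n^'n).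
        (\<forall>i. Ck_on 2 \<Omega> (v i) \<and> continuous_on \<Omega> (\<beta> i) \<and> \<beta> i ` \<Omega> \<subseteq> sym_matrices) \<and>
        (\<forall>i. \<forall>x\<in>\<Omega>. 0 < v i x \<and> conf_hessian (v i) x + \<beta> i x \<in> U) \<and>
        (\<forall>K. compact K \<and> K \<subseteq> \<Omega> \<longrightarrow>
           uniform_limit K v u sequentially \<and>
           uniform_limit K \<beta> (\<lambda>x. 0) sequentially \<and>
           uniform_limit K (\<lambda>i x. F (conf_hessian (v i) x + \<beta> i x)) (\<lambda>x. 0) sequentially))"

definition kelvin :: "(real^'n \<Rightarrow> real) \<Rightarrow> real^'n \<Rightarrow> real \<Rightarrow> real^'n \<Rightarrow> real" where
  "kelvin u x r y =
     r ^ (CARD('n) - 2) / norm (y - x) ^ (CARD('n) - 2) *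
     u (x + (r\<^sup>2 / (norm (y - x))\<^sup>2) *\<^sub>R (y - x))"

definition radially_symmetric_on :: "(real^'n) set \<Rightarrow> real^'n \<Rightarrow> (real^'n \<Rightarrow> real) \<Rightarrow> bool" where
  "radially_symmetric_on \<Omega> p u \<longleftrightarrow> (\<exists>g. \<forall>x\<in>\<Omega>. u x = g (norm (x - p)))"

end

theory Submission
  imports Defs "HOL-Computational_Algebra.Polynomial"
begin

text \<open>
  In terms of \<open>f = u powr (- 2 / (n - 2))\<close> the matrix \<open>A\<^sup>u\<close> becomes \<open>f D\<^sup>2f - \<bar>Df\<bar>\<^sup>2/2 I\<close>, and the Kelvin
  transform becomes \<open>g(y) = (\<bar>y - x\<bar> / r)\<^sup>2 f(y\<^sup>*)\<close> with \<open>y\<^sup>*\<close> the inversion of \<open>y\<close> in the sphere \<open>\<bar>y - x\<bar> = r\<close>.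
  The claim is \<open>g \<le> f\<close> on the ball \<open>\<bar>y - x\<bar> \<le> r\<close>, where \<open>f\<close> is regular and \<open>g\<close> is singular only at \<open>x\<close> and
  at the inverse of the origin, while \<open>g = f\<close> on the boundary.

  If the claim fails, \<open>f\<close> is touched from below by some \<open>t (g + Q)\<close> with \<open>t > 0\<close> and a small
  paraboloid \<open>Q\<close> of negative discriminant. Adding such a \<open>Q\<close> moves the matrix of \<open>g\<close> strictly into \<open>U\<close>. At
  a regular point this is impossible: replace \<open>g\<close> by one of its \<open>C\<^sup>2\<close> approximations, kept fixed, and
  use that \<open>f\<close>, as a limit of approximate solutions with \<open>F \<longlonglongrightarrow> 0\<close>, is a viscosity subsolution. At a
  singular point, tilting \<open>Q\<close> by small linear functions shows that \<open>f - t (g + Q)\<close> grows linearly,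
  which is excluded by the superharmonicity of the Kelvin transform of \<open>u\<close> and the differentiability of \<open>u\<close>.
\<close>

section \<open>Semidefinite matrices and monotonicity of F\<close>

text \<open>The approximations come without any bound on their gradients, so the error matrices
  \<open>\<beta>\<close> must be beaten by a gain that does not depend on the gradient. This is why
  the perturbation is a paraboloid \<open>Q\<close> with \<open>2 \<mu> Q - |DQ|^2 > 0\<close>: this
  number is the same at every point, and half of it is a lower bound for the multiple of the
  identity gained by adding \<open>Q\<close>. The condition is open in the coefficients of
  \<open>Q\<close>, which leaves room to make a contact strict, to shift it and to tilt it. Contact
  is produced by a factor \<open>t\<close> and not by an additive constant because \<open>U\<close>
  is a cone: the matrix of \<open>t\<close> times a function is \<open>t^2\<close> times its matrix.
  The factor also keeps contact off the sphere, where \<open>f = g\<close>: a failure of the claim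
  puts \<open>t\<close> below some \<open>\<tau> < 1\<close> fixed before \<open>Q\<close>, and
  \<open>Q\<close> is chosen small compared with \<open>1 - \<tau>\<close>. In dimension at least
  three a point is negligible for bounded subharmonic functions, so linear bounds for
  \<open>g\<close> on a small sphere pass to its punctured interior. This is all that is known of
  \<open>g\<close> near its singular points.\<close>

definition outer :: "real^'n \<Rightarrow> real^'n \<Rightarrow> real^'n^'n" where
  "outer p q = (\<chi> i j. p $ i * q $ j)"

lemma outer_mult: "outer p q *v h = (q \<bullet> h) *\<^sub>R p"
  by (simp add: outer_def matrix_vector_mult_def vec_eq_iff inner_vec_def sum_distrib_left
      sum_distrib_right mult_ac)

lemma mat_mult_minus: "(- A) *v h = - (A *v (h::real^'n))"
  using scaleR_matrix_vector_assoc[of "-1" A h] by simp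

lemmas mat_mult_simps = matrix_vector_mult_add_rdistrib scaleR_matrix_vector_assoc[symmetric]
  matrix_vector_mult_diff_rdistrib mat_mult_minus outer_mult matrix_vector_mul_lid

lemma sym_matrices_iff: "M \<in> sym_matrices \<longleftrightarrow> (\<forall>i j. M $ i $ j = M $ j $ i)"
  unfolding sym_matrices_def by (auto simp: vec_eq_iff transpose_def)

lemma sym_matrices_add [intro]: "M \<in> sym_matrices \<Longrightarrow> N \<in> sym_matrices \<Longrightarrow> M + N \<in> sym_matrices"
  and sym_matrices_diff [intro]: "M \<in> sym_matrices \<Longrightarrow> N \<in> sym_matrices \<Longrightarrow> M - N \<in> sym_matrices"
  and sym_matrices_scaleR [intro]: "M \<in> sym_matrices \<Longrightarrow> c *\<^sub>R M \<in> sym_matrices"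
  and sym_matrices_mat [intro]: "mat 1 \<in> sym_matrices"
  and sym_matrices_outer [intro]: "outer p p \<in> sym_matrices"
  unfolding sym_matrices_iff vector_add_component vector_minus_component vector_scaleR_component
    mat_def outer_def vec_lambda_beta by (metis mult.commute)+

lemma sym_matrices_inner: "M \<in> sym_matrices \<Longrightarrow> x \<bullet> (M *v y) = (M *v x) \<bullet> y"
  by (metis (mono_tags) mem_Collect_eq sym_matrices_def dot_lmul_matrix vector_transpose_matrix)

lemma norm_matrix_vector_mult_le: "norm (B *v h) \<le> norm (B :: real^'n^'n) * norm h"
proof -
  have "norm (B *v h) = L2_set (\<lambda>i. \<bar>B $ i \<bullet> h\<bar>) UNIV"
    by (simp add: norm_vec_def matrix_vector_mul_component)
  also have "\<dots> \<le> L2_set (\<lambda>i. norm (B $ i) * norm h) UNIV"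
    by (intro L2_set_mono Cauchy_Schwarz_ineq2) auto
  also have "\<dots> = norm B * norm h"
    by (simp add: norm_vec_def[of B] L2_set_left_distrib)
  finally show ?thesis .
qed

lemma abs_quadratic_form_le: "\<bar>h \<bullet> (B *v h)\<bar> \<le> norm (B :: real^'n^'n) * (norm h)\<^sup>2"
proof -
  have "\<bar>h \<bullet> (B *v h)\<bar> \<le> norm h * norm (B *v h)" by (rule Cauchy_Schwarz_ineq2)
  also have "\<dots> \<le> norm h * (norm B * norm h)"
    by (intro mult_left_mono norm_matrix_vector_mult_le) auto
  finally show ?thesis by (simp add: power2_eq_square mult_ac)
qed

definition pos_semidef :: "real^'n^'n \<Rightarrow> bool" where
  "pos_semidef N \<longleftrightarrow> N \<in> sym_matrices \<and> (\<forall>x. 0 \<le> x \<bullet> (N *v x))"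

lemma inner_outer_sum: "(\<Sum>i\<in>UNIV. \<Sum>j\<in>UNIV. P $ i $ j * outer v v $ i $ j) = v \<bullet> (P *v v)"
  by (simp add: outer_def inner_vec_def matrix_vector_mult_def sum_distrib_left mult_ac)

text \<open>Peeling off one rank-one term per index, as in the Cholesky decomposition, reduces the
  pairing of two semidefinite matrices to the values of one of the two quadratic forms.\<close>

lemma pos_semidef_pairing_aux:
  fixes P N :: "real^'n^'n"
  assumes "finite K" and P: "\<And>x. 0 \<le> x \<bullet> (P *v x)" and "pos_semidef N"
    and "\<And>i j. N $ i $ j \<noteq> 0 \<Longrightarrow> i \<in> K \<and> j \<in> K"
  shows "0 \<le> (\<Sum>i\<in>UNIV. \<Sum>j\<in>UNIV. P $ i $ j * N $ i $ j)"
  using assms(1,3,4)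
proof (induction K arbitrary: N rule: finite_induct)
  case empty
  then have "N = 0" by (auto simp: vec_eq_iff)
  then show ?case by simp
next
  case (insert k K)
  have sym: "N \<in> sym_matrices" and psd: "\<And>x. 0 \<le> x \<bullet> (N *v x)"
    using insert.prems by (auto simp: pos_semidef_def)
  have symc: "N $ i $ j = N $ j $ i" for i j using sym by (simp add: sym_matrices_iff)
  have ax: "axis i 1 \<bullet> (N *v axis j 1) = N $ i $ j" for i j
    by (simp add: inner_axis' matrix_vector_mul_component inner_axis)
  show ?case
  proof (cases "N $ k $ k = 0")
    case True
    have "N $ k $ j = 0" for j
    proof (rule ccontr)
      assume nz: "N $ k $ j \<noteq> 0"
      \<comment> \<open>With a zero diagonal entry at \<open>k\<close> the form along
        \<open>axis j 1 + s *\<^sub>R axis k 1\<close> is affine in \<open>s\<close>; this value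
        makes it equal to -1.\<close>
      define s where "s = - (N $ j $ j + 1) / (2 * N $ k $ j)"
      have "0 \<le> (axis j 1 + s *\<^sub>R axis k 1) \<bullet> (N *v (axis j 1 + s *\<^sub>R axis k 1))"
        by (rule psd)
      also have "\<dots> = N $ j $ j + s * N $ j $ k + s * N $ k $ j + s * s * N $ k $ k"
        by (simp add: matrix_vector_right_distrib matrix_vector_mult_scaleR inner_add_left
            inner_add_right ax algebra_simps)
      also have "\<dots> = N $ j $ j + 2 * s * N $ k $ j" using True symc[of j k] by simp
      also have "\<dots> = -1" using nz by (simp add: s_def field_simps)
      finally show False by simp
    qed
    then have "\<And>i j. N $ i $ j \<noteq> 0 \<Longrightarrow> i \<in> K \<and> j \<in> K"
      using insert.prems(2) symc by (metis insertE)
    then show ?thesis using insert.IH insert.prems(1) by blast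
  next
    case False
    define a where "a = N $ k $ k"
    have a: "a > 0" using psd[of "axis k 1"] False by (simp add: ax a_def)
    define v where "v = N *v axis k 1"
    have vi: "v $ i = N $ i $ k" for i
      by (simp add: v_def matrix_vector_mul_component inner_axis)
    \<comment> \<open>The Schur complement of the entry \<open>a\<close>: its form at
      \<open>h\<close> is the minimum over \<open>c\<close> of the form of \<open>N\<close> at
      \<open>h - c *\<^sub>R axis k 1\<close>, hence still nonnegative, and its row and column
      \<open>k\<close> vanish.\<close>
    define N' where "N' = N - (1/a) *\<^sub>R outer v v"
    have "0 \<le> h \<bullet> (N' *v h)" for h
    proof -
      define c where "c = (v \<bullet> h) / a"
      have hv: "h \<bullet> (N *v axis k 1) = v \<bullet> h" by (simp add: v_def inner_commute)
      have vh: "axis k 1 \<bullet> (N *v h) = v \<bullet> h"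
        using sym_matrices_inner[OF sym, of "axis k 1" h] by (simp add: v_def)
      have "0 \<le> (h - c *\<^sub>R axis k 1) \<bullet> (N *v (h - c *\<^sub>R axis k 1))" by (rule psd)
      also have "\<dots> = h \<bullet> (N *v h) - c * (v \<bullet> h) - c * (v \<bullet> h) + c * c * a"
        by (simp add: matrix_vector_mult_diff_distrib matrix_vector_mult_scaleR inner_diff_left
            inner_diff_right ax hv vh algebra_simps a_def)
      also have "\<dots> = h \<bullet> (N' *v h)"
        using a by (simp add: N'_def mat_mult_simps inner_diff_right c_def field_simps inner_commute)
      finally show ?thesis .
    qed
    then have psd': "pos_semidef N'" using sym by (auto simp: pos_semidef_def N'_def)
    have supp: "i \<in> K \<and> j \<in> K" if "N' $ i $ j \<noteq> 0" for i j
    proof -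
      have e: "N' $ i $ j = N $ i $ j - N $ i $ k * N $ j $ k / a"
        by (simp add: N'_def outer_def vi)
      have "i \<noteq> k" "j \<noteq> k" using that e a symc[of i k] symc[of j k] by (auto simp: a_def)
      moreover have "N $ i $ j \<noteq> 0 \<or> (N $ i $ k \<noteq> 0 \<and> N $ j $ k \<noteq> 0)"
        using that e by auto
      ultimately show ?thesis using insert.prems(2) by blast
    qed
    have "(\<Sum>i\<in>UNIV. \<Sum>j\<in>UNIV. P $ i $ j * N $ i $ j)
       = (\<Sum>i\<in>UNIV. \<Sum>j\<in>UNIV. P $ i $ j * N' $ i $ j) + (1/a) * (v \<bullet> (P *v v))"
      unfolding inner_outer_sum[symmetric] sum_distrib_left sum.distrib[symmetric]
      by (simp add: N'_def algebra_simps)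
    then show ?thesis using insert.IH[OF psd' supp] P[of v] a by simp
  qed
qed

lemma pos_semidef_pairing:
  fixes P N :: "real^'n^'n"
  assumes "pos_def_matrix P" "pos_semidef N"
  shows "0 \<le> (\<Sum>i\<in>UNIV. \<Sum>j\<in>UNIV. P $ i $ j * N $ i $ j)"
proof (rule pos_semidef_pairing_aux[OF finite _ assms(2)])
  show "0 \<le> x \<bullet> (P *v x)" for x
    using assms(1) by (cases "x = 0") (auto simp: pos_def_matrix_def less_imp_le)
qed auto

text \<open>The matrices on the right are the directions along which \<open>matrix_partials\<close>
  differentiates, so that a differential applied to a symmetric matrix can be expressed through the
  entries of \<open>matrix_partials\<close>.\<close>

lemma matrix_symmetrised_units:
  fixes N :: "real^'n^'n"
  assumes "N \<in> sym_matrices"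
  shows "N = (\<Sum>i\<in>UNIV. \<Sum>j\<in>UNIV. N $ i $ j *\<^sub>R ((1/2) *\<^sub>R (matrix_unit i j + matrix_unit j i)))"
proof -
  have u: "(matrix_unit i j :: real^'n^'n) $ k $ l = (if i = k \<and> j = l then 1 else 0)"
    for i j k l :: 'n by (auto simp: matrix_unit_def)
  have 1: "(\<Sum>i\<in>UNIV. \<Sum>j\<in>UNIV. N $ i $ j * (matrix_unit i j :: real^'n^'n) $ k $ l) = N $ k $ l" for k l
  proof -
    have "(\<Sum>j\<in>UNIV. N $ i $ j * (matrix_unit i j :: real^'n^'n) $ k $ l)
        = (if i = k then N $ i $ l else 0)" for i
      unfolding u by (cases "i = k") (simp_all add: mult_delta_right)
    then show ?thesis by simp
  qed
  have 2: "(\<Sum>i\<in>UNIV. \<Sum>j\<in>UNIV. N $ i $ j * (matrix_unit j i :: real^'n^'n) $ k $ l) = N $ k $ l" for k l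
  proof -
    have "(\<Sum>j\<in>UNIV. N $ i $ j * (matrix_unit j i :: real^'n^'n) $ k $ l)
        = (if i = l then N $ i $ k else 0)" for i
      unfolding u by (cases "i = l") (simp_all add: mult_delta_right)
    then have "(\<Sum>i\<in>UNIV. \<Sum>j\<in>UNIV. N $ i $ j * (matrix_unit j i :: real^'n^'n) $ k $ l) = N $ l $ k"
      by simp
    then show ?thesis using assms unfolding sym_matrices_iff by metis
  qed
  show ?thesis
  proof (subst vec_eq_iff, subst vec_eq_iff, intro allI)
    fix k l
    have "(\<Sum>i\<in>UNIV. \<Sum>j\<in>UNIV. N $ i $ j *\<^sub>R ((1/2) *\<^sub>R (matrix_unit i j + matrix_unit j i))) $ k $ l
      = (\<Sum>i\<in>UNIV. \<Sum>j\<in>UNIV. N $ i $ j * (matrix_unit i j :: real^'n^'n) $ k $ l * (1/2)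
          + N $ i $ j * (matrix_unit j i :: real^'n^'n) $ k $ l * (1/2))"
      by (simp add: distrib_left add_divide_distrib)
    also have "\<dots> = N $ k $ l"
      unfolding sum.distrib sum_distrib_right[symmetric] 1 2 by simp
    finally show "N $ k $ l = (\<Sum>i\<in>UNIV. \<Sum>j\<in>UNIV.
        N $ i $ j *\<^sub>R ((1/2) *\<^sub>R (matrix_unit i j + matrix_unit j i))) $ k $ l" by simp
  qed
qed

lemma matrix_unit_sym: "(1/2) *\<^sub>R (matrix_unit i j + matrix_unit j i :: real^'n^'n) \<in> sym_matrices"
proof -
  have u: "(matrix_unit i j :: real^'n^'n) $ k $ l = (matrix_unit j i :: real^'n^'n) $ l $ k" for i j k l
    unfolding matrix_unit_def by (simp add: conj_commute)
  show ?thesis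
    unfolding sym_matrices_iff vector_scaleR_component vector_add_component
    using u[of i j] u[of j i] by (simp only: add.commute) simp
qed

section \<open>The cone \<open>U\<close> and the monotonicity of \<open>F\<close> along semidefinite
  directions\<close>

locale elliptic_cone =
  fixes U :: "(real^'n^'n) set" and F :: "real^'n^'n \<Rightarrow> real"
  assumes U_open: "openin (top_of_set sym_matrices) U"
    and F_C1: "C1_on_sym U F"
    and U_inv: "\<And>Q :: real^'n^'n. orthogonal_matrix Q \<Longrightarrow> (\<lambda>M. matrix_inv Q ** M ** Q) ` U = U"
    and U_add: "\<And>M N. M \<in> U \<Longrightarrow> pos_def_matrix N \<Longrightarrow> M + N \<in> U"
    and U_cone: "\<And>M a. M \<in> U \<Longrightarrow> 0 < a \<Longrightarrow> a *\<^sub>R M \<in> U"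
    and F_ellip: "\<And>M. M \<in> U \<Longrightarrow> pos_def_matrix (matrix_partials F M)"
    and F_pos: "\<And>M. M \<in> U \<Longrightarrow> 0 < F M"
begin

lemma U_sym: "M \<in> U \<Longrightarrow> M \<in> sym_matrices"
  using U_open openin_imp_subset by fastforce

lemma U_nhd:
  assumes "M \<in> U"
  obtains e where "e > 0" "\<And>N. N \<in> sym_matrices \<Longrightarrow> dist N M < e \<Longrightarrow> N \<in> U"
  using U_open assms that unfolding openin_euclidean_subtopology_iff by metis

lemma open_line_in_U:
  assumes "N \<in> sym_matrices" "M \<in> sym_matrices"
  shows "open {t::real. M + t *\<^sub>R N \<in> U}"
proof -
  obtain S where S: "open S" "U = sym_matrices \<inter> S" using U_open openin_open by blast
  have "{t::real. M + t *\<^sub>R N \<in> U} = (\<lambda>t. M + t *\<^sub>R N) -` S" using S(2) assms by auto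
  moreover have "open \<dots>" by (intro open_vimage S continuous_intros)
  ultimately show ?thesis by simp
qed

text \<open>On a line of symmetric matrices the parameters that stay in \<open>U\<close> form an
  open set, so the derivative within \<open>U\<close> is an ordinary one along the line.
  \<open>M0\<close> and \<open>t\<close> are left free so that a single \<open>F'\<close> serves
  both for the partial derivatives at \<open>M\<close> and for a line through \<open>M\<close> that
  starts elsewhere.\<close>

lemma F_has_derivative:
  assumes "M \<in> U"
  obtains F' where "linear F'"
    "\<And>N t M0. N \<in> sym_matrices \<Longrightarrow> M = M0 + t *\<^sub>R N \<Longrightarrow> M0 \<in> sym_matrices \<Longrightarrow>
      ((\<lambda>s. F (M0 + s *\<^sub>R N)) has_real_derivative F' N) (at t)"
proof -
  obtain F' where F': "(F has_derivative F') (at M within U)"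
    using F_C1 assms by (auto simp: C1_on_sym_def differentiable_def)
  have lin: "linear F'" using F' has_derivative_linear by blast
  have "((\<lambda>s. F (M0 + s *\<^sub>R N)) has_real_derivative F' N) (at t)"
    if "N \<in> sym_matrices" and eq: "M = M0 + t *\<^sub>R N" "M0 \<in> sym_matrices" for N t M0
  proof -
    let ?S = "{s::real. M0 + s *\<^sub>R N \<in> U}"
    have "open ?S" using open_line_in_U that by blast
    have "t \<in> ?S" using eq assms by simp
    have 1: "((\<lambda>s. M0 + s *\<^sub>R N) has_derivative (\<lambda>s. s *\<^sub>R N)) (at t within ?S)"
      by (auto intro!: derivative_eq_intros)
    have 2: "(F has_derivative F') (at (M0 + t *\<^sub>R N) within (\<lambda>s. M0 + s *\<^sub>R N) ` ?S)"
      using F' eq by (auto intro: has_derivative_subset)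
    have "((\<lambda>s. F (M0 + s *\<^sub>R N)) has_derivative (\<lambda>s. F' (s *\<^sub>R N))) (at t within ?S)"
      using diff_chain_within[OF 1 2] by (simp add: o_def)
    then have "((\<lambda>s. F (M0 + s *\<^sub>R N)) has_derivative (\<lambda>s. F' (s *\<^sub>R N))) (at t)"
      using at_within_open[OF \<open>t \<in> ?S\<close> \<open>open ?S\<close>] by simp
    then show ?thesis
      by (simp add: has_field_derivative_def linear_cmul[OF lin] mult_commute_abs)
  qed
  then show thesis using lin that by blast
qed

text \<open>A small multiple of the identity is moved from \<open>M\<close>, which stays in
  \<open>U\<close> by openness, to \<open>N\<close>, which becomes positive definite.\<close>

lemma U_add_semidef:
  assumes "M \<in> U" "pos_semidef N"
  shows "M + N \<in> U"
proof -
  obtain e where e: "e > 0" "\<And>N. N \<in> sym_matrices \<Longrightarrow> dist N M < e \<Longrightarrow> N \<in> U"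
    using U_nhd assms(1) by blast
  define K where "K = norm (mat 1 :: real^'n^'n) + 1"
  have K: "K > 0" by (simp add: K_def add_nonneg_pos)
  define d where "d = e / (2 * K)"
  have d: "d > 0" using e K by (simp add: d_def)
  have "d * norm (mat 1 :: real^'n^'n) \<le> d * K" using d by (simp add: K_def)
  also have "\<dots> < e" using K e by (simp add: d_def)
  finally have "M - d *\<^sub>R mat 1 \<in> U"
    using U_sym[OF assms(1)] d by (intro e(2)) (auto simp: dist_norm)
  moreover have "pos_def_matrix (N + d *\<^sub>R mat 1)"
    using assms(2) d
    by (auto simp: pos_def_matrix_def pos_semidef_def mat_mult_simps inner_add_right
        add_nonneg_pos)
  ultimately have "(M - d *\<^sub>R mat 1) + (N + d *\<^sub>R mat 1) \<in> U" by (rule U_add)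
  then show ?thesis by simp
qed

text \<open>The derivative of \<open>F\<close> along the segment is the pairing of the positive
  definite matrix of partial derivatives with \<open>N\<close>.\<close>

lemma F_mono:
  assumes M: "M \<in> U" and N: "pos_semidef N"
  shows "F M \<le> F (M + N)"
proof -
  have symN: "N \<in> sym_matrices" using N by (simp add: pos_semidef_def)
  have inU: "M + t *\<^sub>R N \<in> U" if "0 \<le> t" for t
    using N that by (intro U_add_semidef M) (auto simp: pos_semidef_def mat_mult_simps)
  have "F (M + 0 *\<^sub>R N) \<le> F (M + 1 *\<^sub>R N)"
  proof (rule DERIV_nonneg_imp_nondecreasing[of 0 1 "\<lambda>t. F (M + t *\<^sub>R N)"])
    fix t :: real assume t: "0 \<le> t" "t \<le> 1"
    define X where "X = M + t *\<^sub>R N"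
    have X: "X \<in> U" using inU t by (simp add: X_def)
    obtain F' where lin: "linear F'" and
      F': "\<And>N t M0. N \<in> sym_matrices \<Longrightarrow> X = M0 + t *\<^sub>R N \<Longrightarrow> M0 \<in> sym_matrices \<Longrightarrow>
        ((\<lambda>s. F (M0 + s *\<^sub>R N)) has_real_derivative F' N) (at t)"
    proof (rule F_has_derivative[OF X], goal_cases)
      case (1 F')
      show ?case by (rule 1(1)[OF 1(2) 1(3)])
    qed
    let ?E = "\<lambda>i j. (1/2) *\<^sub>R (matrix_unit i j + matrix_unit j i) :: real^'n^'n"
    have partials: "F' (?E i j) = matrix_partials F X $ i $ j" for i j
      using DERIV_imp_deriv[OF F'[OF matrix_unit_sym, of X 0 i j]] U_sym[OF X]
      by (simp add: matrix_partials_def)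
    have "F' N = F' (\<Sum>i\<in>UNIV. \<Sum>j\<in>UNIV. N $ i $ j *\<^sub>R ?E i j)"
      using matrix_symmetrised_units[OF symN] by (rule arg_cong)
    also have "\<dots> = (\<Sum>i\<in>UNIV. \<Sum>j\<in>UNIV. matrix_partials F X $ i $ j * N $ i $ j)"
      
    proof -
      have "F' (N $ i $ j *\<^sub>R ?E i j) = matrix_partials F X $ i $ j * N $ i $ j" for i j
        using linear_cmul[OF lin, of "N $ i $ j" "?E i j"] unfolding partials by (simp only: real_scaleR_def mult.commute)
      then show ?thesis unfolding linear_sum[OF lin] by presburger
    qed
    also have "\<dots> \<ge> 0"
      by (intro pos_semidef_pairing F_ellip X N)
    finally have "F' N \<ge> 0" .
    then show "\<exists>y. ((\<lambda>t. F (M + t *\<^sub>R N)) has_real_derivative y) (at t) \<and> 0 \<le> y"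
      using F'[OF symN X_def U_sym[OF M]] by blast
  qed simp
  then show ?thesis by simp
qed

end

section \<open>Second-order jets\<close>

lemma eventually_norm_less: "d > 0 \<Longrightarrow> \<forall>\<^sub>F h in nhds (0::'a::real_normed_vector). norm h < d"
  unfolding eventually_nhds_metric by (auto simp: dist_norm)

lemma eventually_shift:
  assumes "open S" "(y::'a::real_normed_vector) \<in> S"
  shows "\<forall>\<^sub>F h in nhds 0. y + h \<in> S"
proof -
  have "((\<lambda>h. y + h) \<longlongrightarrow> y + 0) (nhds 0)" by (intro tendsto_intros filterlim_ident)
  then show ?thesis using topological_tendstoD[OF _ assms(1)] assms(2) by fastforce
qed

text \<open>The second-order superjet of viscosity theory, with the error \<open>o(|h|^2)\<close>
  written out. Symmetry of \<open>H\<close> is left to the statements that require it.\<close>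

definition superjet :: "(real^'n \<Rightarrow> real) \<Rightarrow> real^'n \<Rightarrow> real^'n \<Rightarrow> real^'n^'n \<Rightarrow> bool" where
  "superjet f y p H \<longleftrightarrow> (\<forall>e>0. \<forall>\<^sub>F h in nhds 0.
     f (y + h) \<le> f y + p \<bullet> h + (h \<bullet> (H *v h)) / 2 + e * (norm h)\<^sup>2)"

definition subjet :: "(real^'n \<Rightarrow> real) \<Rightarrow> real^'n \<Rightarrow> real^'n \<Rightarrow> real^'n^'n \<Rightarrow> bool" where
  "subjet f y p H \<longleftrightarrow> superjet (\<lambda>x. - f x) y (- p) (- H)"

lemma subjet_iff: "subjet f y p H \<longleftrightarrow> (\<forall>e>0. \<forall>\<^sub>F h in nhds 0.
     f y + p \<bullet> h + (h \<bullet> (H *v h)) / 2 - e * (norm h)\<^sup>2 \<le> f (y + h))"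
proof -
  have "(- f (y + h) \<le> - f y + - p \<bullet> h + (h \<bullet> (- H *v h)) / 2 + e * (norm h)\<^sup>2) \<longleftrightarrow>
     (f y + p \<bullet> h + (h \<bullet> (H *v h)) / 2 - e * (norm h)\<^sup>2 \<le> f (y + h))" for h e
    by (auto simp: mat_mult_minus)
  then show ?thesis unfolding subjet_def superjet_def by simp
qed

text \<open>A gradient near \<open>y\<close> that is differentiable at \<open>y\<close> suffices:
  the remainder \<open>r\<close> has gradient \<open>g (y + k) - g y - G k\<close>, of norm at most
  \<open>e * norm h\<close> on the ball of radius \<open>norm h\<close>, and the mean value
  inequality gives the second factor \<open>norm h\<close>. The general inner product space covers
  both functions on the space and functions of one real variable.\<close>

lemma taylor2_peano:
  fixes f :: "'a::real_inner \<Rightarrow> real"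
  assumes f: "\<forall>\<^sub>F x in nhds y. (f has_derivative (\<lambda>h. g x \<bullet> h)) (at x)"
    and g: "(g has_derivative G) (at y)"
    and sym: "\<And>a b. a \<bullet> G b = G a \<bullet> b" and e: "e > 0"
  shows "\<forall>\<^sub>F h in nhds 0. \<bar>f (y + h) - f y - g y \<bullet> h - (h \<bullet> G h) / 2\<bar> \<le> e * (norm h)\<^sup>2"
proof -
  obtain d0 where d0: "d0 > 0" "\<And>x. dist x y < d0 \<Longrightarrow> (f has_derivative (\<lambda>h. g x \<bullet> h)) (at x)"
    using f unfolding eventually_nhds_metric by blast
  obtain d1 where d1: "d1 > 0" "\<And>x. norm (x - y) < d1 \<Longrightarrow>
      norm (g x - g y - G (x - y)) \<le> e * norm (x - y)"
    using g e unfolding has_derivative_at_alt by blast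
  have bl: "bounded_linear G" using g by (rule has_derivative_bounded_linear)
  show ?thesis unfolding eventually_nhds_metric
  proof (intro exI[of _ "min d0 d1"] conjI allI impI)
    show "0 < min d0 d1" using d0 d1 by simp
    fix h :: 'a assume h: "dist h 0 < min d0 d1"
    define r where "r k = f (y + k) - g y \<bullet> k - (k \<bullet> G k) / 2" for k
    have "norm (r h - r 0) \<le> (e * norm h) * norm (h - 0)"
    proof (rule differentiable_bound[where S = "cball 0 (norm h)"])
      show "(r has_derivative (\<lambda>v. (g (y + k) - g y - G k) \<bullet> v)) (at k within cball 0 (norm h))"
        if "k \<in> cball 0 (norm h)" for k
      proof (rule has_derivative_at_withinI)
        have "dist (y + k) y < d0" using that h by (simp add: dist_norm)
        then have 1: "(f has_derivative (\<lambda>v. g (y + k) \<bullet> v)) (at (y + k))" by (rule d0)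
        have 2: "((\<lambda>k. f (y + k)) has_derivative (\<lambda>v. g (y + k) \<bullet> v)) (at k)"
          by (rule has_derivative_compose[where f = "\<lambda>k. y + k" and f' = "\<lambda>v. v" and g = f, OF _ 1])
             (rule has_derivative_add[OF has_derivative_const has_derivative_ident, simplified])
        have 3: "((\<lambda>k. k \<bullet> G k) has_derivative (\<lambda>v. k \<bullet> G v + v \<bullet> G k)) (at k)"
          by (rule has_derivative_inner[OF has_derivative_ident bounded_linear_imp_has_derivative[OF bl]])
        have "(r has_derivative (\<lambda>v. g (y + k) \<bullet> v - g y \<bullet> v - (k \<bullet> G v + v \<bullet> G k) / 2)) (at k)"
          unfolding r_def
          by (intro has_derivative_diff 2 bounded_linear.has_derivative[OF bounded_linear_divide 3]
              bounded_linear_imp_has_derivative[OF bounded_linear_inner_right])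
        moreover have "(k \<bullet> G v + v \<bullet> G k) / 2 = G k \<bullet> v" for v
          using sym[of k v] by (simp add: inner_commute)
        ultimately show "(r has_derivative (\<lambda>v. (g (y + k) - g y - G k) \<bullet> v)) (at k)"
          by (simp add: inner_diff_left)
      qed
      show "onorm (\<lambda>v. (g (y + k) - g y - G k) \<bullet> v) \<le> e * norm h" if "k \<in> cball 0 (norm h)" for k
      proof (rule onorm_bound)
        show "0 \<le> e * norm h" using e by simp
        fix v
        have "norm (g (y + k) - g y - G k) \<le> e * norm k" using d1(2)[of "y + k"] that h by simp
        also have "\<dots> \<le> e * norm h" using that e by simp
        finally have "norm (g (y + k) - g y - G k) \<le> e * norm h" .
        then show "norm ((g (y + k) - g y - G k) \<bullet> v) \<le> e * norm h * norm v"
          unfolding real_norm_def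
          using order_trans[OF Cauchy_Schwarz_ineq2 mult_right_mono[OF _ norm_ge_zero]] by blast
      qed
    qed auto
    moreover have "r h - r 0 = f (y + h) - f y - g y \<bullet> h - (h \<bullet> G h) / 2"
      by (simp add: r_def)
    ultimately show "\<bar>f (y + h) - f y - g y \<bullet> h - (h \<bullet> G h) / 2\<bar> \<le> e * (norm h)\<^sup>2"
      by (simp add: power2_eq_square)
  qed
qed

lemma frechet_gradient:
  assumes "v differentiable (at x)"
  shows "(v has_derivative (\<lambda>h. gradient v x \<bullet> h)) (at x)"
proof -
  have d: "(v has_derivative frechet_derivative v (at x)) (at x)"
    using assms frechet_derivative_works by blast
  then have lin: "linear (frechet_derivative v (at x))" by (rule has_derivative_linear)
  have "frechet_derivative v (at x) h = gradient v x \<bullet> h" for h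
  proof -
    have "frechet_derivative v (at x) h = frechet_derivative v (at x) (\<Sum>i\<in>UNIV. h $ i *s axis i 1)"
      by (simp add: basis_expansion)
    also have "\<dots> = (\<Sum>i\<in>UNIV. h $ i * partial i v x)"
      unfolding scalar_mult_eq_scaleR linear_sum[OF lin] linear_cmul[OF lin] partial_def by simp
    finally show ?thesis by (simp add: gradient_def inner_vec_def mult.commute)
  qed
  then show ?thesis using d by presburger
qed

text \<open>Symmetry of the Hessian is an assumption. In the application it is read off from the
  symmetry of the elements of \<open>U\<close> and of the error matrices.\<close>

lemma Ck2_taylor:
  assumes v: "Ck_on 2 \<Omega> v" and \<Omega>: "open \<Omega>" "y \<in> \<Omega>" and sym: "hessian v y \<in> sym_matrices"
    and e: "e > 0"
  shows "\<forall>\<^sub>F h in nhds 0. \<bar>v (y + h) - v y - gradient v y \<bullet> h - (h \<bullet> (hessian v y *v h)) / 2\<bar>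
     \<le> e * (norm h)\<^sup>2"
proof (rule taylor2_peano[where g = "gradient v", OF _ _ _ e])
  have v1: "\<And>x. x \<in> \<Omega> \<Longrightarrow> v differentiable (at x)"
    and v2: "\<And>i x. x \<in> \<Omega> \<Longrightarrow> partial i v differentiable (at x)"
    using v by (auto simp: numeral_2_eq_2)
  show "\<forall>\<^sub>F x in nhds y. (v has_derivative (\<lambda>h. gradient v x \<bullet> h)) (at x)"
    using eventually_nhds_in_open[OF \<Omega>] by eventually_elim (auto intro: frechet_gradient v1)
  show "(gradient v has_derivative (\<lambda>h. hessian v y *v h)) (at y)"
  proof (rule has_derivative_componentwise_within[THEN iffD2], rule ballI)
    fix b :: "real^'a" assume "b \<in> Basis"
    then obtain i where b: "b = axis i 1" by (auto simp: Basis_vec_def)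
    have 1: "(\<lambda>x. gradient v x \<bullet> b) = partial i v"
      by (simp add: b inner_axis gradient_def)
    have 2: "(hessian v y *v h) \<bullet> b = gradient (partial i v) y \<bullet> h" for h
    proof -
      have "hessian v y $ i $ j = partial j (partial i v) y" for j
      proof -
        have "hessian v y $ i $ j = hessian v y $ j $ i" using sym unfolding sym_matrices_iff by blast
        then show ?thesis by (simp add: hessian_def)
      qed
      moreover have "(hessian v y *v h) \<bullet> b = (\<Sum>j\<in>UNIV. hessian v y $ i $ j * h $ j)"
        by (simp add: b inner_axis matrix_vector_mult_def)
      ultimately show ?thesis by (simp add: gradient_def inner_vec_def)
    qed
    show "((\<lambda>x. gradient v x \<bullet> b) has_derivative (\<lambda>x. (hessian v y *v x) \<bullet> b)) (at y)"
      unfolding 1 2 by (rule frechet_gradient[OF v2[OF \<Omega>(2)]])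
  qed
  show "a \<bullet> (hessian v y *v b) = (hessian v y *v a) \<bullet> b" for a b
    by (rule sym_matrices_inner[OF sym])
qed

lemma Ck2_jets:
  assumes v: "Ck_on 2 \<Omega> v" and \<Omega>: "open \<Omega>" "y \<in> \<Omega>" and sym: "hessian v y \<in> sym_matrices"
  shows "superjet v y (gradient v y) (hessian v y)" "subjet v y (gradient v y) (hessian v y)"
  unfolding superjet_def subjet_iff
  by (intro allI impI, drule Ck2_taylor[OF assms], erule eventually_mono, simp add: abs_le_iff)+

section \<open>Jets under decreasing functions and negative powers\<close>

text \<open>A decreasing function turns the lower expansion of \<open>w\<close> into an upper one:
  \<open>w (y + h)\<close> is replaced by its lower bound \<open>s + \<tau> h\<close>, and then
  \<open>T\<close> is expanded at \<open>s\<close>. This carries jets back and forth between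
  \<open>u\<close> and its negative power \<open>f\<close>.\<close>

lemma superjet_compose_antimono:
  fixes w :: "real^'n \<Rightarrow> real" and T :: "real \<Rightarrow> real"
  assumes w: "subjet w y p H" and S: "open S" "w y \<in> S" "\<forall>\<^sub>F h in nhds 0. w (y + h) \<in> S"
    and anti: "\<And>a b. a \<in> S \<Longrightarrow> b \<in> S \<Longrightarrow> a \<le> b \<Longrightarrow> T b \<le> T a" and T': "T' \<le> 0"
    and T: "\<And>e. e > 0 \<Longrightarrow> \<forall>\<^sub>F t in nhds 0. T (w y + t) \<le> T (w y) + T' * t + T'' / 2 * t\<^sup>2 + e * t\<^sup>2"
  shows "superjet (\<lambda>x. T (w x)) y (T' *\<^sub>R p) (T' *\<^sub>R H + T'' *\<^sub>R outer p p)"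
  unfolding superjet_def
proof (intro allI impI)
  fix e :: real assume e: "e > 0"
  define s where "s = w y"
  define K where "K = norm H + 1"
  have K: "K > 0" by (simp add: K_def add_nonneg_pos)
  have Kh: "\<bar>h \<bullet> (H *v h)\<bar> \<le> K * (norm h)\<^sup>2" for h
    using abs_quadratic_form_le[of h H] zero_le_power2[of "norm h"]
    unfolding K_def distrib_right by linarith
  \<comment> \<open>The tolerance is spent in thirds: \<open>e1\<close> on the slack in the lower
    bound for \<open>w\<close>, multiplied by \<open>T'\<close>; \<open>e2\<close> on the Taylor
    error of \<open>T\<close>; and the smallness of \<open>h\<close> on replacing
    \<open>(\<tau> h)\<^sup>2\<close> by \<open>(p \<bullet> h)\<^sup>2\<close>, an error of third
    order with coefficient \<open>C\<close>.\<close>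
  define e1 where "e1 = e / (3 * (\<bar>T'\<bar> + 1))"
  have e1: "e1 > 0" using e by (simp add: e1_def)
  have e1': "\<bar>T'\<bar> * e1 \<le> e / 3"
    using e by (simp add: e1_def field_simps)
  define L where "L = K / 2 + e1"
  define M where "M = norm p + L"
  have LM: "L > 0" "M > 0" using K e1 by (auto simp: L_def M_def add_nonneg_pos)
  define e2 where "e2 = e / (3 * M\<^sup>2)"
  have e2: "e2 > 0" "e2 * M\<^sup>2 = e / 3" using e LM by (auto simp: e2_def)
  define \<tau> where "\<tau> h = p \<bullet> h + (h \<bullet> (H *v h)) / 2 - e1 * (norm h)\<^sup>2" for h
  have \<tau>0: "(\<tau> \<longlongrightarrow> 0) (nhds 0)"
  proof -
    have "(\<tau> \<longlongrightarrow> \<tau> 0) (nhds 0)"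
      unfolding \<tau>_def
      by (intro tendsto_intros bounded_linear.tendsto[OF matrix_vector_mul_bounded_linear]
          tendsto_ident_at filterlim_ident) simp
    then show ?thesis by (simp add: \<tau>_def)
  qed
  define C where "C = \<bar>T''\<bar> / 2 * L * (M + norm p)"
  have C: "C \<ge> 0" using LM by (simp add: C_def)
  define D where "D = C + 1"
  have D: "D > 0" "C \<le> D" using C by (auto simp: D_def)
  have "\<forall>\<^sub>F h in nhds 0. s + \<tau> h \<le> w (y + h)"
    using w e1 unfolding subjet_iff \<tau>_def s_def by (auto elim!: eventually_mono simp: algebra_simps)
  moreover have "\<forall>\<^sub>F h in nhds 0. s + \<tau> h \<in> S"
  proof -
    have "((\<lambda>h. s + \<tau> h) \<longlongrightarrow> s) (nhds 0)"
      using tendsto_add[OF tendsto_const \<tau>0, of s] by simp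
    then show ?thesis using topological_tendstoD S(1,2) s_def by blast
  qed
  moreover note S(3)
  moreover have "\<forall>\<^sub>F h in nhds 0. T (s + \<tau> h) \<le> T s + T' * \<tau> h + T'' / 2 * (\<tau> h)\<^sup>2 + e2 * (\<tau> h)\<^sup>2"
    using eventually_compose_filterlim[OF T[OF e2(1)] \<tau>0] by (simp add: s_def)
  moreover have "\<forall>\<^sub>F h in nhds 0. norm (h::real^'n) < min 1 (e / (3 * D))"
    using e D by (intro eventually_norm_less) simp
  ultimately show "\<forall>\<^sub>F h in nhds 0. T (w (y + h)) \<le> T (w y) + (T' *\<^sub>R p) \<bullet> h
      + (h \<bullet> ((T' *\<^sub>R H + T'' *\<^sub>R outer p p) *v h)) / 2 + e * (norm h)\<^sup>2"
  proof eventually_elim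
    case (elim h)
    define n where "n = norm h"
    have n: "n \<ge> 0" "n \<le> 1" "C * n \<le> e / 3"
    proof -
      show "n \<ge> 0" "n \<le> 1" using elim by (auto simp: n_def)
      have "C * n \<le> D * (e / (3 * D))"
        using elim D e by (intro mult_mono) (auto simp: n_def)
      also have "\<dots> = e / 3" using D by simp
      finally show "C * n \<le> e / 3" .
    qed
    have d: "\<bar>\<tau> h - p \<bullet> h\<bar> \<le> L * n\<^sup>2"
    proof -
      have "0 \<le> e1 * n\<^sup>2" using e1 by simp
      moreover have "\<tau> h - p \<bullet> h = h \<bullet> (H *v h) / 2 - e1 * n\<^sup>2" by (simp add: \<tau>_def n_def)
      moreover have "L * n\<^sup>2 = K * n\<^sup>2 / 2 + e1 * n\<^sup>2" by (simp add: L_def distrib_right)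
      ultimately show ?thesis using Kh[of h] unfolding n_def[symmetric] by linarith
    qed
    have ph: "\<bar>p \<bullet> h\<bar> \<le> norm p * n" unfolding n_def by (rule Cauchy_Schwarz_ineq2)
    have "n\<^sup>2 \<le> n" using n by (simp add: power2_eq_square mult_left_le)
    then have "L * n\<^sup>2 \<le> L * n" using LM by simp
    then have tn: "\<bar>\<tau> h\<bar> \<le> M * n" unfolding M_def distrib_right using d ph by linarith
    have tp: "\<bar>\<tau> h + p \<bullet> h\<bar> \<le> (M + norm p) * n" unfolding distrib_right using tn ph by linarith
    then have t2: "(\<tau> h)\<^sup>2 \<le> M\<^sup>2 * n\<^sup>2"
      using power_mono[OF tn abs_ge_zero, of 2] by (simp add: power_mult_distrib)
    have "\<bar>(\<tau> h)\<^sup>2 - (p \<bullet> h)\<^sup>2\<bar> = \<bar>\<tau> h - p \<bullet> h\<bar> * \<bar>\<tau> h + p \<bullet> h\<bar>"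
      unfolding abs_mult[symmetric] by (simp add: power2_eq_square algebra_simps)
    also have "\<dots> \<le> (L * n\<^sup>2) * ((M + norm p) * n)"
      using d tp LM by (intro mult_mono) auto
    finally have "\<bar>T''\<bar> / 2 * \<bar>(\<tau> h)\<^sup>2 - (p \<bullet> h)\<^sup>2\<bar> \<le> \<bar>T''\<bar> / 2 * ((L * n\<^sup>2) * ((M + norm p) * n))"
      by (intro mult_left_mono) auto
    also have "\<dots> = C * n * n\<^sup>2" by (simp add: C_def mult_ac)
    also have "\<dots> \<le> e / 3 * n\<^sup>2" using n by (intro mult_right_mono) auto
    finally have A1: "T'' / 2 * (\<tau> h)\<^sup>2 \<le> T'' / 2 * (p \<bullet> h)\<^sup>2 + e / 3 * n\<^sup>2"
    proof -
      assume a: "\<bar>T''\<bar> / 2 * \<bar>(\<tau> h)\<^sup>2 - (p \<bullet> h)\<^sup>2\<bar> \<le> e / 3 * n\<^sup>2"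
      have "T'' / 2 * ((\<tau> h)\<^sup>2 - (p \<bullet> h)\<^sup>2) \<le> \<bar>T'' / 2 * ((\<tau> h)\<^sup>2 - (p \<bullet> h)\<^sup>2)\<bar>" by (rule abs_ge_self)
      also have "\<dots> = \<bar>T''\<bar> / 2 * \<bar>(\<tau> h)\<^sup>2 - (p \<bullet> h)\<^sup>2\<bar>" by (simp add: abs_mult)
      finally show ?thesis using a by (simp add: right_diff_distrib)
    qed
    have A2: "e2 * (\<tau> h)\<^sup>2 \<le> e / 3 * n\<^sup>2"
      using mult_left_mono[OF t2 less_imp_le[OF e2(1)]] unfolding mult.assoc[symmetric] e2(2) .
    have A3: "T' * \<tau> h \<le> T' * (p \<bullet> h) + T' * (h \<bullet> (H *v h)) / 2 + e / 3 * n\<^sup>2"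
    proof -
      have "- T' * e1 * n\<^sup>2 \<le> e / 3 * n\<^sup>2" using e1' T' by (intro mult_right_mono) auto
      then show ?thesis by (simp add: \<tau>_def n_def algebra_simps)
    qed
    have "T (w (y + h)) \<le> T (s + \<tau> h)" using elim by (intro anti) auto
    also have "\<dots> \<le> T s + T' * \<tau> h + T'' / 2 * (\<tau> h)\<^sup>2 + e2 * (\<tau> h)\<^sup>2" using elim by simp
    also have "\<dots> \<le> T s + T' * (p \<bullet> h) + T' * (h \<bullet> (H *v h)) / 2 + T'' / 2 * (p \<bullet> h)\<^sup>2 + e * n\<^sup>2"
      using A1 A2 A3 by simp
    finally show ?case
      by (simp add: s_def n_def mat_mult_simps inner_add_right power2_eq_square inner_commute
          add_divide_distrib mult_ac)
  qed
qed

lemma eventually_subjet_pos: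
  assumes "subjet w y p H" "w y > 0"
  shows "\<forall>\<^sub>F h in nhds 0. w (y + h) > 0"
proof -
  define \<tau> where "\<tau> h = w y + p \<bullet> h + (h \<bullet> (H *v h)) / 2 - 1 * (norm h)\<^sup>2" for h
  have "(\<tau> \<longlongrightarrow> \<tau> 0) (nhds 0)"
    unfolding \<tau>_def
    by (intro tendsto_intros bounded_linear.tendsto[OF matrix_vector_mul_bounded_linear]
        tendsto_ident_at filterlim_ident) simp
  then have "\<forall>\<^sub>F h in nhds 0. \<tau> h > 0"
    using order_tendstoD(1)[of \<tau> "\<tau> 0" "nhds 0" 0] assms(2) by (simp add: \<tau>_def)
  moreover have "\<forall>\<^sub>F h in nhds 0. \<tau> h \<le> w (y + h)"
    using assms(1) unfolding subjet_iff \<tau>_def by (elim allE[of _ 1]) simp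
  ultimately show ?thesis by eventually_elim simp
qed

lemma powr_taylor:
  fixes s :: real
  assumes "s > 0" "e > 0"
  shows "\<forall>\<^sub>F t in nhds 0. \<bar>(s + t) powr a - s powr a - (a * s powr (a - 1)) * t
     - (a * (a - 1) * s powr (a - 2)) / 2 * t\<^sup>2\<bar> \<le> e * t\<^sup>2"
proof -
  have d: "((\<lambda>x. x powr b) has_real_derivative b * x powr (b - 1)) (at x)" if "x > 0" for x b :: real
    using that by (auto intro!: derivative_eq_intros)
  have "\<forall>\<^sub>F t in nhds 0. \<bar>(s + t) powr a - s powr a - (a * s powr (a - 1)) \<bullet> t
     - (t \<bullet> ((a * (a - 1) * s powr (a - 2)) * t)) / 2\<bar> \<le> e * (norm t)\<^sup>2"
  proof (rule taylor2_peano[where g = "\<lambda>x. a * x powr (a - 1)"])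
    have "\<forall>\<^sub>F x in nhds s. x > 0"
      using eventually_nhds_in_open[of "{0<..}" s] assms by auto
    then show "\<forall>\<^sub>F x in nhds s. ((\<lambda>x. x powr a) has_derivative (\<bullet>) (a * x powr (a - 1))) (at x)"
      by eventually_elim (use d[of _ a] in \<open>auto simp: has_field_derivative_def\<close>)
    have "((\<lambda>x. a * x powr (a - 1)) has_real_derivative a * ((a - 1) * s powr (a - 1 - 1))) (at s)"
      by (intro DERIV_cmult d assms)
    then show "((\<lambda>x. a * x powr (a - 1)) has_derivative (*) (a * (a - 1) * s powr (a - 2))) (at s)"
      by (simp add: has_field_derivative_def mult.assoc)
  qed (use assms in auto)
  then show ?thesis by eventually_elim (simp add: power2_eq_square mult_ac)
qed

lemma superjet_powr:
  fixes w :: "real^'n \<Rightarrow> real"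
  assumes w: "subjet w y p H" and pos: "w y > 0" and a: "a < 0"
  shows "superjet (\<lambda>x. w x powr a) y ((a * w y powr (a - 1)) *\<^sub>R p)
     ((a * w y powr (a - 1)) *\<^sub>R H + (a * (a - 1) * w y powr (a - 2)) *\<^sub>R outer p p)"
proof (rule superjet_compose_antimono[OF w, where S = "{0<..}"])
  show "\<forall>\<^sub>F h in nhds 0. w (y + h) \<in> {0<..}"
    using eventually_subjet_pos[OF w pos] by simp
  show "d powr a \<le> c powr a" if "c \<in> {0<..}" "d \<in> {0<..}" "c \<le> d" for c d
    using that a by (intro powr_mono2') auto
  show "a * w y powr (a - 1) \<le> 0" using a by (simp add: mult_nonpos_nonneg)
  show "\<forall>\<^sub>F t in nhds 0. (w y + t) powr a \<le> w y powr a + a * w y powr (a - 1) * t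
      + a * (a - 1) * w y powr (a - 2) / 2 * t\<^sup>2 + e * t\<^sup>2" if "e > 0" for e
    using powr_taylor[OF pos that, of a] by eventually_elim linarith
qed (use pos in auto)

text \<open>The composition lemma is applied to \<open>- w\<close> and to the map from
  \<open>c\<close> to \<open>- ((- c) powr a)\<close>, which is again decreasing on the negative
  half-line. A superjet bounds \<open>w\<close> from above only, so positivity near \<open>y\<close>
  has to be supplied.\<close>

lemma subjet_powr:
  fixes w :: "real^'n \<Rightarrow> real"
  assumes w: "superjet w y p H" and pos: "w y > 0" "\<forall>\<^sub>F h in nhds 0. w (y + h) > 0" and a: "a < 0"
  shows "subjet (\<lambda>x. w x powr a) y ((a * w y powr (a - 1)) *\<^sub>R p)
     ((a * w y powr (a - 1)) *\<^sub>R H + (a * (a - 1) * w y powr (a - 2)) *\<^sub>R outer p p)"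
proof -
  have w': "subjet (\<lambda>x. - w x) y (- p) (- H)" using w by (simp add: subjet_def)
  have o: "outer (- p) (- p) = outer p p" by (simp add: outer_def)
  have "superjet (\<lambda>x. - ((- (- w x)) powr a)) y ((a * w y powr (a - 1)) *\<^sub>R - p)
     ((a * w y powr (a - 1)) *\<^sub>R - H + (- (a * (a - 1) * w y powr (a - 2))) *\<^sub>R outer (- p) (- p))"
  proof (rule superjet_compose_antimono[OF w', where S = "{..<0}"])
    show "\<forall>\<^sub>F h in nhds 0. - w (y + h) \<in> {..<0}" using pos by simp
    show "- ((- d) powr a) \<le> - ((- c) powr a)" if "c \<in> {..<0}" "d \<in> {..<0}" "c \<le> d" for c d
      using that a by (auto intro!: powr_mono2')
    show "a * w y powr (a - 1) \<le> 0" using a by (simp add: mult_nonpos_nonneg)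
    show "\<forall>\<^sub>F t in nhds 0. - ((- (- w y + t)) powr a) \<le> - ((- (- w y)) powr a)
        + a * w y powr (a - 1) * t + - (a * (a - 1) * w y powr (a - 2)) / 2 * t\<^sup>2 + e * t\<^sup>2"
      if "e > 0" for e
    proof -
      have "filterlim (\<lambda>t::real. - t) (nhds 0) (nhds 0)"
        using tendsto_minus[OF filterlim_ident, of "0::real"] by simp
      then have "\<forall>\<^sub>F t in nhds 0. \<bar>(w y + (- t)) powr a - w y powr a - (a * w y powr (a - 1)) * (- t)
          - (a * (a - 1) * w y powr (a - 2)) / 2 * (- t)\<^sup>2\<bar> \<le> e * (- t)\<^sup>2"
        by (rule eventually_compose_filterlim[OF powr_taylor[OF pos(1) that]])
      then show ?thesis
      proof eventually_elim
        case (elim t)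
        define B where "B = a * (a - 1) * w y powr (a - 2)"
        have "- (- w y + t) = w y + - t" "- (- w y) = w y" by simp_all
        then show ?case using elim unfolding B_def[symmetric]
          by (simp add: abs_le_iff)
      qed
    qed
  qed (use pos in auto)
  then show ?thesis unfolding subjet_def o by simp
qed

section \<open>Comparison of jets at a contact point\<close>

text \<open>Both expansions are compared along a ray \<open>t *\<^sub>R v\<close> and divided by
  \<open>t\<close>. Letting \<open>t\<close> tend to zero for \<open>v = p' - p\<close> gives
  equality of the gradients; dividing by \<open>t\<close> once more then compares the quadratic
  forms.\<close>

lemma jet_touch:
  fixes f q :: "real^'n \<Rightarrow> real"
  assumes f: "superjet f y p H" and q: "subjet q y p' H'"
    and le: "\<forall>\<^sub>F h in nhds 0. q (y + h) - q y \<le> f (y + h) - f y"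
  shows "p = p'" "h \<bullet> (H' *v h) \<le> h \<bullet> (H *v h)"
proof -
  have key: "\<exists>d>0. \<forall>t\<in>{0<..<d}. (p' - p) \<bullet> v + t * ((v \<bullet> (H' *v v) - v \<bullet> (H *v v)) / 2 - e * (norm v)\<^sup>2) \<le> 0"
    if e: "e > 0" for e v
  proof -
    have "\<forall>\<^sub>F h in nhds 0. (p' - p) \<bullet> h + (h \<bullet> (H' *v h) - h \<bullet> (H *v h)) / 2 - e * (norm h)\<^sup>2 \<le> 0"
    proof -
      have "\<forall>\<^sub>F h in nhds 0. f (y + h) \<le> f y + p \<bullet> h + (h \<bullet> (H *v h)) / 2 + e / 2 * (norm h)\<^sup>2"
        using f e unfolding superjet_def by (elim allE[of _ "e/2"]) simp
      moreover have "\<forall>\<^sub>F h in nhds 0. q y + p' \<bullet> h + (h \<bullet> (H' *v h)) / 2 - e / 2 * (norm h)\<^sup>2 \<le> q (y + h)"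
        using q e unfolding subjet_iff by (elim allE[of _ "e/2"]) simp
      ultimately show ?thesis using le
        by eventually_elim (simp add: inner_diff_left field_simps)
    qed
    then obtain d where d: "d > 0" "\<And>h. norm h < d \<Longrightarrow>
        (p' - p) \<bullet> h + (h \<bullet> (H' *v h) - h \<bullet> (H *v h)) / 2 - e * (norm h)\<^sup>2 \<le> 0"
      unfolding eventually_nhds_metric by (auto simp: dist_norm)
    define K where "K = norm v + 1"
    have K: "K > 0" by (simp add: K_def add_nonneg_pos)
    show ?thesis
    proof (intro exI[of _ "d / K"] conjI ballI)
      show "d / K > 0" using d K by simp
      fix t assume t: "t \<in> {0<..<d / K}"
      have "norm (t *\<^sub>R v) \<le> t * K" using t by (simp add: K_def)
      also have "\<dots> < d" using t K by (simp add: pos_less_divide_eq)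
      finally have "(p' - p) \<bullet> (t *\<^sub>R v) + ((t *\<^sub>R v) \<bullet> (H' *v (t *\<^sub>R v)) - (t *\<^sub>R v) \<bullet> (H *v (t *\<^sub>R v))) / 2
          - e * (norm (t *\<^sub>R v))\<^sup>2 \<le> 0"
        by (rule d(2))
      then have "t * ((p' - p) \<bullet> v + t * ((v \<bullet> (H' *v v) - v \<bullet> (H *v v)) / 2 - e * (norm v)\<^sup>2)) \<le> 0"
        by (simp add: matrix_vector_mult_scaleR algebra_simps power2_eq_square diff_divide_distrib)
      then show "(p' - p) \<bullet> v + t * ((v \<bullet> (H' *v v) - v \<bullet> (H *v v)) / 2 - e * (norm v)\<^sup>2) \<le> 0"
        using t by (simp add: mult_le_0_iff)
    qed
  qed
  have "(p' - p) \<bullet> (p' - p) \<le> 0"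
  proof -
    let ?v = "p' - p"
    define A where "A = (?v \<bullet> (H' *v ?v) - ?v \<bullet> (H *v ?v)) / 2 - 1 * (norm ?v)\<^sup>2"
    obtain d where d: "d > 0" "\<And>t. t \<in> {0<..<d} \<Longrightarrow> ?v \<bullet> ?v + t * A \<le> 0"
      using key[of 1 ?v] unfolding A_def by auto
    have "((\<lambda>t. ?v \<bullet> ?v + t * A) \<longlongrightarrow> ?v \<bullet> ?v + 0 * A) (at_right 0)"
      by (intro tendsto_intros)
    moreover have "\<forall>\<^sub>F t in at_right 0. ?v \<bullet> ?v + t * A \<le> 0"
      using eventually_at_right_real[OF d(1)] by eventually_elim (rule d(2))
    ultimately show ?thesis
      using tendsto_upperbound[of "\<lambda>t. ?v \<bullet> ?v + t * A" "?v \<bullet> ?v + 0 * A" "at_right 0" 0] by simp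
  qed
  then have "(p' - p) \<bullet> (p' - p) = 0" using inner_ge_zero by (rule antisym)
  then show p: "p = p'" unfolding inner_eq_zero_iff by simp
  show "h \<bullet> (H' *v h) \<le> h \<bullet> (H *v h)"
  proof (rule field_le_epsilon)
    fix e :: real assume e: "e > 0"
    define K where "K = 2 * (norm h)\<^sup>2 + 1"
    have K: "K > 0" by (simp add: K_def add_nonneg_pos)
    obtain d where "d > 0"
      "\<And>t. t \<in> {0<..<d} \<Longrightarrow> (p' - p) \<bullet> h + t * ((h \<bullet> (H' *v h) - h \<bullet> (H *v h)) / 2 - e / K * (norm h)\<^sup>2) \<le> 0"
      using key[of "e / K" h] e K by auto
    from this(2)[of "d/2"] this(1) p have "(h \<bullet> (H' *v h) - h \<bullet> (H *v h)) / 2 - e / K * (norm h)\<^sup>2 \<le> 0"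
      by (simp add: mult_le_0_iff)
    moreover have "e / K * (2 * (norm h)\<^sup>2) \<le> e / K * K"
      using e K by (intro mult_left_mono) (auto simp: K_def)
    moreover have "e / K * K = e" using K by simp
    moreover have "e / K * (2 * (norm h)\<^sup>2) = 2 * (e / K * (norm h)\<^sup>2)" by simp
    ultimately show "h \<bullet> (H' *v h) \<le> h \<bullet> (H *v h) + e" by argo
  qed
qed

lemma subjet_add_quadratic:
  assumes g: "subjet g y p H" and Q: "\<And>h. Q (y + h) = Q y + G \<bullet> h + (h \<bullet> (K *v h)) / 2" and t: "t > 0"
  shows "subjet (\<lambda>x. t * (g x + Q x)) y (t *\<^sub>R (p + G)) (t *\<^sub>R (H + K))"
  unfolding subjet_iff
proof (intro allI impI)
  fix e :: real assume "e > 0"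
  then have "e / t > 0" using t by simp
  with g have "\<forall>\<^sub>F h in nhds 0. g y + p \<bullet> h + (h \<bullet> (H *v h)) / 2 - e / t * (norm h)\<^sup>2 \<le> g (y + h)"
    unfolding subjet_iff by blast
  then show "\<forall>\<^sub>F h in nhds 0. t * (g y + Q y) + t *\<^sub>R (p + G) \<bullet> h + (h \<bullet> (t *\<^sub>R (H + K) *v h)) / 2
      - e * (norm h)\<^sup>2 \<le> t * (g (y + h) + Q (y + h))"
  proof eventually_elim
    case (elim h)
    have "t * (g y + p \<bullet> h + (h \<bullet> (H *v h)) / 2 - e / t * (norm h)\<^sup>2) \<le> t * g (y + h)"
      using elim t by (intro mult_left_mono) auto
    then show ?case using t unfolding Q
      by (simp add: mat_mult_simps inner_add_left inner_add_right algebra_simps add_divide_distrib)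
  qed
qed

lemma subjet_quadratic:
  assumes Q: "\<And>h. Q (y + h) = Q y + G \<bullet> h + (h \<bullet> (K *v h)) / 2"
  shows "subjet Q y G K"
  unfolding subjet_iff by (simp add: Q)

lemma subjet_touch:
  assumes "subjet q y p H" "\<forall>\<^sub>F h in nhds 0. q (y + h) - q y \<le> f (y + h) - f y"
  shows "subjet f y p H"
  unfolding subjet_iff
proof (intro allI impI)
  fix e :: real assume "e > 0"
  with assms(1) have "\<forall>\<^sub>F h in nhds 0. q y + p \<bullet> h + (h \<bullet> (H *v h)) / 2 - e * (norm h)\<^sup>2 \<le> q (y + h)"
    unfolding subjet_iff by blast
  then show "\<forall>\<^sub>F h in nhds 0. f y + p \<bullet> h + (h \<bullet> (H *v h)) / 2 - e * (norm h)\<^sup>2 \<le> f (y + h)"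
    using assms(2) by eventually_elim simp
qed

section \<open>Conformal inversion\<close>

text \<open>For value \<open>s\<close>, gradient \<open>p\<close> and Hessian \<open>H\<close> of a
  positive function \<open>f\<close> this is the Schouten tensor of the metric
  \<open>f^(-2) |dx|^2\<close> with one index raised, whence its conformal covariance. As a function
  of the 2-jet alone it can be evaluated at jets of functions that are merely continuous.\<close>

definition schouten :: "real \<Rightarrow> real^'n \<Rightarrow> real^'n^'n \<Rightarrow> real^'n^'n" where
  "schouten s p H = s *\<^sub>R H - ((norm p)\<^sup>2 / 2) *\<^sub>R mat 1"

lemma schouten_sym: "H \<in> sym_matrices \<Longrightarrow> schouten s p H \<in> sym_matrices"
  unfolding schouten_def by (intro sym_matrices_diff sym_matrices_scaleR sym_matrices_mat)

lemma sym_of_schouten: "schouten s p H \<in> sym_matrices \<Longrightarrow> s \<noteq> 0 \<Longrightarrow> H \<in> sym_matrices"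
proof -
  assume a: "schouten s p H \<in> sym_matrices" "s \<noteq> 0"
  have "H = (1/s) *\<^sub>R (schouten s p H + ((norm p)\<^sup>2 / 2) *\<^sub>R mat 1)"
    using a(2) by (simp add: schouten_def)
  also have "\<dots> \<in> sym_matrices"
    by (intro sym_matrices_add sym_matrices_scaleR sym_matrices_mat a)
  finally show ?thesis .
qed

lemma trace_scaleR: "trace (c *\<^sub>R A) = c * trace (A :: real^'n^'n)"
  by (simp add: trace_def sum_distrib_left)

lemma trace_outer: "trace (outer p q) = p \<bullet> q"
  by (simp add: trace_def outer_def inner_vec_def)

lemma trace_mat_1: "trace (mat 1 :: real^'n^'n) = real CARD('n)"
  by (simp add: trace_def mat_def)

lemma trace_schouten: "trace (schouten s p (H :: real^'n^'n)) = s * trace H - CARD('n) * (norm p)\<^sup>2 / 2"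
  by (simp add: schouten_def trace_sub trace_scaleR trace_mat_1)

text \<open>The differential of the inversion of radius \<open>r\<close> about \<open>x\<close> at
  \<open>x + a\<close> is \<open>r\<^sup>2 / (norm a)\<^sup>2\<close> times this matrix.\<close>

definition reflection :: "real^'n \<Rightarrow> real^'n^'n" where
  "reflection a = mat 1 - (2 / (norm a)\<^sup>2) *\<^sub>R outer a a"

lemma reflection_mult: "reflection a *v h = h - (2 * (a \<bullet> h) / (norm a)\<^sup>2) *\<^sub>R a"
  by (simp add: reflection_def mat_mult_simps)

lemma reflection_sym: "reflection a \<in> sym_matrices"
  unfolding reflection_def
  by (intro sym_matrices_diff sym_matrices_scaleR sym_matrices_mat sym_matrices_outer)

lemma reflection_sq:
  assumes "a \<noteq> 0"
  shows "reflection a ** reflection a = mat 1"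
proof (rule matrix_eq[THEN iffD2], rule allI)
  fix h
  have "a \<bullet> a = (norm a)\<^sup>2" "(norm a)\<^sup>2 \<noteq> 0" using assms by (auto simp: power2_norm_eq_inner)
  then have "reflection a *v (reflection a *v h) = h"
    by (simp add: reflection_mult inner_diff_right field_simps)
  then show "(reflection a ** reflection a) *v h = mat 1 *v h"
    by (simp add: matrix_vector_mul_assoc)
qed

lemma reflection_orthogonal: "a \<noteq> 0 \<Longrightarrow> orthogonal_matrix (reflection a)"
  using reflection_sq[of a] reflection_sym[of a]
  by (simp add: orthogonal_matrix_def sym_matrices_def)

lemma reflection_inv:
  assumes "a \<noteq> 0"
  shows "matrix_inv (reflection a) = reflection a"
proof -
  have sq: "reflection a ** reflection a = mat 1" by (rule reflection_sq[OF assms])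
  then have "reflection a ** matrix_inv (reflection a) = mat 1"
    unfolding matrix_inv_def
    by (rule someI2[of "\<lambda>A'. reflection a ** A' = mat 1 \<and> A' ** reflection a = mat 1" "reflection a",
          OF conjI]) (auto simp: sq)
  then have "reflection a ** (reflection a ** matrix_inv (reflection a)) = reflection a"
    by (simp only: matrix_mul_rid)
  then show ?thesis unfolding matrix_mul_assoc sq matrix_mul_lid .
qed

lemma reflection_conj_inner:
  "h \<bullet> ((reflection a ** H ** reflection a) *v h) = (reflection a *v h) \<bullet> (H *v (reflection a *v h))"
  using sym_matrices_inner[OF reflection_sym, of h a "H *v (reflection a *v h)"]
  by (simp add: matrix_vector_mul_assoc matrix_mul_assoc)

lemma norm_reflection:
  assumes "a \<noteq> 0"
  shows "norm (reflection a *v h) = norm h"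
proof -
  have "(reflection a *v h) \<bullet> (reflection a *v h) = h \<bullet> (reflection a *v (reflection a *v h))"
    by (rule sym_matrices_inner[OF reflection_sym, symmetric])
  also have "\<dots> = h \<bullet> h"
    by (simp add: matrix_vector_mul_assoc reflection_sq[OF assms])
  finally show ?thesis by (simp add: norm_eq_sqrt_inner)
qed

lemma conj_reflection_sym:
  assumes "H \<in> sym_matrices"
  shows "reflection a ** H ** reflection a \<in> sym_matrices"
  using assms reflection_sym[of a] unfolding sym_matrices_def
  by (simp add: matrix_transpose_mul matrix_mul_assoc)

text \<open>Conformal covariance on the level of jets: the arguments on the left are value, gradient
  and Hessian of the transformed function at \<open>x + a\<close> when the original one has the jet
  \<open>(s, p, H)\<close> at the inverse point. Substituting
  \<open>p \<bullet> a = N * (s / r\<^sup>2 - c)\<close> into the square of the gradient makes all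
  terms in \<open>c\<close> cancel.\<close>

lemma schouten_inversion:
  fixes a p :: "real^'n" and H :: "real^'n^'n" and r s :: real
  assumes a: "a \<noteq> 0" and r: "r \<noteq> 0"
  defines "c \<equiv> s / r\<^sup>2 - (p \<bullet> a) / (norm a)\<^sup>2"
  shows "schouten ((norm a)\<^sup>2 / r\<^sup>2 * s) ((2 * c) *\<^sub>R a + p)
      ((2 * c) *\<^sub>R mat 1 + (r\<^sup>2 / (norm a)\<^sup>2) *\<^sub>R (reflection a ** H ** reflection a))
    = reflection a ** schouten s p H ** reflection a"
proof -
  define N where "N = (norm a)\<^sup>2"
  have N: "N \<noteq> 0" using a by (simp add: N_def)
  have pa: "p \<bullet> a = N * (s / r\<^sup>2 - c)" using N by (simp add: c_def N_def)
  have n: "(norm ((2 * c) *\<^sub>R a + p))\<^sup>2 = 4 * c\<^sup>2 * N + 4 * c * (p \<bullet> a) + (norm p)\<^sup>2"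
    unfolding power2_norm_eq_inner N_def
    by (simp add: inner_add_left inner_add_right inner_commute power2_eq_square algebra_simps)
  have "N / r\<^sup>2 * s * (2 * c) - (norm ((2 * c) *\<^sub>R a + p))\<^sup>2 / 2 = - ((norm p)\<^sup>2 / 2)"
    unfolding n pa using r by (simp add: field_simps power2_eq_square)
  then have 1: "(N / r\<^sup>2 * s * (2 * c)) *\<^sub>R mat 1 - ((norm ((2 * c) *\<^sub>R a + p))\<^sup>2 / 2) *\<^sub>R mat 1
      = - ((norm p)\<^sup>2 / 2) *\<^sub>R (mat 1 :: real^'n^'n)"
    by (metis scaleR_left_diff_distrib scaleR_minus_left)
  have 2: "reflection a ** schouten s p H ** reflection a
      = s *\<^sub>R (reflection a ** H ** reflection a) - ((norm p)\<^sup>2 / 2) *\<^sub>R mat 1"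
  proof (rule matrix_eq[THEN iffD2], rule allI)
    fix h
    have "reflection a *v (reflection a *v h) = h"
      by (simp add: matrix_vector_mul_assoc reflection_sq[OF a])
    then show "(reflection a ** schouten s p H ** reflection a) *v h
      = (s *\<^sub>R (reflection a ** H ** reflection a) - ((norm p)\<^sup>2 / 2) *\<^sub>R mat 1) *v h"
      by (simp add: schouten_def matrix_vector_mul_assoc[symmetric] mat_mult_simps
          matrix_vector_mult_diff_distrib matrix_vector_mult_scaleR)
  qed
  have "schouten (N / r\<^sup>2 * s) ((2 * c) *\<^sub>R a + p)
      ((2 * c) *\<^sub>R mat 1 + (r\<^sup>2 / N) *\<^sub>R (reflection a ** H ** reflection a))
    = ((N / r\<^sup>2 * s * (2 * c)) *\<^sub>R mat 1 - ((norm ((2 * c) *\<^sub>R a + p))\<^sup>2 / 2) *\<^sub>R mat 1)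
      + s *\<^sub>R (reflection a ** H ** reflection a)"
    using N r by (simp add: schouten_def scaleR_add_right mult_ac)
  also have "\<dots> = reflection a ** schouten s p H ** reflection a"
    unfolding 1 2 by simp
  finally show ?thesis by (simp add: N_def)
qed

definition inversion :: "real^'n \<Rightarrow> real \<Rightarrow> real^'n \<Rightarrow> real^'n" where
  "inversion x r y = x + (r\<^sup>2 / (norm (y - x))\<^sup>2) *\<^sub>R (y - x)"

text \<open>For \<open>f = u powr (- 2 / (n - 2))\<close> the Kelvin transform of \<open>u\<close> corresponds to
  the following transform of \<open>f\<close>, in which the power of the conformal factor no longer depends on \<open>n\<close>.\<close>

definition conf_inv :: "real^'n \<Rightarrow> real \<Rightarrow> (real^'n \<Rightarrow> real) \<Rightarrow> real^'n \<Rightarrow> real" where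
  "conf_inv x r f y = (norm (y - x))\<^sup>2 / r\<^sup>2 * f (inversion x r y)"

text \<open>With \<open>z = y - x\<close> one has \<open>\<bar>z\<bar>\<^sup>2 (p \<bullet> (z / \<bar>z\<bar>\<^sup>2)) = p \<bullet> z\<close>, so the linear part of the jet of \<open>f\<close>
  is turned into an exact quadratic polynomial, and only the first-order expansion of
  the inversion enters in the quadratic part.\<close>

lemma superjet_inversion:
  fixes f :: "real^'n \<Rightarrow> real" and x a p :: "real^'n" and r :: real
  assumes a: "a \<noteq> 0" and r: "r > 0" and f: "superjet f (inversion x r (x + a)) p H"
  defines "c \<equiv> f (inversion x r (x + a)) / r\<^sup>2 - (p \<bullet> a) / (norm a)\<^sup>2"
  shows "superjet (conf_inv x r f) (x + a) ((2 * c) *\<^sub>R a + p)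
      ((2 * c) *\<^sub>R mat 1 + (r\<^sup>2 / (norm a)\<^sup>2) *\<^sub>R (reflection a ** H ** reflection a))"
  unfolding superjet_def
proof (intro allI impI)
  fix e :: real assume e: "e > 0"
  let ?R = "reflection a"
  define N where "N = (norm a)\<^sup>2"
  have N: "N > 0" using a by (simp add: N_def)
  define b where "b = inversion x r (x + a)"
  have b: "b = x + (r\<^sup>2 / N) *\<^sub>R a" by (simp add: b_def inversion_def N_def)
  define f0 where "f0 = f b"
  have pa: "p \<bullet> a = N * (f0 / r\<^sup>2 - c)" using N by (simp add: c_def N_def f0_def b_def)
  \<comment> \<open>The inverse of \<open>x + a + h\<close> is exactly \<open>b + k h\<close>; the
    vector \<open>v h\<close> differs from the reflection of \<open>h\<close> by a term of second
    order.\<close>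
  define v where "v h = ?R *v h - ((norm h)\<^sup>2 / N) *\<^sub>R a" for h
  define k where "k h = (r\<^sup>2 / (norm (a + h))\<^sup>2) *\<^sub>R v h" for h
  have nz: "(norm (a + h))\<^sup>2 = N + 2 * (a \<bullet> h) + (norm h)\<^sup>2" for h
    unfolding N_def power2_norm_eq_inner by (simp add: inner_add_left inner_add_right inner_commute)
  have inv: "inversion x r (x + a + h) = b + k h" if "a + h \<noteq> 0" for h
  proof -
    define Z where "Z = (norm (a + h))\<^sup>2"
    have Z: "Z > 0" using that by (simp add: Z_def)
    have Zh: "2 * (a \<bullet> h) + (norm h)\<^sup>2 = Z - N" using nz[of h] by (simp add: Z_def)
    have "v h = h - ((2 * (a \<bullet> h) + (norm h)\<^sup>2) / N) *\<^sub>R a"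
      by (simp add: v_def reflection_mult N_def add_divide_distrib scaleR_add_left)
    also have "\<dots> = h - ((Z - N) / N) *\<^sub>R a" by (simp only: Zh)
    finally have vh: "v h = (a + h) - (Z / N) *\<^sub>R a"
      using N by (simp add: diff_divide_distrib scaleR_diff_left)
    have "b + k h = x + (r\<^sup>2 / N) *\<^sub>R a + (r\<^sup>2 / Z) *\<^sub>R (a + h) - (r\<^sup>2 / Z * (Z / N)) *\<^sub>R a"
      unfolding b k_def vh Z_def[symmetric] by (simp add: scaleR_diff_right)
    also have "r\<^sup>2 / Z * (Z / N) = r\<^sup>2 / N" using Z by simp
    finally show ?thesis by (simp add: inversion_def Z_def add.assoc)
  qed
  obtain K where K: "K > 0" "\<And>w. norm (H *v w) \<le> norm w * K"
    using bounded_linear.pos_bounded[OF matrix_vector_mul_bounded_linear[of H]] by blast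
  define A where "A = 1 + norm a / N"
  have A: "A > 0" using N by (simp add: A_def add_pos_nonneg)
  define B where "B = K * (A + 1) * (norm a / N)"
  \<comment> \<open>Relative error of the quadratic part: the first summand is for replacing
    \<open>1 / (norm (a + h))\<^sup>2\<close> by \<open>1 / N\<close>, the second for replacing
    \<open>v h\<close> by the reflection of \<open>h\<close>.\<close>
  define E where "E h = r\<^sup>2 / 2 * (K * A\<^sup>2 * \<bar>1 / (norm (a + h))\<^sup>2 - 1 / N\<bar> + 1 / N * (B * norm h))" for h
  \<comment> \<open>Since \<open>norm (v h) \<le> A * norm h\<close> and
    \<open>1 / (norm (a + h))\<^sup>2 \<le> 2 / N\<close> near zero, this makes the transformed
    slack of the jet at most \<open>e / 2 * (norm h)\<^sup>2\<close>.\<close>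
  define e1 where "e1 = e * N / (4 * r\<^sup>2 * A\<^sup>2)"
  have e1: "e1 > 0" using e N r A by (simp add: e1_def)
  have Zlim: "((\<lambda>h. (norm (a + h))\<^sup>2) \<longlongrightarrow> N) (nhds 0)"
  proof -
    have "((\<lambda>h. (norm (a + h))\<^sup>2) \<longlongrightarrow> (norm (a + 0))\<^sup>2) (nhds 0)"
      by (intro tendsto_intros filterlim_ident)
    then show ?thesis by (simp add: N_def)
  qed
  have k0: "(k \<longlongrightarrow> 0) (nhds 0)"
  proof -
    have "(k \<longlongrightarrow> (r\<^sup>2 / N) *\<^sub>R v 0) (nhds 0)"
      unfolding k_def v_def
      by (intro tendsto_intros Zlim filterlim_ident
          bounded_linear.tendsto[OF matrix_vector_mul_bounded_linear]) (use N in auto)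
    then show ?thesis by (simp add: v_def)
  qed
  have E0: "(E \<longlongrightarrow> 0) (nhds 0)"
  proof -
    have "(E \<longlongrightarrow> r\<^sup>2 / 2 * (K * A\<^sup>2 * \<bar>1 / N - 1 / N\<bar> + 1 / N * (B * norm (0::real^'n)))) (nhds 0)"
      unfolding E_def by (intro tendsto_intros Zlim filterlim_ident) (use N in auto)
    then show ?thesis by simp
  qed
  have "\<forall>\<^sub>F k in nhds 0. f (b + k) \<le> f0 + p \<bullet> k + (k \<bullet> (H *v k)) / 2 + e1 * (norm k)\<^sup>2"
    using f e1 unfolding superjet_def b_def[symmetric] f0_def by blast
  then have "\<forall>\<^sub>F h in nhds 0. f (b + k h) \<le> f0 + p \<bullet> k h + (k h \<bullet> (H *v k h)) / 2 + e1 * (norm (k h))\<^sup>2"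
    by (rule eventually_compose_filterlim[OF _ k0])
  moreover have "\<forall>\<^sub>F h in nhds 0. N / 2 < (norm (a + h))\<^sup>2"
    using order_tendstoD(1)[OF Zlim, of "N / 2"] N by simp
  moreover have "\<forall>\<^sub>F h in nhds 0. E h < e / 2"
    using order_tendstoD(2)[OF E0, of "e / 2"] e by simp
  moreover have "\<forall>\<^sub>F h in nhds 0. norm (h::real^'n) < 1"
    by (rule eventually_norm_less) simp
  ultimately show "\<forall>\<^sub>F h in nhds 0. conf_inv x r f (x + a + h)
     \<le> conf_inv x r f (x + a) + ((2 * c) *\<^sub>R a + p) \<bullet> h
       + (h \<bullet> (((2 * c) *\<^sub>R mat 1 + (r\<^sup>2 / (norm a)\<^sup>2) *\<^sub>R (?R ** H ** ?R)) *v h)) / 2 + e * (norm h)\<^sup>2"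
  proof eventually_elim
    case (elim h)
    define Z where "Z = (norm (a + h))\<^sup>2"
    define n where "n = norm h"
    have Z: "Z > 0" "Z > N / 2" using elim N by (auto simp: Z_def)
    have n: "0 \<le> n" "n < 1" using elim by (auto simp: n_def)
    have Zn: "Z = N + 2 * (a \<bullet> h) + n\<^sup>2" by (simp add: Z_def nz n_def)
    have ne: "a + h \<noteq> 0" using Z(1) by (auto simp: Z_def)
    define w where "w = ?R *v h"
    define d where "d = ((norm h)\<^sup>2 / N) *\<^sub>R a"
    have vw: "v h = w - d" by (simp add: v_def w_def d_def)
    have nw: "norm w = n" by (simp add: w_def n_def norm_reflection[OF a])
    have nd: "norm d = norm a / N * n\<^sup>2" using N by (simp add: d_def n_def)
    have n2: "n\<^sup>2 \<le> n" using n by (simp add: power2_eq_square mult_left_le)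
    have "norm (v h) \<le> norm w + norm d" unfolding vw by (rule norm_triangle_ineq4)
    also have "\<dots> \<le> n + norm a / N * n" unfolding nw nd using n2 N
      by (intro add_left_mono mult_left_mono) auto
    finally have nv: "norm (v h) \<le> A * n" by (simp add: A_def distrib_right)
    have Hb: "\<bar>x \<bullet> (H *v y)\<bar> \<le> K * (norm x * norm y)" for x y :: "real^'n"
    proof -
      have "\<bar>x \<bullet> (H *v y)\<bar> \<le> norm x * norm (H *v y)" by (rule Cauchy_Schwarz_ineq2)
      also have "\<dots> \<le> norm x * (norm y * K)" by (intro mult_left_mono K) auto
      finally show ?thesis by (simp add: mult_ac)
    qed
    have q1: "\<bar>v h \<bullet> (H *v v h)\<bar> \<le> K * A\<^sup>2 * n\<^sup>2"
    proof -
      have "\<bar>v h \<bullet> (H *v v h)\<bar> \<le> K * (norm (v h) * norm (v h))" by (rule Hb)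
      also have "\<dots> \<le> K * ((A * n) * (A * n))" using nv K(1) A n by (intro mult_left_mono mult_mono) auto
      finally show ?thesis by (simp add: power2_eq_square mult_ac)
    qed
    have q2: "\<bar>v h \<bullet> (H *v v h) - w \<bullet> (H *v w)\<bar> \<le> B * n * n\<^sup>2"
    proof -
      have "v h \<bullet> (H *v v h) - w \<bullet> (H *v w) = - (d \<bullet> (H *v v h)) - w \<bullet> (H *v d)"
        unfolding vw by (simp add: matrix_vector_mult_diff_distrib inner_diff_left inner_diff_right)
      then have "\<bar>v h \<bullet> (H *v v h) - w \<bullet> (H *v w)\<bar> \<le> \<bar>d \<bullet> (H *v v h)\<bar> + \<bar>w \<bullet> (H *v d)\<bar>" by linarith
      also have "\<dots> \<le> K * (norm d * norm (v h)) + K * (norm w * norm d)" by (intro add_mono Hb)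
      also have "\<dots> \<le> K * (norm d * (A * n)) + K * (n * norm d)"
        unfolding nw using nv K(1) n by (intro add_mono mult_left_mono) auto
      also have "\<dots> = B * n * n\<^sup>2" unfolding nd B_def by (simp add: algebra_simps)
      finally show ?thesis .
    qed
    have q3: "r\<^sup>2 / Z * (v h \<bullet> (H *v v h)) / 2 \<le> r\<^sup>2 / N * (w \<bullet> (H *v w)) / 2 + e / 2 * n\<^sup>2"
    proof -
      define X where "X = v h \<bullet> (H *v v h)"
      define Y where "Y = w \<bullet> (H *v w)"
      have "(1 / Z - 1 / N) * X \<le> \<bar>1 / Z - 1 / N\<bar> * \<bar>X\<bar>"
        by (metis abs_ge_self abs_mult)
      also have "\<dots> \<le> \<bar>1 / Z - 1 / N\<bar> * (K * A\<^sup>2 * n\<^sup>2)"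
        using q1 by (intro mult_left_mono) (auto simp: X_def)
      finally have i: "(1 / Z - 1 / N) * X \<le> \<bar>1 / Z - 1 / N\<bar> * (K * A\<^sup>2 * n\<^sup>2)" .
      have ii: "1 / N * (X - Y) \<le> 1 / N * (B * n * n\<^sup>2)"
        using q2 N by (intro mult_left_mono) (auto simp: X_def Y_def)
      have iii: "u * X - v * Y = (u - v) * X + v * (X - Y)" for u v by (simp add: algebra_simps)
      have iv: "u * (K * A\<^sup>2 * n\<^sup>2) + v * (B * n * n\<^sup>2) = (K * A\<^sup>2 * u + v * (B * n)) * n\<^sup>2" for u v
        by (simp add: algebra_simps)
      have "r\<^sup>2 / 2 * (1 / Z * X - 1 / N * Y) = r\<^sup>2 / 2 * ((1 / Z - 1 / N) * X + 1 / N * (X - Y))"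
        by (simp only: iii)
      also have "\<dots> \<le> r\<^sup>2 / 2 * (\<bar>1 / Z - 1 / N\<bar> * (K * A\<^sup>2 * n\<^sup>2) + 1 / N * (B * n * n\<^sup>2))"
        by (intro mult_left_mono add_mono i ii) auto
      also have "\<dots> = E h * n\<^sup>2" unfolding iv by (simp only: E_def Z_def n_def mult.assoc)
      also have "\<dots> \<le> e / 2 * n\<^sup>2" using elim by (intro mult_right_mono) auto
      finally have "r\<^sup>2 / 2 * (1 / Z * X - 1 / N * Y) \<le> e / 2 * n\<^sup>2" .
      moreover have "r\<^sup>2 / 2 * (1 / Z * X - 1 / N * Y) = r\<^sup>2 / Z * X / 2 - r\<^sup>2 / N * Y / 2"
        by (simp add: right_diff_distrib)
      ultimately show ?thesis unfolding X_def[symmetric] Y_def[symmetric] by linarith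
    qed
    have q4: "e1 * (r\<^sup>2 / Z * (norm (v h))\<^sup>2) \<le> e / 2 * n\<^sup>2"
    proof -
      have "(norm (v h))\<^sup>2 \<le> (A * n)\<^sup>2" using nv by (intro power_mono) auto
      moreover have "1 / Z \<le> 2 / N" using Z N by (simp add: field_simps)
      ultimately have "(1 / Z) * (norm (v h))\<^sup>2 \<le> (2 / N) * (A * n)\<^sup>2"
        using Z N by (intro mult_mono) auto
      then have "e1 * r\<^sup>2 * ((1 / Z) * (norm (v h))\<^sup>2) \<le> e1 * r\<^sup>2 * ((2 / N) * (A * n)\<^sup>2)"
        using e1 by (intro mult_left_mono) auto
      also have "\<dots> = e / 2 * n\<^sup>2" using N r A by (simp add: e1_def power_mult_distrib)
      finally show ?thesis by simp
    qed
    \<comment> \<open>The conformal factor \<open>Z / r\<^sup>2\<close> cancels the denominator in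
      \<open>k h\<close>, so the linear part of the jet contributes a polynomial and no error
      term.\<close>
    have pk: "Z / r\<^sup>2 * (p \<bullet> k h) = p \<bullet> (a + h) - Z * (f0 / r\<^sup>2 - c)"
    proof -
      have "b + k h = x + (r\<^sup>2 / Z) *\<^sub>R (a + h)"
        using inv[OF ne] by (simp add: inversion_def Z_def add.assoc)
      then have "k h = (r\<^sup>2 / Z) *\<^sub>R (a + h) - (r\<^sup>2 / N) *\<^sub>R a" unfolding b by (simp add: algebra_simps)
      then have "p \<bullet> k h = r\<^sup>2 / Z * (p \<bullet> (a + h)) - r\<^sup>2 / N * (p \<bullet> a)"
        by (simp only: inner_diff_right inner_scaleR_right)
      then have "Z / r\<^sup>2 * (p \<bullet> k h) = (Z / r\<^sup>2 * (r\<^sup>2 / Z)) * (p \<bullet> (a + h)) - (Z / r\<^sup>2 * (r\<^sup>2 / N)) * (p \<bullet> a)"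
        by (simp only: right_diff_distrib mult.assoc)
      also have "\<dots> = p \<bullet> (a + h) - Z / N * (p \<bullet> a)" using Z r by simp
      also have "\<dots> = p \<bullet> (a + h) - Z * (f0 / r\<^sup>2 - c)" unfolding pa using N by simp
      finally show ?thesis .
    qed
    have kZ: "k h = (r\<^sup>2 / Z) *\<^sub>R v h" by (simp add: k_def Z_def)
    have kk: "Z / r\<^sup>2 * (k h \<bullet> (H *v k h)) = r\<^sup>2 / Z * (v h \<bullet> (H *v v h))"
      using Z r by (simp add: kZ matrix_vector_mult_scaleR power2_eq_square)
    have kn: "Z / r\<^sup>2 * (norm (k h))\<^sup>2 = r\<^sup>2 / Z * (norm (v h))\<^sup>2"
      using Z r by (simp add: kZ power_mult_distrib power2_eq_square)
    have "conf_inv x r f (x + a + h) = Z / r\<^sup>2 * f (b + k h)"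
      unfolding conf_inv_def inv[OF ne] by (simp add: Z_def add.assoc)
    also have "\<dots> \<le> Z / r\<^sup>2 * (f0 + p \<bullet> k h + (k h \<bullet> (H *v k h)) / 2 + e1 * (norm (k h))\<^sup>2)"
      using elim Z by (intro mult_left_mono) auto
    also have "\<dots> = Z / r\<^sup>2 * f0 + Z / r\<^sup>2 * (p \<bullet> k h) + Z / r\<^sup>2 * (k h \<bullet> (H *v k h)) / 2
        + e1 * (Z / r\<^sup>2 * (norm (k h))\<^sup>2)"
      by (simp only: distrib_left times_divide_eq_right mult.left_commute[of e1])
    also have "\<dots> = Z * c + p \<bullet> (a + h) + r\<^sup>2 / Z * (v h \<bullet> (H *v v h)) / 2
        + e1 * (r\<^sup>2 / Z * (norm (v h))\<^sup>2)"
      unfolding pk kk kn by (simp add: right_diff_distrib)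
    also have "\<dots> \<le> Z * c + p \<bullet> (a + h) + r\<^sup>2 / N * (w \<bullet> (H *v w)) / 2 + e * n\<^sup>2"
      using q3 q4 by linarith
    also have "Z * c + p \<bullet> (a + h) = N / r\<^sup>2 * f0 + ((2 * c) *\<^sub>R a + p) \<bullet> h + c * n\<^sup>2"
      unfolding Zn inner_add_right pa by (simp add: inner_add_left algebra_simps)
    finally have "conf_inv x r f (x + a + h) \<le> N / r\<^sup>2 * f0 + ((2 * c) *\<^sub>R a + p) \<bullet> h + c * n\<^sup>2
      + r\<^sup>2 / N * (w \<bullet> (H *v w)) / 2 + e * n\<^sup>2" .
    moreover have "conf_inv x r f (x + a) = N / r\<^sup>2 * f0"
      by (simp add: conf_inv_def N_def f0_def b_def)
    moreover have "(h \<bullet> (((2 * c) *\<^sub>R mat 1 + (r\<^sup>2 / (norm a)\<^sup>2) *\<^sub>R (?R ** H ** ?R)) *v h)) / 2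
        = c * n\<^sup>2 + r\<^sup>2 / N * (w \<bullet> (H *v w)) / 2"
      unfolding mat_mult_simps inner_add_right inner_scaleR_right reflection_conj_inner
      by (simp add: w_def N_def n_def power2_norm_eq_inner add_divide_distrib)
    ultimately show ?case unfolding n_def by linarith
  qed
qed

section \<open>Touching away from the singular points\<close>

lemma quadratic_expansion:
  assumes "K \<in> sym_matrices"
  shows "c + p \<bullet> (y + h - y0) + ((y + h - y0) \<bullet> (K *v (y + h - y0))) / 2
    = (c + p \<bullet> (y - y0) + ((y - y0) \<bullet> (K *v (y - y0))) / 2)
      + (p + K *v (y - y0)) \<bullet> h + (h \<bullet> (K *v h)) / (2::real)"
proof -
  define z where "z = y - y0"
  have 1: "y + h - y0 = z + h" by (simp add: z_def)
  have 2: "h \<bullet> (K *v z) = (K *v z) \<bullet> h" by (rule inner_commute)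
  have 3: "z \<bullet> (K *v h) = (K *v z) \<bullet> h" by (rule sym_matrices_inner[OF assms])
  show ?thesis unfolding 1 z_def[symmetric]
    by (simp add: matrix_vector_right_distrib inner_add_left inner_add_right 2 3 add_divide_distrib)
qed

section \<open>Paraboloids and the gain from adding them\<close>

definition paraboloid :: "real \<Rightarrow> real^'n \<Rightarrow> real \<Rightarrow> real^'n \<Rightarrow> real" where
  "paraboloid e b \<mu> x = e + b \<bullet> x + \<mu> / 2 * (norm x)\<^sup>2"

lemma paraboloid_expansion:
  "paraboloid e b \<mu> (y + h) = paraboloid e b \<mu> y + (b + \<mu> *\<^sub>R y) \<bullet> h + (h \<bullet> ((\<mu> *\<^sub>R mat 1) *v h)) / 2"
  by (simp add: paraboloid_def power2_norm_eq_inner mat_mult_simps inner_add_left inner_add_right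
      inner_commute algebra_simps)

text \<open>The left side is twice the factor in front of the identity when \<open>schouten\<close>
  is evaluated at the jet of the paraboloid at \<open>y\<close>. Its value does not depend on
  \<open>y\<close>, so positivity is a condition on the coefficients alone.\<close>

lemma paraboloid_discriminant:
  "2 * \<mu> * paraboloid e b \<mu> y - (norm (b + \<mu> *\<^sub>R y))\<^sup>2 = 2 * \<mu> * e - (norm b)\<^sup>2"
  by (simp add: paraboloid_def power2_norm_eq_inner inner_add_left inner_add_right
      inner_commute algebra_simps)

lemma paraboloid_diff:
  "paraboloid e b \<mu> z - \<nu> / 2 * (norm (z - y))\<^sup>2
    = paraboloid (e - \<nu> / 2 * (norm y)\<^sup>2) (b + \<nu> *\<^sub>R y) (\<mu> - \<nu>) z"
  by (simp add: paraboloid_def power2_norm_eq_inner inner_add_left inner_diff_left inner_diff_right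
      inner_commute algebra_simps diff_divide_distrib add_divide_distrib)

lemma continuous_on_paraboloid: "continuous_on S (paraboloid e b \<mu>)"
  unfolding paraboloid_def by (intro continuous_intros)

lemma tendsto_paraboloid: "(y \<longlongrightarrow> z) G \<Longrightarrow> ((\<lambda>k. paraboloid e b \<mu> (y k)) \<longlongrightarrow> paraboloid e b \<mu> z) G"
  unfolding paraboloid_def by (intro tendsto_intros)

text \<open>Subtracting \<open>\<nu> / 2 * (norm (z - y))\<^sup>2\<close> turns a contact at
  \<open>y\<close> into a strict one. By \<open>paraboloid_diff\<close> it changes the coefficients
  as in this statement, and continuity at \<open>\<nu> = 0\<close> preserves the sign.\<close>

lemma discriminant_perturb:
  fixes b y :: "real^'n"
  assumes disc: "\<mu> > 0" "2 * \<mu> * e - (norm b)\<^sup>2 > 0"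
  shows "\<exists>\<nu>>0. \<mu> - \<nu> > 0 \<and> 2 * (\<mu> - \<nu>) * (e - \<nu> / 2 * (norm y)\<^sup>2) - (norm (b + \<nu> *\<^sub>R y))\<^sup>2 > 0"
proof -
  have "((\<lambda>\<nu>. 2 * (\<mu> - \<nu>) * (e - \<nu> / 2 * (norm y)\<^sup>2) - (norm (b + \<nu> *\<^sub>R y))\<^sup>2) \<longlongrightarrow>
      2 * (\<mu> - 0) * (e - 0 / 2 * (norm y)\<^sup>2) - (norm (b + 0 *\<^sub>R y))\<^sup>2) (at_right 0)"
    by (intro tendsto_intros) simp
  then have "\<forall>\<^sub>F \<nu> in at_right 0. 2 * (\<mu> - \<nu>) * (e - \<nu> / 2 * (norm y)\<^sup>2) - (norm (b + \<nu> *\<^sub>R y))\<^sup>2 > 0"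
    using disc(2) by (intro order_tendstoD(1)) auto
  moreover have "\<forall>\<^sub>F \<nu> in at_right 0. \<nu> \<in> {0<..<\<mu>}" by (rule eventually_at_right_real[OF disc(1)])
  ultimately have "\<forall>\<^sub>F \<nu> in at_right (0::real). \<nu> > 0 \<and> \<mu> - \<nu> > 0 \<and>
      2 * (\<mu> - \<nu>) * (e - \<nu> / 2 * (norm y)\<^sup>2) - (norm (b + \<nu> *\<^sub>R y))\<^sup>2 > 0"
    by eventually_elim auto
  then show ?thesis using eventually_happens'[OF trivial_limit_at_right_real] by blast
qed

context elliptic_cone
begin

lemma U_conj_reflection:
  assumes "a \<noteq> 0" "M \<in> U"
  shows "reflection a ** M ** reflection a \<in> U"
  using U_inv[OF reflection_orthogonal[OF assms(1)]] assms(2)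
  unfolding reflection_inv[OF assms(1)] by blast

text \<open>Adding a paraboloid of negative discriminant pushes the matrix strictly into \<open>U\<close>, without
  any bound on the gradient: the terms containing \<open>p\<close> combine to a perfect square.\<close>

lemma schouten_add_paraboloid:
  fixes p G :: "real^'n"
  assumes g: "g > 0" and \<mu>: "\<mu> > 0" and t: "t > 0"
    and disc: "2 * \<mu> * q - (norm G)\<^sup>2 = \<delta>" "\<delta> > 0" and \<delta>: "(1 + q / g) * \<epsilon> < \<delta> / 2"
    and B: "B \<in> sym_matrices" "\<And>h. \<bar>h \<bullet> (B *v h)\<bar> \<le> \<epsilon> * (norm h)\<^sup>2" and SB: "schouten g p H + B \<in> U"
  shows "schouten (t * (g + q)) (t *\<^sub>R (p + G)) (t *\<^sub>R (H + \<mu> *\<^sub>R mat 1)) \<in> U"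
proof -
  \<comment> \<open>Multiplying the matrix of \<open>g\<close> by \<open>c0\<close> turns
    \<open>g *\<^sub>R H\<close> into \<open>(g + q) *\<^sub>R H\<close>; then
    \<open>\<kappa>\<close> is the multiple of the identity that remains. It must dominate
    \<open>c0 *\<^sub>R B\<close>, which is what the bound on \<open>\<epsilon>\<close>
    ensures.\<close>
  define \<kappa> where "\<kappa> = q * (norm p)\<^sup>2 / (2 * g) + \<mu> * (g + q) - p \<bullet> G - (norm G)\<^sup>2 / 2"
  define c0 where "c0 = 1 + q / g"
  have "2 * \<mu> * q > 0" using disc zero_le_power2[of "norm G"] by linarith
  then have q: "q > 0" using \<mu> by (simp add: zero_less_mult_iff)
  have c0: "c0 > 0" using g q by (simp add: c0_def add_pos_pos)
  have \<kappa>: "\<kappa> \<ge> \<delta> / 2"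
  proof -
    define P where "P = norm p"
    define N where "N = norm G"
    have "p \<bullet> G \<le> P * N" unfolding P_def N_def by (rule norm_cauchy_schwarz)
    \<comment> \<open>The inequality of arithmetic and geometric means with weights from
      \<open>N\<^sup>2 \<le> 2 * \<mu> * q\<close>: the mixed term is absorbed for every size of the
      gradient \<open>p\<close>.\<close>
    moreover have "P * N \<le> q * P\<^sup>2 / (2 * g) + \<mu> * g"
    proof -
      have "N\<^sup>2 \<le> 2 * \<mu> * q" using disc by (simp add: N_def)
      then have "(P * N)\<^sup>2 \<le> P\<^sup>2 * (2 * \<mu> * q)" by (simp add: power_mult_distrib mult_left_mono)
      also have "\<dots> = 4 * (q * P\<^sup>2 / (2 * g)) * (\<mu> * g)" using g by simp
      also have "\<dots> \<le> (q * P\<^sup>2 / (2 * g) + \<mu> * g)\<^sup>2"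
      proof -
        have "4 * X * W \<le> (X + W)\<^sup>2" for X W :: real
          using zero_le_power2[of "X - W"] by (simp add: power2_diff power2_sum mult_ac)
        then show ?thesis .
      qed
      finally show ?thesis
        by (rule power2_le_imp_le) (use g q \<mu> in auto)
    qed
    ultimately have "p \<bullet> G \<le> q * P\<^sup>2 / (2 * g) + \<mu> * g" by simp
    then show ?thesis unfolding \<kappa>_def disc(1)[symmetric] P_def by (simp add: algebra_simps diff_divide_distrib)
  qed
  have eq: "schouten (t * (g + q)) (t *\<^sub>R (p + G)) (t *\<^sub>R (H + \<mu> *\<^sub>R mat 1))
    = (t\<^sup>2) *\<^sub>R (c0 *\<^sub>R (schouten g p H + B) + (\<kappa> *\<^sub>R mat 1 - c0 *\<^sub>R B))"
  proof -
    have 1: "c0 * g = g + q" using g by (simp add: c0_def distrib_right)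
    have 2: "(norm (p + G))\<^sup>2 = (norm p)\<^sup>2 + 2 * (p \<bullet> G) + (norm G)\<^sup>2"
      unfolding power2_norm_eq_inner by (simp add: inner_add_left inner_add_right inner_commute)
    have 3: "(g + q) * \<mu> - (norm (p + G))\<^sup>2 / 2 = \<kappa> - c0 * ((norm p)\<^sup>2 / 2)"
      unfolding 2 \<kappa>_def c0_def using g by (simp add: field_simps)
    have "schouten (t * (g + q)) (t *\<^sub>R (p + G)) (t *\<^sub>R (H + \<mu> *\<^sub>R mat 1))
      = (t\<^sup>2) *\<^sub>R ((g + q) *\<^sub>R H + ((g + q) * \<mu> - (norm (p + G))\<^sup>2 / 2) *\<^sub>R mat 1)"
    proof -
      have n: "(norm (t *\<^sub>R (p + G)))\<^sup>2 = t\<^sup>2 * (norm (p + G))\<^sup>2" by (simp add: power_mult_distrib)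
      show ?thesis unfolding schouten_def n
        by (simp add: power2_eq_square[of t] scaleR_add_right scaleR_diff_left scaleR_diff_right mult_ac)
    qed
    also have "\<dots> = (t\<^sup>2) *\<^sub>R (c0 *\<^sub>R (schouten g p H + B) + (\<kappa> *\<^sub>R mat 1 - c0 *\<^sub>R B))"
      unfolding 3 by (simp add: schouten_def scaleR_add_right scaleR_diff_right 1 scaleR_diff_left)
    finally show ?thesis .
  qed
  have pd: "pos_def_matrix (\<kappa> *\<^sub>R mat 1 - c0 *\<^sub>R B)"
    unfolding pos_def_matrix_def
  proof (intro conjI allI impI)
    show "\<kappa> *\<^sub>R mat 1 - c0 *\<^sub>R B \<in> sym_matrices"
      by (intro sym_matrices_diff sym_matrices_scaleR sym_matrices_mat B(1))
    fix h :: "real^'n" assume "h \<noteq> 0"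
    then have h: "(norm h)\<^sup>2 > 0" by simp
    have "c0 * (h \<bullet> (B *v h)) \<le> c0 * (\<epsilon> * (norm h)\<^sup>2)"
      using B(2)[of h] c0 by (intro mult_left_mono) auto
    also have "\<dots> = (c0 * \<epsilon>) * (norm h)\<^sup>2" by simp
    also have "\<dots> < \<kappa> * (norm h)\<^sup>2"
      using order_less_le_trans[OF \<delta> \<kappa>] h by (intro mult_strict_right_mono) (auto simp: c0_def)
    finally show "0 < h \<bullet> ((\<kappa> *\<^sub>R mat 1 - c0 *\<^sub>R B) *v h)"
      by (simp add: mat_mult_simps inner_diff_right power2_norm_eq_inner)
  qed
  show ?thesis unfolding eq
    using t c0 by (intro U_cone U_add pd SB) auto
qed

end

section \<open>The viscosity property and contact at regular points\<close>

text \<open>The weak solution in the variable \<open>f\<close>: \<open>A j x\<close> is the matrix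
  of the approximation \<open>v j\<close> at \<open>x\<close>. A common superjet and subjet
  expresses second-order differentiability, and locally uniform convergence appears as convergence
  along subsequences at moving points, the form in which minimisers use it.\<close>

locale approx_solution = elliptic_cone U F
  for U :: "(real^'n^'n) set" and F +
  fixes \<Omega> :: "(real^'n) set" and f :: "real^'n \<Rightarrow> real" and v :: "nat \<Rightarrow> real^'n \<Rightarrow> real"
    and \<beta> A :: "nat \<Rightarrow> real^'n \<Rightarrow> real^'n^'n"
  assumes open_\<Omega>: "open \<Omega>" and f_cont: "continuous_on \<Omega> f" and f_pos: "\<And>x. x \<in> \<Omega> \<Longrightarrow> 0 < f x"
    and v_cont: "\<And>j. continuous_on \<Omega> (v j)" and v_pos: "\<And>j x. x \<in> \<Omega> \<Longrightarrow> 0 < v j x"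
    and v_jets: "\<And>j x. x \<in> \<Omega> \<Longrightarrow> \<exists>p H. superjet (v j) x p H \<and> subjet (v j) x p H \<and>
          H \<in> sym_matrices \<and> schouten (v j x) p H = A j x"
    and \<beta>_sym: "\<And>j x. x \<in> \<Omega> \<Longrightarrow> \<beta> j x \<in> sym_matrices"
    and A_U: "\<And>j x. x \<in> \<Omega> \<Longrightarrow> A j x + \<beta> j x \<in> U"
    and v_conv: "\<And>s y x. strict_mono s \<Longrightarrow> (\<And>k. y k \<in> \<Omega>) \<Longrightarrow> y \<longlonglongrightarrow> x \<Longrightarrow> x \<in> \<Omega> \<Longrightarrow>
          (\<lambda>k. v (s k) (y k)) \<longlonglongrightarrow> f x"
    and \<beta>_conv: "\<And>s y x. strict_mono s \<Longrightarrow> (\<And>k. y k \<in> \<Omega>) \<Longrightarrow> y \<longlonglongrightarrow> x \<Longrightarrow> x \<in> \<Omega> \<Longrightarrow>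
          (\<lambda>k. \<beta> (s k) (y k)) \<longlonglongrightarrow> 0"
    and F_conv: "\<And>s y x. strict_mono s \<Longrightarrow> (\<And>k. y k \<in> \<Omega>) \<Longrightarrow> y \<longlonglongrightarrow> x \<Longrightarrow> x \<in> \<Omega> \<Longrightarrow>
          (\<lambda>k. F (A (s k) (y k) + \<beta> (s k) (y k))) \<longlonglongrightarrow> 0"
begin

text \<open>Minimise \<open>v j - q\<close> for a quadratic \<open>q\<close> that touches
  \<open>f\<close> strictly from below at \<open>y\<close>. The minimisers accumulate only at
  \<open>y\<close>; there the Hessian of \<open>v j\<close> dominates that of \<open>q\<close>, so
  monotonicity bounds \<open>F\<close> at matrices tending to \<open>M\<close> by quantities tending
  to zero. Were the matrix in \<open>U\<close>, this would contradict
  \<open>F M > 0\<close>.\<close>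

lemma subsolution:
  assumes y: "y \<in> \<Omega>" and jet: "subjet f y p H" and H: "H \<in> sym_matrices"
  shows "schouten (f y) p H \<notin> U"
proof
  assume M0: "schouten (f y) p H \<in> U"
  obtain e where e: "e > 0" "\<And>N. N \<in> sym_matrices \<Longrightarrow> dist N (schouten (f y) p H) < e \<Longrightarrow> N \<in> U"
    using U_nhd[OF M0] by blast
  have fy: "f y > 0" using f_pos y by simp
  define L where "L = f y * (norm (mat 1 :: real^'n^'n) + 1)"
  have L: "L > 0" using fy by (simp add: L_def add_nonneg_pos)
  define \<eta> where "\<eta> = e / (2 * L)"
  have \<eta>: "\<eta> > 0" "\<eta> * L < e" using e L by (auto simp: \<eta>_def)
  \<comment> \<open>Lowering the Hessian by \<open>\<eta>\<close> makes the contact strict, while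
    \<open>\<eta> * L < e\<close> keeps the matrix in \<open>U\<close>.\<close>
  define K where "K = H - \<eta> *\<^sub>R mat 1"
  have K: "K \<in> sym_matrices" unfolding K_def by (intro sym_matrices_diff sym_matrices_scaleR sym_matrices_mat H)
  define M where "M = schouten (f y) p K"
  have MU: "M \<in> U"
  proof (rule e(2))
    show "M \<in> sym_matrices" unfolding M_def by (rule schouten_sym[OF K])
    have "M - schouten (f y) p H = - ((f y * \<eta>) *\<^sub>R mat 1)"
      by (simp add: M_def schouten_def K_def scaleR_diff_right)
    then have "dist M (schouten (f y) p H) = \<eta> * (f y * norm (mat 1 :: real^'n^'n))"
      using fy \<eta> by (simp add: dist_norm abs_mult)
    also have "\<dots> \<le> \<eta> * L" using \<eta> fy by (intro mult_left_mono) (auto simp: L_def)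
    finally show "dist M (schouten (f y) p H) < e" using \<eta> by simp
  qed
  define q where "q x = f y + p \<bullet> (x - y) + ((x - y) \<bullet> (K *v (x - y))) / 2" for x
  have q_exp: "q (z + h) = q z + (p + K *v (z - y)) \<bullet> h + (h \<bullet> (K *v h)) / 2" for z h
    unfolding q_def by (rule quadratic_expansion[OF K])
  have q_cont: "continuous_on S q" for S
    unfolding q_def by (intro continuous_intros matrix_vector_mult_linear_continuous_on
       continuous_on_compose2[OF matrix_vector_mult_linear_continuous_on[of UNIV K]]) auto
  have "\<forall>\<^sub>F h in nhds 0. q (y + h) + \<eta> / 4 * (norm h)\<^sup>2 \<le> f (y + h) \<and> y + h \<in> \<Omega>"
  proof (rule eventually_conj)
    have "\<forall>\<^sub>F h in nhds 0. f y + p \<bullet> h + (h \<bullet> (H *v h)) / 2 - \<eta> / 4 * (norm h)\<^sup>2 \<le> f (y + h)"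
      using jet \<eta>(1) unfolding subjet_iff by (elim allE[of _ "\<eta> / 4"]) simp
    then show "\<forall>\<^sub>F h in nhds 0. q (y + h) + \<eta> / 4 * (norm h)\<^sup>2 \<le> f (y + h)"
      by eventually_elim (simp add: q_def K_def mat_mult_simps inner_diff_right power2_norm_eq_inner
          field_simps)
    show "\<forall>\<^sub>F h in nhds 0. y + h \<in> \<Omega>" by (rule eventually_shift[OF open_\<Omega> y])
  qed
  then obtain d where d: "d > 0" "\<And>h. norm h < d \<Longrightarrow> q (y + h) + \<eta> / 4 * (norm h)\<^sup>2 \<le> f (y + h) \<and> y + h \<in> \<Omega>"
    unfolding eventually_nhds_metric by (auto simp: dist_norm)
  define r where "r = d / 2"
  have r: "r > 0" using d by (simp add: r_def)
  have below: "q x + \<eta> / 4 * (norm (x - y))\<^sup>2 \<le> f x" and sub: "x \<in> \<Omega>" if "x \<in> cball y r" for x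
    using d(2)[of "x - y"] that r by (auto simp: r_def dist_norm norm_minus_commute)
  have "\<exists>x\<in>cball y r. \<forall>z\<in>cball y r. v j x - q x \<le> v j z - q z" for j
    using r by (intro continuous_attains_inf continuous_intros q_cont
        continuous_on_subset[OF v_cont]) (auto intro: sub)
  then obtain X where X: "\<And>j. X j \<in> cball y r" "\<And>j z. z \<in> cball y r \<Longrightarrow> v j (X j) - q (X j) \<le> v j z - q z"
    by metis
  obtain z s where s: "z \<in> cball y r" "strict_mono s" "(X \<circ> s) \<longlonglongrightarrow> z"
    using compact_cball[of y r] X(1) unfolding compact_def by metis
  define Y where "Y k = X (s k)" for k
  have Y: "Y \<longlonglongrightarrow> z" "\<And>k. Y k \<in> cball y r" using s X by (auto simp: Y_def[abs_def] o_def)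
  have Y\<Omega>: "\<And>k. Y k \<in> \<Omega>" using Y sub by blast
  have qlim: "(\<lambda>k. q (Y k)) \<longlonglongrightarrow> q z"
    by (rule continuous_on_tendsto_compose[OF q_cont[of UNIV] Y(1)]) auto
  have "f z - q z \<le> f y - q y"
  proof (rule LIMSEQ_le)
    show "(\<lambda>k. v (s k) (Y k) - q (Y k)) \<longlonglongrightarrow> f z - q z"
      by (intro tendsto_diff v_conv s Y Y\<Omega> sub qlim)
    show "(\<lambda>k. v (s k) y - q y) \<longlonglongrightarrow> f y - q y"
      by (intro tendsto_diff v_conv[where y = "\<lambda>_. y"] s tendsto_const y)
    show "\<exists>N. \<forall>k\<ge>N. v (s k) (Y k) - q (Y k) \<le> v (s k) y - q y"
      using X(2) r by (auto simp: Y_def)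
  qed
  moreover have "q y = f y" by (simp add: q_def)
  ultimately have "\<eta> / 4 * (norm (z - y))\<^sup>2 \<le> 0" using below[OF s(1)] by simp
  then have zy: "z = y" using \<eta>(1) by (simp add: mult_le_0_iff)
  \<comment> \<open>The value is that of the approximation, gradient and Hessian are those of
    \<open>q\<close>. At a minimiser the gradients agree, so \<open>M' k\<close> differs from
    \<open>A + \<beta>\<close> only by a multiple of the difference of the Hessians.\<close>
  define M' where "M' k = schouten (v (s k) (Y k)) (p + K *v (Y k - y)) K + \<beta> (s k) (Y k)" for k
  have Ylim: "Y \<longlonglongrightarrow> y" using Y zy by simp
  have "M' \<longlonglongrightarrow> schouten (f y) (p + K *v (y - y)) K + 0"
    unfolding M'_def schouten_def
    by (intro tendsto_intros v_conv[OF s(2) Y\<Omega> Ylim y] \<beta>_conv[OF s(2) Y\<Omega> Ylim y] Ylim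
        bounded_linear.tendsto[OF matrix_vector_mul_bounded_linear]) simp
  then have M'lim: "M' \<longlonglongrightarrow> M" by (simp add: M_def)
  have M'sym: "M' k \<in> sym_matrices" for k
    unfolding M'_def by (intro sym_matrices_add schouten_sym K \<beta>_sym Y\<Omega>)
  have M'U: "\<forall>\<^sub>F k in sequentially. M' k \<in> U"
  proof -
    obtain e' where "e' > 0" "\<And>N. N \<in> sym_matrices \<Longrightarrow> dist N M < e' \<Longrightarrow> N \<in> U"
      using U_nhd[OF MU] by blast
    then show ?thesis using tendstoD[OF M'lim, of e'] M'sym by (auto elim: eventually_mono)
  qed
  have FM: "(\<lambda>k. F (M' k)) \<longlonglongrightarrow> F M"
  proof (rule continuous_within_tendsto_compose[OF _ M'U M'lim])
    show "continuous (at M within U) F"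
      using F_C1 MU by (auto simp: C1_on_sym_def intro: differentiable_imp_continuous_within)
  qed
  have "\<forall>\<^sub>F k in sequentially. Y k \<in> ball y r"
    using tendstoD[OF Ylim r] by eventually_elim (simp add: dist_commute)
  with M'U have "\<forall>\<^sub>F k in sequentially. F (M' k) \<le> F (A (s k) (Y k) + \<beta> (s k) (Y k))"
  proof eventually_elim
    case (elim k)
    obtain pk Hk where jk: "superjet (v (s k)) (Y k) pk Hk" "Hk \<in> sym_matrices"
       "schouten (v (s k) (Y k)) pk Hk = A (s k) (Y k)"
      using v_jets[OF Y\<Omega>] by metis
    have qj: "subjet q (Y k) (p + K *v (Y k - y)) K"
      by (rule subjet_quadratic) (rule q_exp)
    have "\<forall>\<^sub>F h in nhds 0. Y k + h \<in> ball y r" using elim by (intro eventually_shift) auto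
    then have "\<forall>\<^sub>F h in nhds 0. q (Y k + h) - q (Y k) \<le> v (s k) (Y k + h) - v (s k) (Y k)"
    proof eventually_elim
      case (elim h)
      then show ?case using X(2)[of "Y k + h" "s k"] by (simp add: Y_def)
    qed
    note t = jet_touch[OF jk(1) qj this]
    define N where "N = (v (s k) (Y k)) *\<^sub>R (Hk - K)"
    have "pos_semidef N"
      unfolding pos_semidef_def N_def
    proof (intro conjI allI)
      show "(v (s k) (Y k)) *\<^sub>R (Hk - K) \<in> sym_matrices"
        by (intro sym_matrices_scaleR sym_matrices_diff jk K)
      fix h
      have "0 \<le> v (s k) (Y k) * (h \<bullet> (Hk *v h) - h \<bullet> (K *v h))"
        using t(2)[of h] v_pos[OF Y\<Omega>, of "s k"] by (intro mult_nonneg_nonneg) (auto intro: less_imp_le)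
      then show "0 \<le> h \<bullet> (((v (s k) (Y k)) *\<^sub>R (Hk - K)) *v h)"
        by (simp add: mat_mult_simps inner_diff_right)
    qed
    then have "F (M' k) \<le> F (M' k + N)" using elim by (intro F_mono)
    also have "M' k + N = A (s k) (Y k) + \<beta> (s k) (Y k)"
      unfolding jk(3)[symmetric] t(1) by (simp add: M'_def N_def schouten_def scaleR_diff_right)
    finally show ?case .
  qed
  then have "F M \<le> 0"
    by (intro tendsto_le[OF _ F_conv[OF s(2) Y\<Omega> Ylim y] FM]) auto
  then show False using F_pos[OF MU] by simp
qed

text \<open>The inversion conjugates the matrix of \<open>v j\<close> by a reflection, under which
  \<open>U\<close> is invariant. The error matrix is conjugated too, and as a reflection is an
  isometry the bound on its quadratic form survives.\<close>

lemma conf_inv_jet: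
  assumes r: "r > 0" and y: "y \<noteq> x" "inversion x r y \<in> \<Omega>"
  shows "\<exists>p H B. subjet (conf_inv x r (v j)) y p H \<and> B \<in> sym_matrices \<and>
    schouten (conf_inv x r (v j) y) p H + B \<in> U \<and>
    (\<forall>h. \<bar>h \<bullet> (B *v h)\<bar> \<le> norm (\<beta> j (inversion x r y)) * (norm h)\<^sup>2)"
proof -
  define a where "a = y - x"
  have a: "a \<noteq> 0" "y = x + a" using y by (auto simp: a_def)
  define z where "z = inversion x r (x + a)"
  have z: "z \<in> \<Omega>" using y a by (simp add: z_def)
  obtain p H where j: "subjet (v j) z p H" "H \<in> sym_matrices" "schouten (v j z) p H = A j z"
    using v_jets[OF z] by metis
  define c where "c = v j z / r\<^sup>2 - (p \<bullet> a) / (norm a)\<^sup>2"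
  let ?P = "(2 * c) *\<^sub>R a + p"
  let ?H = "(2 * c) *\<^sub>R mat 1 + (r\<^sup>2 / (norm a)\<^sup>2) *\<^sub>R (reflection a ** H ** reflection a)"
  let ?B = "reflection a ** \<beta> j z ** reflection a"
  \<comment> \<open>The transformation rule is stated for superjets and is linear in the jet, so it
    is applied to \<open>- v j\<close> and the signs are undone afterwards.\<close>
  have "superjet (\<lambda>x. - v j x) (inversion x r (x + a)) (- p) (- H)"
    using j(1) by (simp add: subjet_def z_def)
  from superjet_inversion[OF a(1) r this]
  have sj: "superjet (conf_inv x r (\<lambda>x. - v j x)) (x + a)
     ((2 * (- v j z / r\<^sup>2 - (- p \<bullet> a) / (norm a)\<^sup>2)) *\<^sub>R a + - p)
     ((2 * (- v j z / r\<^sup>2 - (- p \<bullet> a) / (norm a)\<^sup>2)) *\<^sub>R mat 1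
        + (r\<^sup>2 / (norm a)\<^sup>2) *\<^sub>R (reflection a ** - H ** reflection a))"
    by (simp only: z_def)
  have 1: "conf_inv x r (\<lambda>x. - v j x) = (\<lambda>y. - conf_inv x r (v j) y)"
    by (auto simp: conf_inv_def)
  have 2: "- v j z / r\<^sup>2 - (- p \<bullet> a) / (norm a)\<^sup>2 = - c" by (simp add: c_def)
  have 3: "reflection a ** - H ** reflection a = - (reflection a ** H ** reflection a)"
  proof (rule matrix_eq[THEN iffD2], rule allI)
    show "(reflection a ** - H ** reflection a) *v h = (- (reflection a ** H ** reflection a)) *v h" for h
      by (simp add: matrix_vector_mul_assoc[symmetric] mat_mult_minus
          linear_neg[OF matrix_vector_mul_linear])
  qed
  have 4: "(2 * - c) *\<^sub>R a + - p = - ?P" by simp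
  have 5: "(2 * - c) *\<^sub>R mat 1 + (r\<^sup>2 / (norm a)\<^sup>2) *\<^sub>R - (reflection a ** H ** reflection a) = - ?H"
    by simp
  have jet: "subjet (conf_inv x r (v j)) y ?P ?H"
    using sj unfolding 1 2 3 4 5 subjet_def a(2) .
  have S: "schouten (conf_inv x r (v j) y) ?P ?H = reflection a ** A j z ** reflection a"
    using schouten_inversion[OF a(1), of r "v j z" p H] r j(3)
    by (simp add: conf_inv_def a(2) c_def z_def)
  have "reflection a ** (A j z + \<beta> j z) ** reflection a \<in> U"
    by (intro U_conj_reflection a A_U z)
  then have SU: "schouten (conf_inv x r (v j) y) ?P ?H + ?B \<in> U"
  proof -
    have "reflection a ** A j z ** reflection a + ?B = reflection a ** (A j z + \<beta> j z) ** reflection a"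
    proof (rule matrix_eq[THEN iffD2], rule allI)
      show "(reflection a ** A j z ** reflection a + ?B) *v h
         = (reflection a ** (A j z + \<beta> j z) ** reflection a) *v h" for h
        by (simp add: matrix_vector_mul_assoc[symmetric] matrix_vector_mult_add_rdistrib matrix_vector_right_distrib)
    qed
    then show ?thesis using \<open>reflection a ** (A j z + \<beta> j z) ** reflection a \<in> U\<close> unfolding S by simp
  qed
  have "\<bar>h \<bullet> (?B *v h)\<bar> \<le> norm (\<beta> j z) * (norm h)\<^sup>2" for h
    using abs_quadratic_form_le[of "reflection a *v h" "\<beta> j z"]
    by (simp only: reflection_conj_inner norm_reflection[OF a(1)])
  moreover have "?B \<in> sym_matrices" by (intro conj_reflection_sym \<beta>_sym z)
  moreover have "z = inversion x r y" by (simp add: z_def a(2))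
  ultimately show ?thesis using jet SU by blast
qed

lemma inversion_continuous_on: "continuous_on (- {x}) (inversion x r)"
  unfolding inversion_def by (intro continuous_intros) auto

lemma conf_inv_tendsto:
  assumes r: "r > 0" and s: "strict_mono s" and y: "y \<noteq> x" "inversion x r y \<in> \<Omega>"
    and Y: "\<And>k. Y k \<noteq> x" "\<And>k. inversion x r (Y k) \<in> \<Omega>" "Y \<longlonglongrightarrow> y"
  shows "(\<lambda>k. inversion x r (Y k)) \<longlonglongrightarrow> inversion x r y"
    "(\<lambda>k. conf_inv x r (v (s k)) (Y k)) \<longlonglongrightarrow> conf_inv x r f y"
proof -
  show i: "(\<lambda>k. inversion x r (Y k)) \<longlonglongrightarrow> inversion x r y"
    using Y(1) y(1) by (intro continuous_on_tendsto_compose[OF inversion_continuous_on Y(3)]) auto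
  show "(\<lambda>k. conf_inv x r (v (s k)) (Y k)) \<longlonglongrightarrow> conf_inv x r f y"
    unfolding conf_inv_def
    using r by (intro tendsto_intros Y(3) v_conv[OF s Y(2) i y(2)]) simp
qed

text \<open>After the contact has been made strict, \<open>f - t (g_j + Q)\<close> has minimisers
  that converge to \<open>y\<close> along a subsequence. There \<open>f\<close> inherits a subjet
  from \<open>t (g_j + Q)\<close>, and its matrix lies in \<open>U\<close> once the error of
  \<open>g_j\<close> is smaller than the gain from \<open>Q\<close>. This contradicts
  \<open>subsolution\<close>, which holds at every point and not only at \<open>y\<close>.\<close>

lemma no_regular_touching:
  fixes x y b :: "real^'n"
  assumes r: "r > 0" and t: "t > 0" and y: "y \<in> \<Omega>" "y \<noteq> x" "inversion x r y \<in> \<Omega>"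
    and disc: "\<mu> > 0" "2 * \<mu> * e - (norm b)\<^sup>2 > 0"
    and eq: "f y = t * (conf_inv x r f y + paraboloid e b \<mu> y)"
    and touch: "\<forall>\<^sub>F z in nhds y. t * (conf_inv x r f z + paraboloid e b \<mu> z) \<le> f z"
  shows False
proof -
  let ?g = "conf_inv x r f" and ?gj = "\<lambda>j. conf_inv x r (v j)"
  obtain \<nu> where \<nu>: "\<nu> > 0" "\<mu> - \<nu> > 0"
    "2 * (\<mu> - \<nu>) * (e - \<nu> / 2 * (norm y)\<^sup>2) - (norm (b + \<nu> *\<^sub>R y))\<^sup>2 > 0"
    using discriminant_perturb[OF disc, of y] by blast
  define e' b' \<mu>' where "e' = e - \<nu> / 2 * (norm y)\<^sup>2" and "b' = b + \<nu> *\<^sub>R y" and "\<mu>' = \<mu> - \<nu>"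
  define \<delta> where "\<delta> = 2 * \<mu>' * e' - (norm b')\<^sup>2"
  have \<mu>': "\<mu>' > 0" "\<delta> > 0" using \<nu> by (auto simp: \<mu>'_def \<delta>_def e'_def b'_def)
  let ?Q = "paraboloid e' b' \<mu>'"
  have Q: "?Q z = paraboloid e b \<mu> z - \<nu> / 2 * (norm (z - y))\<^sup>2" for z
    unfolding paraboloid_diff e'_def b'_def \<mu>'_def ..
  have "open ((- {x}) \<inter> inversion x r -` \<Omega>)"
    by (rule continuous_open_preimage[OF inversion_continuous_on _ open_\<Omega>]) auto
  then have "\<forall>\<^sub>F z in nhds y. z \<in> \<Omega> \<inter> ((- {x}) \<inter> inversion x r -` \<Omega>)"
    using y by (intro eventually_nhds_in_open open_Int[OF open_\<Omega>]) auto
  with touch have "\<forall>\<^sub>F z in nhds y. t * (?g z + paraboloid e b \<mu> z) \<le> f z \<and>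
      z \<in> \<Omega> \<and> z \<noteq> x \<and> inversion x r z \<in> \<Omega>"
    by eventually_elim auto
  then obtain d where d: "d > 0" "\<And>z. dist z y \<le> d \<Longrightarrow> t * (?g z + paraboloid e b \<mu> z) \<le> f z \<and>
      z \<in> \<Omega> \<and> z \<noteq> x \<and> inversion x r z \<in> \<Omega>"
    unfolding eventually_nhds_metric_le by auto
  define D where "D = cball y d"
  have D: "z \<in> \<Omega>" "z \<noteq> x" "inversion x r z \<in> \<Omega>" and
    below: "t * (?g z + ?Q z) + t * \<nu> / 2 * (norm (z - y))\<^sup>2 \<le> f z" if "z \<in> D" for z
  proof -
    have "dist z y \<le> d" using that by (simp add: D_def dist_commute)
    from d(2)[OF this] show "z \<in> \<Omega>" "z \<noteq> x" "inversion x r z \<in> \<Omega>"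
      "t * (?g z + ?Q z) + t * \<nu> / 2 * (norm (z - y))\<^sup>2 \<le> f z"
      by (auto simp: Q algebra_simps)
  qed
  have yD: "y \<in> D" using d by (simp add: D_def)
  have gj_cont: "continuous_on D (?gj j)" for j
    unfolding conf_inv_def
    by (intro continuous_intros continuous_on_compose2[OF v_cont]
        continuous_on_subset[OF inversion_continuous_on]) (use D r in auto)
  define \<phi> where "\<phi> j z = f z - t * (?gj j z + ?Q z)" for j z
  have "\<exists>z\<in>D. \<forall>w\<in>D. \<phi> j z \<le> \<phi> j w" for j
    unfolding \<phi>_def using yD D
    by (intro continuous_attains_inf continuous_intros gj_cont continuous_on_subset[OF f_cont]
        continuous_on_paraboloid) (auto simp: D_def)
  then obtain X where X: "\<And>j. X j \<in> D" "\<And>j w. w \<in> D \<Longrightarrow> \<phi> j (X j) \<le> \<phi> j w"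
    by metis
  obtain z s where s: "z \<in> D" "strict_mono s" "(X \<circ> s) \<longlonglongrightarrow> z"
    using compact_cball[of y d] X(1) unfolding compact_def D_def by metis
  define Y where "Y k = X (s k)" for k
  have Y: "Y \<longlonglongrightarrow> z" "\<And>k. Y k \<in> D" using s X by (auto simp: Y_def[abs_def] o_def)
  have fY: "(\<lambda>k. f (Y k)) \<longlonglongrightarrow> f z"
    using D Y s by (intro continuous_on_tendsto_compose[OF f_cont]) auto
  have gY: "(\<lambda>k. ?gj (s k) (Y k)) \<longlonglongrightarrow> ?g z"
    by (intro conf_inv_tendsto r s D Y)
  have \<phi>Y: "(\<lambda>k. \<phi> (s k) (Y k)) \<longlonglongrightarrow> f z - t * (?g z + ?Q z)"
    unfolding \<phi>_def by (intro tendsto_intros fY gY tendsto_paraboloid Y)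
  have "f z - t * (?g z + ?Q z) \<le> f y - t * (?g y + ?Q y)"
  proof (rule LIMSEQ_le[OF \<phi>Y])
    show "(\<lambda>k. \<phi> (s k) y) \<longlonglongrightarrow> f y - t * (?g y + ?Q y)"
      unfolding \<phi>_def
      by (intro tendsto_intros conf_inv_tendsto(2)[where Y = "\<lambda>_. y"] r s D yD)
    show "\<exists>N. \<forall>k\<ge>N. \<phi> (s k) (Y k) \<le> \<phi> (s k) y"
      using X(2) yD by (auto simp: Y_def)
  qed
  moreover have "f y - t * (?g y + ?Q y) = 0" unfolding Q eq by simp
  ultimately have "t * \<nu> / 2 * (norm (z - y))\<^sup>2 \<le> 0" using below[OF s(1)] by simp
  then have zy: "z = y" using t \<nu>(1) by (simp add: mult_le_0_iff)
  note lim = Y(1)[unfolded zy] fY[unfolded zy] gY[unfolded zy]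
  have \<phi>0: "(\<lambda>k. \<phi> (s k) (Y k)) \<longlonglongrightarrow> 0"
    using \<phi>Y unfolding zy \<open>f y - t * (?g y + ?Q y) = 0\<close> .
  \<comment> \<open>The minimum value is absorbed into the constant term of the paraboloid, so that
    \<open>t * (g k + q k)\<close> is exactly \<open>f (Y k)\<close>. As that value tends to zero,
    the discriminant with \<open>q k\<close> and \<open>G k\<close> still tends to
    \<open>\<delta>\<close>.\<close>
  define q where "q k = ?Q (Y k) + \<phi> (s k) (Y k) / t" for k
  define G where "G k = b' + \<mu>' *\<^sub>R Y k" for k
  define g where "g k = ?gj (s k) (Y k)" for k
  define \<epsilon> where "\<epsilon> k = norm (\<beta> (s k) (inversion x r (Y k)))" for k
  have qlim: "q \<longlonglongrightarrow> ?Q y + 0 / t"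
    unfolding q_def using t by (intro tendsto_intros tendsto_paraboloid lim \<phi>0) auto
  have glim: "g \<longlonglongrightarrow> ?g y" unfolding g_def by (rule lim)
  have gy: "?g y > 0" using y r f_pos by (simp add: conf_inv_def)
  have \<epsilon>lim: "\<epsilon> \<longlonglongrightarrow> norm (0 :: real^'n^'n)"
    unfolding \<epsilon>_def
    by (rule tendsto_norm[OF \<beta>_conv[OF s(2) D(3)[OF Y(2)] conf_inv_tendsto(1)[OF r s(2) y(2,3)
            D(2)[OF Y(2)] D(3)[OF Y(2)] lim(1)] y(3)]])
  \<comment> \<open>The smallness condition of \<open>schouten_add_paraboloid\<close> as a
    difference; its limit \<open>\<delta> / 2\<close> leaves room for it to hold eventually.\<close>
  have "(\<lambda>k. (2 * \<mu>' * q k - (norm (G k))\<^sup>2) / 2 - (1 + q k / g k) * \<epsilon> k) \<longlonglongrightarrow>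
     (2 * \<mu>' * (?Q y + 0 / t) - (norm (b' + \<mu>' *\<^sub>R y))\<^sup>2) / 2
       - (1 + (?Q y + 0 / t) / ?g y) * norm (0 :: real^'n^'n)"
    unfolding G_def by (intro tendsto_intros qlim glim \<epsilon>lim lim) (use gy in auto)
  moreover have "2 * \<mu>' * (?Q y + 0 / t) - (norm (b' + \<mu>' *\<^sub>R y))\<^sup>2 = \<delta>"
    unfolding \<delta>_def using paraboloid_discriminant[of \<mu>' e' b' y] by simp
  ultimately have lim1: "(\<lambda>k. (2 * \<mu>' * q k - (norm (G k))\<^sup>2) / 2 - (1 + q k / g k) * \<epsilon> k) \<longlonglongrightarrow> \<delta> / 2"
    by simp
  have "(\<lambda>k. 2 * \<mu>' * q k - (norm (G k))\<^sup>2) \<longlonglongrightarrow> 2 * \<mu>' * (?Q y + 0 / t) - (norm (b' + \<mu>' *\<^sub>R y))\<^sup>2"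
    unfolding G_def by (intro tendsto_intros qlim lim)
  then have lim2: "(\<lambda>k. 2 * \<mu>' * q k - (norm (G k))\<^sup>2) \<longlonglongrightarrow> \<delta>"
    unfolding \<open>2 * \<mu>' * (?Q y + 0 / t) - (norm (b' + \<mu>' *\<^sub>R y))\<^sup>2 = \<delta>\<close> .
  have "\<forall>\<^sub>F k in sequentially. 0 < (2 * \<mu>' * q k - (norm (G k))\<^sup>2) / 2 - (1 + q k / g k) * \<epsilon> k"
    by (rule order_tendstoD(1)[OF lim1]) (use \<mu>' in simp)
  moreover have "\<forall>\<^sub>F k in sequentially. 0 < 2 * \<mu>' * q k - (norm (G k))\<^sup>2"
    by (rule order_tendstoD(1)[OF lim2]) (use \<mu>' in simp)
  moreover have "\<forall>\<^sub>F k in sequentially. Y k \<in> ball y d"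
    using tendstoD[OF lim(1) d(1)] by eventually_elim (simp add: dist_commute)
  moreover have "\<forall>\<^sub>F k in sequentially. 0 < g k"
    using order_tendstoD(1)[OF glim gy] .
  ultimately have "\<forall>\<^sub>F k in sequentially. False"
  proof eventually_elim
    case (elim k)
    obtain p H B where j: "subjet (?gj (s k)) (Y k) p H" "B \<in> sym_matrices"
      "schouten (?gj (s k) (Y k)) p H + B \<in> U"
      "\<And>h. \<bar>h \<bullet> (B *v h)\<bar> \<le> norm (\<beta> (s k) (inversion x r (Y k))) * (norm h)\<^sup>2"
      using conf_inv_jet[OF r, of "Y k" x "s k"] D Y(2) by metis
    have Hsym: "H \<in> sym_matrices"
    proof (rule sym_of_schouten)
      have "(schouten (g k) p H + B) - B \<in> sym_matrices"
        using j U_sym by (intro sym_matrices_diff) (auto simp: g_def)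
      then show "schouten (g k) p H \<in> sym_matrices" by simp
    qed (use elim in auto)
    have "schouten (t * (g k + q k)) (t *\<^sub>R (p + G k)) (t *\<^sub>R (H + \<mu>' *\<^sub>R mat 1)) \<in> U"
      using elim j by (intro schouten_add_paraboloid[where \<epsilon> = "\<epsilon> k" and B = B] \<mu>' t refl)
        (auto simp: g_def \<epsilon>_def)
    moreover have "t * (g k + q k) = f (Y k)"
      using t by (simp add: q_def g_def \<phi>_def field_simps)
    ultimately have inU: "schouten (f (Y k)) (t *\<^sub>R (p + G k)) (t *\<^sub>R (H + \<mu>' *\<^sub>R mat 1)) \<in> U"
      by simp
    have "subjet (\<lambda>z. t * (?gj (s k) z + ?Q z)) (Y k) (t *\<^sub>R (p + G k)) (t *\<^sub>R (H + \<mu>' *\<^sub>R mat 1))"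
      unfolding G_def by (rule subjet_add_quadratic[OF j(1) paraboloid_expansion t])
    moreover have "\<forall>\<^sub>F h in nhds 0. t * (?gj (s k) (Y k + h) + ?Q (Y k + h)) - t * (?gj (s k) (Y k) + ?Q (Y k))
        \<le> f (Y k + h) - f (Y k)"
    proof -
      have "\<forall>\<^sub>F h in nhds 0. Y k + h \<in> ball y d" using elim by (intro eventually_shift) auto
      then show ?thesis
      proof eventually_elim
        case (elim h)
        then have "Y k + h \<in> D" by (simp add: D_def)
        from X(2)[OF this, of "s k"] show ?case by (simp add: \<phi>_def Y_def)
      qed
    qed
    ultimately have "subjet f (Y k) (t *\<^sub>R (p + G k)) (t *\<^sub>R (H + \<mu>' *\<^sub>R mat 1))"
      by (rule subjet_touch)
    moreover have "t *\<^sub>R (H + \<mu>' *\<^sub>R mat 1) \<in> sym_matrices"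
      by (intro sym_matrices_scaleR sym_matrices_add sym_matrices_mat Hsym)
    ultimately show False using subsolution D(1)[OF Y(2)] inU by blast
  qed
  then show False by simp
qed

end

section \<open>The punctured maximum principle\<close>

lemma superjet_add_quadratic:
  assumes g: "superjet g y p H" and Q: "\<And>h. Q (y + h) = Q y + G \<bullet> h + (h \<bullet> (K *v h)) / 2" and t: "t > 0"
  shows "superjet (\<lambda>x. t * (g x + Q x)) y (t *\<^sub>R (p + G)) (t *\<^sub>R (H + K))"
proof -
  have "subjet (\<lambda>x. t * (- g x + - Q x)) y (t *\<^sub>R (- p + - G)) (t *\<^sub>R (- H + - K))"
    by (rule subjet_add_quadratic[OF _ _ t]) (use g in \<open>auto simp: subjet_def Q mat_mult_minus\<close>)
  moreover have "- (t * (- g x + - Q x)) = t * (g x + Q x)" for x by (simp add: algebra_simps)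
  moreover have "- (t *\<^sub>R (- p + - G)) = t *\<^sub>R (p + G)" by (simp add: algebra_simps)
  moreover have "- (t *\<^sub>R (- H + - K)) = t *\<^sub>R (H + K)" by (simp add: algebra_simps)
  ultimately show ?thesis unfolding subjet_def by (simp only:)
qed

lemma superjet_touch:
  assumes "superjet q y p H" "\<forall>\<^sub>F h in nhds 0. f (y + h) - f y \<le> q (y + h) - q y"
  shows "superjet f y p H"
  unfolding superjet_def
proof (intro allI impI)
  fix e :: real assume "e > 0"
  with assms(1) have "\<forall>\<^sub>F h in nhds 0. q (y + h) \<le> q y + p \<bullet> h + (h \<bullet> (H *v h)) / 2 + e * (norm h)\<^sup>2"
    unfolding superjet_def by blast
  then show "\<forall>\<^sub>F h in nhds 0. f (y + h) \<le> f y + p \<bullet> h + (h \<bullet> (H *v h)) / 2 + e * (norm h)\<^sup>2"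
    using assms(2) by eventually_elim simp
qed

text \<open>The barrier is \<open>\<bar>z - P\<bar> powr (- 1 / 2)\<close>, strictly superharmonic and infinite at \<open>P\<close> as \<open>n \<ge> 3\<close>.\<close>

lemma punctured_max_principle:
  fixes k :: "real^'n \<Rightarrow> real"
  assumes n: "CARD('n) \<ge> 3" and cont: "continuous_on (cball P r - {P}) k"
    and C: "\<And>z. z \<in> cball P r - {P} \<Longrightarrow> k z \<le> C"
    and sub: "\<And>z p H. z \<in> ball P r - {P} \<Longrightarrow> superjet k z p H \<Longrightarrow> 0 \<le> trace H"
    and bd: "\<And>z. dist P z = r \<Longrightarrow> k z \<le> c + b \<bullet> (z - P)"
    and z: "z \<in> ball P r - {P}"
  shows "k z \<le> c + b \<bullet> (z - P)"
proof (rule ccontr)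
  assume not: "\<not> k z \<le> c + b \<bullet> (z - P)"
  \<comment> \<open>The exponent belongs to the squared distance \<open>s\<close>. The Laplacian of
    \<open>s powr a\<close> is \<open>2 * a * s powr (a - 1) * (n + 2 * (a - 1))\<close>, which is
    negative for \<open>n > 5 / 2\<close>.\<close>
  define a :: real where "a = - 1 / 4"
  define N where "N z = ((norm (z - P))\<^sup>2) powr a" for z
  have N_pos: "N z > 0" if "z \<noteq> P" for z using that by (simp add: N_def)
  define l where "l z = c + b \<bullet> (z - P)" for z
  \<comment> \<open>Half of the largest admissible multiple: the excess of \<open>k\<close> over the
    linear function at \<open>z\<close> stays positive after subtracting the barrier.\<close>
  define t where "t = (k z - l z) / (2 * N z)"
  have Nz: "N z > 0" using z N_pos by blast
  have t: "t > 0" using not Nz by (simp add: t_def l_def)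
  have tN: "k z - l z - t * N z > 0" using not Nz by (simp add: t_def l_def)
  \<comment> \<open>\<open>E\<close> exceeds \<open>k - l\<close> on the whole punctured ball, and
    within distance \<open>\<rho>\<close> of \<open>P\<close> the barrier \<open>t * N\<close> is at
    least \<open>E\<close>. The maximum is thereby kept away from the puncture.\<close>
  define E where "E = \<bar>C - c + norm b * r\<bar> + 1"
  define \<rho> where "\<rho> = (E / t) powr (- 2)"
  have E: "E > 0" by (simp add: E_def add_nonneg_pos)
  have \<rho>: "\<rho> > 0" using E t by (simp add: \<rho>_def)
  have near: "k w - l w - t * N w < 0" if "dist P w \<le> \<rho>" "w \<in> cball P r - {P}" for w
  proof -
    have nw: "norm (w - P) > 0" "norm (w - P) \<le> \<rho>" "norm (w - P) \<le> r"
      using that by (auto simp: dist_norm norm_minus_commute)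
    have "E / t = \<rho> powr (- 1 / 2)" using E t by (simp add: \<rho>_def powr_powr)
    also have "\<dots> \<le> norm (w - P) powr (- 1 / 2)" using nw by (intro powr_mono2') auto
    also have "\<dots> = N w"
      using nw by (simp add: N_def a_def powr_powr powr_numeral[symmetric] del: powr_numeral)
    finally have "E \<le> t * N w" using t by (simp add: field_simps)
    moreover have "k w \<le> C" using C that by blast
    moreover have "\<bar>b \<bullet> (w - P)\<bar> \<le> norm b * r"
      using order_trans[OF Cauchy_Schwarz_ineq2 mult_left_mono[OF nw(3) norm_ge_zero]] .
    ultimately show ?thesis unfolding l_def E_def by linarith
  qed
  define S where "S = cball P r - ball P \<rho>"
  have SP: "w \<noteq> P" if "w \<in> S" for w using that \<rho> by (auto simp: S_def)
  have Ssub: "S \<subseteq> cball P r - {P}" using \<rho> by (auto simp: S_def)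
  have zS: "z \<in> S" using near[of z] z tN by (fastforce simp: S_def)
  have "compact S" unfolding S_def by (intro compact_diff) auto
  moreover have "continuous_on S (\<lambda>w. k w - l w - t * N w)"
    unfolding l_def N_def
    by (intro continuous_intros continuous_on_subset[OF cont Ssub]) (auto dest: SP)
  ultimately obtain y where y: "y \<in> S" "\<And>w. w \<in> S \<Longrightarrow> k w - l w - t * N w \<le> k y - l y - t * N y"
    using continuous_attains_sup[of S "\<lambda>w. k w - l w - t * N w"] zS by blast
  have ypos: "k y - l y - t * N y > 0" using y(2)[OF zS] tN by simp
  have yP: "y \<noteq> P" using SP y by blast
  have "dist P y \<noteq> r"
  proof
    assume "dist P y = r"
    then have "k y \<le> l y" using bd by (simp add: l_def)
    moreover have "t * N y > 0" using t N_pos[OF yP] by simp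
    ultimately show False using ypos by simp
  qed
  then have yr: "dist P y < r" using y(1) by (simp add: S_def)
  have y\<rho>: "dist P y > \<rho>"
    using near[of y] ypos y(1) Ssub by force
  define s where "s = (norm (y - P))\<^sup>2"
  have s: "s > 0" using yP by (simp add: s_def)
  have "subjet (\<lambda>w. (norm (w - P))\<^sup>2) y (2 *\<^sub>R (y - P)) (2 *\<^sub>R mat 1)"
  proof (rule subjet_quadratic)
    fix h
    have "y + h - P = (y - P) + h" by simp
    then show "(norm (y + h - P))\<^sup>2 = (norm (y - P))\<^sup>2 + (2 *\<^sub>R (y - P)) \<bullet> h + (h \<bullet> ((2 *\<^sub>R mat 1) *v h)) / 2"
      unfolding power2_norm_eq_inner
      by (simp only: inner_add_left inner_add_right mat_mult_simps) (simp add: inner_commute)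
  qed
  from superjet_powr[OF this, of a] s have "superjet N y ((a * s powr (a - 1)) *\<^sub>R (2 *\<^sub>R (y - P)))
    ((a * s powr (a - 1)) *\<^sub>R (2 *\<^sub>R mat 1) + (a * (a - 1) * s powr (a - 2)) *\<^sub>R outer (2 *\<^sub>R (y - P)) (2 *\<^sub>R (y - P)))"
    (is "superjet N y ?p ?H")
    by (simp add: s_def N_def[abs_def] a_def)
  then have "superjet (\<lambda>w. t * (N w + l w / t)) y (t *\<^sub>R (?p + (1 / t) *\<^sub>R b)) (t *\<^sub>R (?H + 0))"
  proof (rule superjet_add_quadratic[OF _ _ t])
    fix h
    have "l (y + h) = l y + b \<bullet> h" by (simp add: l_def inner_add_right inner_diff_right)
    then show "l (y + h) / t = l y / t + ((1 / t) *\<^sub>R b) \<bullet> h + (h \<bullet> (0 *v h)) / 2"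
      by (simp add: add_divide_distrib)
  qed
  moreover have "(\<lambda>w. t * (N w + l w / t)) = (\<lambda>w. t * N w + l w)"
    using t by (simp add: distrib_left)
  ultimately have q: "superjet (\<lambda>w. t * N w + l w) y (t *\<^sub>R (?p + (1 / t) *\<^sub>R b)) (t *\<^sub>R ?H)"
    by simp
  have "open (ball P r - cball P \<rho>)" "y \<in> ball P r - cball P \<rho>" using yr y\<rho> by auto
  from eventually_shift[OF this]
  have "\<forall>\<^sub>F h in nhds 0. k (y + h) - k y \<le> (t * N (y + h) + l (y + h)) - (t * N y + l y)"
  proof eventually_elim
    case (elim h)
    then have "y + h \<in> S" by (auto simp: S_def)
    from y(2)[OF this] show ?case by simp
  qed
  then have "superjet k y (t *\<^sub>R (?p + (1 / t) *\<^sub>R b)) (t *\<^sub>R ?H)" by (rule superjet_touch[OF q])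
  then have "0 \<le> trace (t *\<^sub>R ?H)" using sub yr yP by auto
  moreover have "trace (t *\<^sub>R ?H) = t * (2 * a * s powr (a - 1) * (real CARD('n) + 2 * (a - 1)))"
  proof -
    have "(2 *\<^sub>R (y - P)) \<bullet> (2 *\<^sub>R (y - P)) = 4 * s"
      by (simp add: s_def power2_norm_eq_inner)
    then have A: "trace (t *\<^sub>R ?H) = t * (a * s powr (a - 1) * (2 * real CARD('n)) + a * (a - 1) * s powr (a - 2) * (4 * s))"
      by (simp add: trace_scaleR trace_add trace_outer trace_mat_1)
    have "s powr (a - 2) * s = s powr (a - 1)"
      using s powr_add[of s "a - 2" 1] by simp
    moreover have "a * (a - 1) * s powr (a - 2) * (4 * s) = 4 * a * (a - 1) * (s powr (a - 2) * s)"
      by (simp only: mult_ac)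
    ultimately have B: "a * (a - 1) * s powr (a - 2) * (4 * s) = 4 * a * (a - 1) * s powr (a - 1)"
      by (simp only:)
    show ?thesis unfolding A B by (simp add: algebra_simps)
  qed
  moreover have "t * (2 * a * s powr (a - 1) * (real CARD('n) + 2 * (a - 1))) < 0"
  proof -
    have "real CARD('n) + 2 * (a - 1) > 0" using n by (simp add: a_def)
    moreover have "2 * a * s powr (a - 1) < 0" using s by (simp add: a_def)
    ultimately show ?thesis using t by (simp add: mult_pos_neg mult_neg_pos)
  qed
  ultimately show False by simp
qed

section \<open>Traces: superharmonicity and its conformal invariance\<close>

text \<open>Since \<open>a * (n - 2) = - 2\<close>, the terms quadratic in the gradient cancel. This
  is the flat conformal Laplacian: the trace of \<open>A\<^sup>u\<close> is a negative multiple of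
  the Laplacian of \<open>u\<close>.\<close>

lemma trace_schouten_powr:
  fixes p :: "real^'n" and H :: "real^'n^'n" and s :: real
  assumes n: "CARD('n) \<ge> 3" and s: "s > 0"
  defines "a \<equiv> - 2 / (real CARD('n) - 2)"
  shows "trace (schouten (s powr a) ((a * s powr (a - 1)) *\<^sub>R p)
      ((a * s powr (a - 1)) *\<^sub>R H + (a * (a - 1) * s powr (a - 2)) *\<^sub>R outer p p))
    = a * s powr (2 * a - 1) * trace H"
proof -
  define m where "m = real CARD('n)"
  have m: "m - 2 > 0" using n by (simp add: m_def)
  have am: "a * (m - 2) = - 2"
    unfolding a_def m_def[symmetric] using m by (simp only: times_divide_eq_left) (subst nonzero_mult_div_cancel_right; simp)
  have e1: "s powr a * s powr (a - 1) = s powr (2 * a - 1)"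
    by (simp add: powr_add[symmetric])
  have e2: "s powr a * s powr (a - 2) = s powr (2 * a - 2)"
    by (simp add: powr_add[symmetric])
  have e3: "(s powr (a - 1))\<^sup>2 = s powr (2 * a - 2)"
    by (simp add: powr_add[symmetric] power2_eq_square)
  have n2: "(norm ((a * s powr (a - 1)) *\<^sub>R p))\<^sup>2 = a\<^sup>2 * s powr (2 * a - 2) * (p \<bullet> p)"
    by (simp add: power_mult_distrib e3 power2_norm_eq_inner)
  have "trace (schouten (s powr a) ((a * s powr (a - 1)) *\<^sub>R p)
      ((a * s powr (a - 1)) *\<^sub>R H + (a * (a - 1) * s powr (a - 2)) *\<^sub>R outer p p))
     = a * (s powr a * s powr (a - 1)) * trace H + a * (a - 1) * (s powr a * s powr (a - 2)) * (p \<bullet> p)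
       - m * (a\<^sup>2 * s powr (2 * a - 2) * (p \<bullet> p)) / 2"
    unfolding trace_schouten n2
    unfolding trace_add trace_scaleR trace_outer m_def[symmetric] by (simp add: distrib_left mult_ac)
  also have "\<dots> = a * s powr (2 * a - 1) * trace H
      - (a * (a * (m - 2) + 2)) / 2 * s powr (2 * a - 2) * (p \<bullet> p)"
    unfolding e1 e2
    by (simp add: power2_eq_square algebra_simps diff_divide_distrib add_divide_distrib)
  finally show ?thesis unfolding am by simp
qed

lemma inversion_involution:
  assumes "y \<noteq> x" "r > 0"
  shows "inversion x r (inversion x r y) = y" "inversion x r y \<noteq> x"
    "norm (inversion x r y - x) = r\<^sup>2 / norm (y - x)"
proof -
  have n: "norm (y - x) > 0" using assms by simp
  show 1: "norm (inversion x r y - x) = r\<^sup>2 / norm (y - x)"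
    using n by (simp add: inversion_def power2_eq_square)
  then have "norm (inversion x r y - x) > 0" using n assms(2) by simp
  then show "inversion x r y \<noteq> x" by auto
  show "inversion x r (inversion x r y) = y"
  proof -
    have "inversion x r y - x = (r\<^sup>2 / (norm (y - x))\<^sup>2) *\<^sub>R (y - x)" by (simp add: inversion_def)
    then have "inversion x r (inversion x r y)
        = x + (r\<^sup>2 / (r\<^sup>2 / norm (y - x))\<^sup>2 * (r\<^sup>2 / (norm (y - x))\<^sup>2)) *\<^sub>R (y - x)"
      unfolding inversion_def[of x r "inversion x r y"] 1 by simp
    also have "r\<^sup>2 / (r\<^sup>2 / norm (y - x))\<^sup>2 * (r\<^sup>2 / (norm (y - x))\<^sup>2) = 1"
      using n assms(2) by (simp add: power_divide field_simps)
    finally show ?thesis by simp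
  qed
qed

lemma conf_inv_involution:
  assumes "y \<noteq> x" "r > 0"
  shows "conf_inv x r (conf_inv x r f) y = f y"
proof -
  have "norm (y - x) > 0" using assms by simp
  then have 1: "(norm (y - x))\<^sup>2 / r\<^sup>2 * ((r\<^sup>2 / norm (y - x))\<^sup>2 / r\<^sup>2) = 1"
    using assms(2) by (simp add: power_divide field_simps)
  show ?thesis
    unfolding conf_inv_def[of x r "conf_inv x r f"] conf_inv_def[of x r f] inversion_involution[OF assms]
    by (simp only: mult.assoc[symmetric] 1 mult_1)
qed

lemma trace_conj_reflection:
  assumes "a \<noteq> 0"
  shows "trace (reflection a ** M ** reflection a) = trace M"
proof -
  have "trace (reflection a ** M ** reflection a) = trace (reflection a ** (reflection a ** M))"
    by (rule trace_mul_sym)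
  then show ?thesis by (simp add: matrix_mul_assoc reflection_sq[OF assms])
qed

text \<open>A superjet of the transformed function is carried back to one of \<open>f\<close> by a
  second inversion, because the transform is an involution; the matrices are conjugate, so their
  traces agree. This is the invariance of superharmonicity under the Kelvin transform.\<close>

lemma conf_inv_trace_nonneg:
  fixes f :: "real^'n \<Rightarrow> real"
  assumes r: "r > 0" and y: "y \<noteq> x"
    and f: "\<And>p H. superjet f (inversion x r y) p H \<Longrightarrow> 0 \<le> trace (schouten (f (inversion x r y)) p H)"
    and jet: "superjet (conf_inv x r f) y p H"
  shows "0 \<le> trace (schouten (conf_inv x r f y) p H)"
proof -
  define y' where "y' = inversion x r y"
  define a where "a = y' - x"
  have y': "y' \<noteq> x" "inversion x r y' = y" unfolding y'_def using inversion_involution[OF y r] by auto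
  have a: "a \<noteq> 0" "y' = x + a" using y' by (auto simp: a_def)
  have iy: "inversion x r (x + a) = y" using y' a by simp
  let ?g = "conf_inv x r f"
  define c where "c = ?g y / r\<^sup>2 - (p \<bullet> a) / (norm a)\<^sup>2"
  let ?P = "(2 * c) *\<^sub>R a + p"
  let ?H = "(2 * c) *\<^sub>R mat 1 + (r\<^sup>2 / (norm a)\<^sup>2) *\<^sub>R (reflection a ** H ** reflection a)"
  have "superjet ?g (inversion x r (x + a)) p H" using jet iy by simp
  from superjet_inversion[OF a(1) r this]
  have j: "superjet (conf_inv x r ?g) y' ?P ?H" unfolding iy c_def a(2) .
  have "superjet f y' ?P ?H"
  proof (rule superjet_touch[OF j])
    have "\<forall>\<^sub>F h in nhds 0. y' + h \<in> - {x}" using y' by (intro eventually_shift) auto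
    then show "\<forall>\<^sub>F h in nhds 0. f (y' + h) - f y' \<le> conf_inv x r ?g (y' + h) - conf_inv x r ?g y'"
      by eventually_elim (simp add: conf_inv_involution[OF _ r] y'(1))
  qed
  then have "0 \<le> trace (schouten (f y') ?P ?H)" using f by (simp add: y'_def)
  moreover have "f y' = (norm a)\<^sup>2 / r\<^sup>2 * ?g y"
    using conf_inv_involution[OF y'(1) r, of f] unfolding conf_inv_def[of x r ?g] y'(2) a_def by simp
  ultimately show ?thesis
    using schouten_inversion[OF a(1), of r "?g y" p H] r trace_conj_reflection[OF a(1)]
    unfolding c_def by simp
qed

section \<open>Touching at the singular points and comparison\<close>

text \<open>\<open>f_trace\<close> is the superharmonicity of \<open>u\<close> expressed by the jets
  of \<open>f\<close>; \<open>f_diff\<close> is what remains of \<open>u\<close> being continuously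
  differentiable.\<close>

locale punctured_solution = approx_solution U F "- {0}" f v \<beta> A
  for U :: "(real^'n^'n) set" and F f v \<beta> A +
  assumes n_ge_3: "CARD('n) \<ge> 3"
    and f_diff: "\<And>x. x \<noteq> 0 \<Longrightarrow> f differentiable (at x)"
    and f_trace: "\<And>y p H. y \<noteq> 0 \<Longrightarrow> superjet f y p H \<Longrightarrow> 0 \<le> trace (schouten (f y) p H)"
begin

definition regular :: "real^'n \<Rightarrow> real \<Rightarrow> (real^'n) set" where
  "regular x r = {z. z \<noteq> x \<and> inversion x r z \<noteq> 0}"

lemma conf_inv_pos: "r > 0 \<Longrightarrow> z \<in> regular x r \<Longrightarrow> conf_inv x r f z > 0"
  using f_pos by (simp add: conf_inv_def regular_def)

lemma continuous_on_conf_inv: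
  assumes "r > 0" "S \<subseteq> regular x r"
  shows "continuous_on S (conf_inv x r f)"
  unfolding conf_inv_def
  by (intro continuous_intros continuous_on_compose2[OF f_cont]
      continuous_on_subset[OF inversion_continuous_on]) (use assms in \<open>auto simp: regular_def\<close>)

lemma open_regular: "open (regular x r)"
proof -
  have "open ((- {x}) \<inter> inversion x r -` (- {0}))"
    by (rule continuous_open_preimage[OF inversion_continuous_on]) auto
  moreover have "(- {x}) \<inter> inversion x r -` (- {0}) = regular x r" by (auto simp: regular_def)
  ultimately show ?thesis by simp
qed

lemma conf_inv_trace:
  assumes "r > 0" "z \<in> regular x r" "superjet (conf_inv x r f) z p H"
  shows "0 \<le> trace (schouten (conf_inv x r f z) p H)"
  using assms by (intro conf_inv_trace_nonneg f_trace) (auto simp: regular_def)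

text \<open>The gradient term has a favourable sign. The function \<open>g\<close> itself is thus
  subharmonic in the sense required by \<open>punctured_max_principle\<close>, although the Kelvin
  transform of \<open>u\<close>, a negative power of it, is superharmonic.\<close>

lemma conf_inv_trace_hessian:
  assumes "r > 0" "z \<in> regular x r" "superjet (conf_inv x r f) z p H"
  shows "0 \<le> trace H"
proof -
  have "0 \<le> conf_inv x r f z * trace H - CARD('n) * (norm p)\<^sup>2 / 2"
    using conf_inv_trace[OF assms] by (simp add: trace_schouten)
  moreover have "0 \<le> CARD('n) * (norm p)\<^sup>2 / 2" by simp
  ultimately have "0 \<le> conf_inv x r f z * trace H" by linarith
  then show ?thesis using conf_inv_pos[OF assms(1,2)] by (simp add: zero_le_mult_iff)
qed

text \<open>The power \<open>w\<close> is the Kelvin transform of \<open>u\<close>. Being positive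
  and superharmonic on the punctured ball, it is bounded below by its minimum on the sphere, and the
  negative exponent turns this into an upper bound for \<open>g\<close>. The subharmonicity of
  \<open>g\<close> would not do here, as the maximum principle presupposes such a bound.\<close>

lemma conf_inv_locally_bounded:
  assumes r: "r > 0" and d: "d > 0" and reg: "cball P d - {P} \<subseteq> regular x r"
  shows "\<exists>C. \<forall>z\<in>ball P d - {P}. conf_inv x r f z \<le> C"
proof -
  let ?g = "conf_inv x r f"
  define a where "a = - 2 / (real CARD('n) - 2)"
  have a: "a < 0" using n_ge_3 by (simp add: a_def)
  define w where "w z = ?g z powr (1 / a)" for z
  have gw: "w z powr a = ?g z" "w z > 0" if "z \<in> regular x r" for z
    using conf_inv_pos[OF r that] a by (auto simp: w_def powr_powr)
  have sph: "sphere P d \<subseteq> regular x r" using reg d by force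
  have "bounded (?g ` sphere P d)"
    by (intro compact_imp_bounded compact_continuous_image continuous_on_conf_inv r sph) auto
  then obtain C where C: "C > 0" "\<And>z. z \<in> sphere P d \<Longrightarrow> \<bar>?g z\<bar> \<le> C"
    unfolding bounded_pos by auto
  have "?g z \<le> C" if z: "z \<in> ball P d - {P}" for z
  proof -
    have zr: "z \<in> regular x r" using z reg by auto
    have "- w z \<le> - (C powr (1 / a)) + 0 \<bullet> (z - P)"
    proof (rule punctured_max_principle[OF n_ge_3 _ _ _ _ z])
      show "continuous_on (cball P d - {P}) (\<lambda>z. - w z)"
        unfolding w_def using reg conf_inv_pos[OF r]
        by (intro continuous_intros continuous_on_conf_inv r reg) force
      show "- w z \<le> 0" if "z \<in> cball P d - {P}" for z using gw that reg by (force intro: less_imp_le)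
      show "- w z \<le> - (C powr (1 / a)) + 0 \<bullet> (z - P)" if "dist P z = d" for z
      proof -
        have "z \<in> sphere P d" using that by simp
        then have "0 < ?g z" "?g z \<le> C" using C(2)[of z] conf_inv_pos[OF r] sph by auto
        then have "C powr (1 / a) \<le> ?g z powr (1 / a)" using a by (intro powr_mono2') auto
        then show ?thesis by (simp add: w_def)
      qed
      show "0 \<le> trace H" if y: "y \<in> ball P d - {P}" and j: "superjet (\<lambda>z. - w z) y p H" for y p H
      proof -
        have yr: "y \<in> regular x r" using y reg by auto
        have "subjet w y (- p) (- H)" using j by (simp add: subjet_def)
        from superjet_powr[OF this gw(2)[OF yr] a]
        have "superjet ?g y ((a * w y powr (a - 1)) *\<^sub>R - p)
          ((a * w y powr (a - 1)) *\<^sub>R - H + (a * (a - 1) * w y powr (a - 2)) *\<^sub>R outer (- p) (- p))"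
          (is "superjet ?g y ?p ?H")
        proof (rule superjet_touch)
          show "\<forall>\<^sub>F h in nhds 0. ?g (y + h) - ?g y \<le> w (y + h) powr a - w y powr a"
            using eventually_shift[OF open_regular yr] by eventually_elim (simp add: gw yr)
        qed
        from conf_inv_trace[OF r yr this]
        have "0 \<le> trace (schouten (w y powr a) ?p ?H)" by (simp add: gw yr)
        also have "\<dots> = a * w y powr (2 * a - 1) * trace (- H)"
          unfolding a_def by (rule trace_schouten_powr[OF n_ge_3 gw(2)[OF yr]])
        also have "trace (- H) = - trace H" using trace_scaleR[of "-1" H] by simp
        finally have "0 \<le> (- a * w y powr (2 * a - 1)) * trace H" by simp
        moreover have "- a * w y powr (2 * a - 1) > 0"
          using a gw(2)[OF yr] by (simp add: mult_neg_pos)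
        ultimately show ?thesis by (simp only: zero_le_mult_iff) auto
      qed
    qed
    then have "C powr (1 / a) \<le> w z" by simp
    then have "w z powr a \<le> (C powr (1 / a)) powr a" using a C by (intro powr_mono2') auto
    then show ?thesis using gw[OF zr] a C by (simp add: powr_powr)
  qed
  then show ?thesis by blast
qed

text \<open>If \<open>f\<close> touches \<open>t (g + Q)\<close> only at \<open>P\<close>, then the same holds after adding any small linear
  function, so that \<open>f - t (g + Q)\<close> grows linearly; this contradicts the maximum principle since \<open>f\<close> is
  differentiable at \<open>P\<close>.\<close>

lemma no_singular_touching:
  fixes x P b :: "real^'n"
  assumes r: "r > 0" and t: "t > 0" and P: "P \<noteq> 0" and d: "d > 0"
    and reg: "cball P d - {P} \<subseteq> regular x r" "0 \<notin> cball P d"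
    and disc: "\<mu> > 0" "2 * \<mu> * e - (norm b)\<^sup>2 > 0"
    and below: "\<And>z. z \<in> cball P d - {P} \<Longrightarrow> t * (conf_inv x r f z + paraboloid e b \<mu> z) \<le> f z"
    and Y: "\<And>k. Y k \<in> cball P d - {P}" "Y \<longlonglongrightarrow> P"
      "(\<lambda>k. f (Y k) - t * (conf_inv x r f (Y k) + paraboloid e b \<mu> (Y k))) \<longlonglongrightarrow> 0"
  shows False
proof -
  let ?g = "conf_inv x r f"
  obtain \<nu> where \<nu>: "\<nu> > 0" "\<mu> - \<nu> > 0"
    "2 * (\<mu> - \<nu>) * (e - \<nu> / 2 * (norm P)\<^sup>2) - (norm (b + \<nu> *\<^sub>R P))\<^sup>2 > 0"
    using discriminant_perturb[OF disc, of P] by blast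
  define e' b' \<mu>' where "e' = e - \<nu> / 2 * (norm P)\<^sup>2" and "b' = b + \<nu> *\<^sub>R P" and "\<mu>' = \<mu> - \<nu>"
  have \<mu>': "\<mu>' > 0" "2 * \<mu>' * e' - (norm b')\<^sup>2 > 0" using \<nu> by (auto simp: \<mu>'_def e'_def b'_def)
  let ?Q = "paraboloid e' b' \<mu>'"
  have Q: "?Q z = paraboloid e b \<mu> z - \<nu> / 2 * (norm (z - P))\<^sup>2" for z
    unfolding paraboloid_diff e'_def b'_def \<mu>'_def ..
  define \<phi> where "\<phi> z = f z - t * (?g z + ?Q z)" for z
  have \<phi>: "t * \<nu> / 2 * (norm (z - P))\<^sup>2 \<le> \<phi> z" if "z \<in> cball P d - {P}" for z
    using below[OF that] by (simp add: \<phi>_def Q algebra_simps)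
  define N where "N = cball P d - {P}"
  have \<phi>_cont: "continuous_on N \<phi>"
    unfolding \<phi>_def using reg
    by (intro continuous_intros continuous_on_conf_inv r continuous_on_subset[OF f_cont]
        continuous_on_paraboloid) (auto simp: N_def)
  \<comment> \<open>Tilting the paraboloid by a slope \<open>s\<close> about \<open>P\<close> and
    shifting it by \<open>m\<close> keeps the discriminant condition as long as both are
    small.\<close>
  obtain \<eta> where \<eta>: "\<eta> > 0" "\<And>s m. norm s + \<bar>m\<bar> < \<eta> \<Longrightarrow>
      2 * \<mu>' * (e' - s \<bullet> P + m) - (norm (b' + s))\<^sup>2 > 0"
  proof -
    have "((\<lambda>q. 2 * \<mu>' * (e' - fst q \<bullet> P + snd q) - (norm (b' + fst q))\<^sup>2) \<longlongrightarrow>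
       2 * \<mu>' * (e' - fst (0::(real^'n) \<times> real) \<bullet> P + snd (0::(real^'n) \<times> real)) - (norm (b' + fst (0::(real^'n) \<times> real)))\<^sup>2) (nhds 0)"
      by (intro tendsto_intros filterlim_ident)
    then have "\<forall>\<^sub>F q in nhds (0::(real^'n) \<times> real). 2 * \<mu>' * (e' - fst q \<bullet> P + snd q) - (norm (b' + fst q))\<^sup>2 > 0"
      by (rule order_tendstoD(1)) (use \<mu>' in simp)
    then obtain \<eta> where \<eta>: "\<eta> > 0" "\<And>q. norm q < \<eta> \<Longrightarrow>
        2 * \<mu>' * (e' - fst q \<bullet> P + snd q) - (norm (b' + fst q))\<^sup>2 > 0"
      unfolding eventually_nhds_metric by (auto simp: dist_norm)
    show thesis
    proof (rule that[OF \<eta>(1)])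
      fix s :: "real^'n" and m :: real assume "norm s + \<bar>m\<bar> < \<eta>"
      then have "norm (s, m) < \<eta>" using norm_Pair_le[of s m] by simp
      from \<eta>(2)[OF this] show "2 * \<mu>' * (e' - s \<bullet> P + m) - (norm (b' + s))\<^sup>2 > 0" by simp
    qed
  qed
  define d1 where "d1 = 1 + d"
  have d1: "d1 > 0" using d by (simp add: d1_def)
  \<comment> \<open>The first bound gives \<open>\<sigma> + \<sigma> * d < \<eta>\<close>, room for
    a slope of size \<open>\<sigma>\<close> and a shift of size \<open>\<sigma> * d\<close>. The
    second makes the slope weaker than the quadratic gain at distance \<open>d\<close> from
    \<open>P\<close>, so no contact occurs on that sphere.\<close>
  define \<sigma> where "\<sigma> = min (\<eta> / (2 * d1)) (\<nu> * d / 4)"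
  have \<sigma>: "\<sigma> > 0" "\<sigma> < \<nu> * d / 2" 
  proof -
    show "\<sigma> > 0" using \<eta> d d1 \<nu> by (auto simp: \<sigma>_def)
    have "\<sigma> \<le> \<nu> * d / 4" unfolding \<sigma>_def by (rule min.cobounded2)
    moreover have "\<nu> * d > 0" using \<nu> d by simp
    ultimately show "\<sigma> < \<nu> * d / 2" by linarith
  qed
  have \<sigma>\<eta>: "\<sigma> + \<sigma> * d < \<eta>"
  proof -
    have "\<sigma> * d1 \<le> \<eta> / (2 * d1) * d1"
      using d1 by (intro mult_right_mono) (auto simp: \<sigma>_def)
    also have "\<dots> = \<eta> / 2" using d1 by simp
    finally show ?thesis using \<eta> by (simp add: d1_def distrib_left)
  qed
  \<comment> \<open>If the tilted function were not below, then \<open>\<zeta>\<close> would have a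
    negative minimum at an interior point other than \<open>P\<close>. There \<open>f\<close> would
    touch a tilted and shifted competitor, which \<open>no_regular_touching\<close>
    excludes.\<close>
  have slope: "t * (s \<bullet> (z - P)) \<le> \<phi> z" if s: "norm s \<le> \<sigma>" and z: "z \<in> N" for s z
  proof (rule ccontr)
    assume not: "\<not> t * (s \<bullet> (z - P)) \<le> \<phi> z"
    define \<zeta> where "\<zeta> w = \<phi> w - t * (s \<bullet> (w - P))" for w
    have \<zeta>z: "\<zeta> z < 0" using not by (simp add: \<zeta>_def)
    have lower: "- (t * \<sigma> * norm (w - P)) \<le> \<zeta> w" if "w \<in> N" for w
    proof -
      have "s \<bullet> (w - P) \<le> norm s * norm (w - P)" by (rule norm_cauchy_schwarz)
      also have "\<dots> \<le> \<sigma> * norm (w - P)" using s by (intro mult_right_mono) auto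
      finally have "t * (s \<bullet> (w - P)) \<le> t * (\<sigma> * norm (w - P))" using t by (intro mult_left_mono) auto
      moreover have "0 \<le> t * \<nu> / 2 * (norm (w - P))\<^sup>2" using t \<nu> by simp
      then have "0 \<le> \<phi> w" using \<phi> that unfolding N_def by (meson order_trans)
      ultimately show ?thesis by (simp add: \<zeta>_def)
    qed
    \<comment> \<open>Within this distance of \<open>P\<close> the lower bound
      \<open>- (t * \<sigma> * norm (w - P))\<close> already exceeds \<open>\<zeta> z\<close>, so
      the minimum over a compact set avoiding \<open>P\<close> is a minimum over all of
      \<open>N\<close>.\<close>
    define \<rho> where "\<rho> = - \<zeta> z / (t * \<sigma>)"
    have \<rho>: "\<rho> > 0" using \<zeta>z t \<sigma> by (simp add: \<rho>_def divide_neg_pos)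
    have near: "\<zeta> z < \<zeta> w" if "w \<in> N" "norm (w - P) < \<rho>" for w
    proof -
      have "t * \<sigma> * norm (w - P) < t * \<sigma> * \<rho>" using that t \<sigma> by (intro mult_strict_left_mono) auto
      also have "\<dots> = - \<zeta> z" using t \<sigma> by (simp add: \<rho>_def)
      finally show ?thesis using lower[OF that(1)] by linarith
    qed
    define K where "K = cball P d - ball P \<rho>"
    have KN: "K \<subseteq> N" using \<rho> by (auto simp: K_def N_def)
    have zK: "z \<in> K" using near[OF z] z by (force simp: K_def N_def dist_norm norm_minus_commute)
    have "compact K" unfolding K_def by (intro compact_diff) auto
    moreover have "continuous_on K \<zeta>"
      unfolding \<zeta>_def by (intro continuous_intros continuous_on_subset[OF \<phi>_cont KN])
    ultimately obtain y where y: "y \<in> K" "\<And>w. w \<in> K \<Longrightarrow> \<zeta> y \<le> \<zeta> w"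
      using continuous_attains_inf[of K \<zeta>] zK by blast
    have yN: "y \<in> N" using y KN by blast
    have ymin: "\<zeta> y \<le> \<zeta> w" if "w \<in> N" for w
    proof (cases "w \<in> K")
      case False
      then have "norm (w - P) < \<rho>" using that by (auto simp: K_def N_def dist_norm norm_minus_commute)
      then show ?thesis using near[OF that] y(2)[OF zK] by simp
    qed (rule y(2))
    have yneg: "\<zeta> y < 0" using ymin[OF z] \<zeta>z by simp
    have yd: "norm (y - P) < d"
    proof (rule ccontr)
      assume "\<not> norm (y - P) < d"
      then have nd: "norm (y - P) = d" using yN by (auto simp: N_def dist_norm norm_minus_commute)
      have "t * (s \<bullet> (y - P)) \<le> t * (\<sigma> * d)"
        using order_trans[OF norm_cauchy_schwarz[of s "y - P", unfolded nd]
            mult_right_mono[OF s less_imp_le[OF d]]] t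
        by (intro mult_left_mono) auto
      also have "\<dots> \<le> t * ((\<nu> * d / 2) * d)"
        using \<sigma> d t by (intro mult_left_mono mult_right_mono) auto
      also have "\<dots> = t * \<nu> / 2 * (norm (y - P))\<^sup>2" unfolding nd by (simp add: power2_eq_square)
      also have "\<dots> \<le> \<phi> y" using \<phi> yN unfolding N_def by blast
      finally show False using yneg by (simp add: \<zeta>_def)
    qed
    define m where "m = \<zeta> y / t"
    have m: "\<bar>m\<bar> \<le> \<sigma> * d"
    proof -
      have "- (t * \<sigma> * d) \<le> - (t * \<sigma> * norm (y - P))" using yd t \<sigma> by simp
      then have "- (t * \<sigma> * d) \<le> \<zeta> y" using lower[OF yN] by linarith
      then have "- \<zeta> y / t \<le> \<sigma> * d" using t by (simp add: field_simps)
      moreover have "\<bar>m\<bar> = - \<zeta> y / t" using yneg t by (simp add: m_def divide_neg_pos abs_of_neg)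
      ultimately show ?thesis by simp
    qed
    have Q': "paraboloid (e' - s \<bullet> P + m) (b' + s) \<mu>' w = ?Q w + s \<bullet> (w - P) + m" for w
      by (simp add: paraboloid_def inner_add_left inner_diff_right)
    have tm: "t * m = \<zeta> y" using t by (simp add: m_def)
    show False
    proof (rule no_regular_touching[OF r t, of y x \<mu>' "e' - s \<bullet> P + m" "b' + s"])
      show "y \<in> - {0}" "y \<noteq> x" "inversion x r y \<in> - {0}"
        using yN reg by (auto simp: N_def regular_def)
      show "2 * \<mu>' * (e' - s \<bullet> P + m) - (norm (b' + s))\<^sup>2 > 0"
        using s m \<sigma>\<eta> by (intro \<eta>) linarith
      show "f y = t * (?g y + paraboloid (e' - s \<bullet> P + m) (b' + s) \<mu>' y)"
        unfolding Q' using tm by (simp add: \<zeta>_def \<phi>_def algebra_simps)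
      have "\<forall>\<^sub>F w in nhds y. w \<in> ball P d - {P}"
        using yN yd by (intro eventually_nhds_in_open) (auto simp: N_def dist_norm norm_minus_commute)
      then show "\<forall>\<^sub>F w in nhds y. t * (?g w + paraboloid (e' - s \<bullet> P + m) (b' + s) \<mu>' w) \<le> f w"
      proof eventually_elim
        case (elim w)
        then have "\<zeta> y \<le> \<zeta> w" by (intro ymin) (auto simp: N_def)
        then show ?case unfolding Q' using tm by (simp add: \<zeta>_def \<phi>_def algebra_simps)
      qed
    qed (rule \<mu>')
  qed
  have cone: "t * (\<sigma> * norm (z - P)) \<le> \<phi> z" if "z \<in> N" for z
  proof -
    have nz: "norm (z - P) > 0" using that by (simp add: N_def)
    have "t * (((\<sigma> / norm (z - P)) *\<^sub>R (z - P)) \<bullet> (z - P)) \<le> \<phi> z"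
      using \<sigma> nz by (intro slope that) simp
    moreover have "((\<sigma> / norm (z - P)) *\<^sub>R (z - P)) \<bullet> (z - P) = \<sigma> * norm (z - P)"
      using nz by (simp add: power2_norm_eq_inner[symmetric] power2_eq_square)
    ultimately show ?thesis by (simp only:)
  qed
  obtain f' where f': "(f has_derivative f') (at P)"
    using f_diff[OF P] by (auto simp: differentiable_def)
  have f'_eq: "f' h = gradient f P \<bullet> h" for h
    using has_derivative_unique[OF f' frechet_gradient[OF f_diff[OF P]]] by simp
  have "t * \<sigma> / 2 > 0" using t \<sigma> by simp
  then obtain \<rho>0 where \<rho>0: "\<rho>0 > 0" "\<And>z. norm (z - P) < \<rho>0 \<Longrightarrow>
      norm (f z - f P - f' (z - P)) \<le> t * \<sigma> / 2 * norm (z - P)"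
    using f' unfolding has_derivative_at_alt by blast
  define \<rho> where "\<rho> = min (\<rho>0 / 2) d"
  have \<rho>: "\<rho> > 0" "\<rho> < \<rho>0" "\<rho> \<le> d" using \<rho>0 d by (auto simp: \<rho>_def)
  define G where "G = b' + \<mu>' *\<^sub>R P"
  define c where "c = f P / t - ?Q P"
  define a where "a = (1 / t) *\<^sub>R gradient f P - G"
  \<comment> \<open>\<open>f\<close> is at most its tangent plane plus half the slope
    \<open>t * \<sigma>\<close>, and \<open>?Q\<close> lies above its tangent plane; subtracting the
    full slope from \<open>cone\<close> leaves \<open>g\<close> below an affine function by a
    definite cone.\<close>
  have upper: "?g z \<le> c + a \<bullet> (z - P) - \<sigma> / 2 * norm (z - P)" if "z \<in> cball P \<rho> - {P}" for z
  proof -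
    have nz: "norm (z - P) < \<rho>0" using that \<rho> by (auto simp: dist_norm norm_minus_commute)
    have zN: "z \<in> N" using that \<rho> by (auto simp: N_def)
    have "f z \<le> f P + gradient f P \<bullet> (z - P) + t * \<sigma> / 2 * norm (z - P)"
      using \<rho>0(2)[OF nz] unfolding f'_eq real_norm_def by linarith
    moreover have "?Q P + G \<bullet> (z - P) \<le> ?Q z"
      using paraboloid_expansion[of e' b' \<mu>' P "z - P"] \<mu>'(1)
      by (simp add: G_def mat_mult_simps)
    then have "t * (?Q P + G \<bullet> (z - P)) \<le> t * ?Q z" using t by (intro mult_left_mono) auto
    ultimately have "t * ?g z \<le> f P + gradient f P \<bullet> (z - P) + t * \<sigma> / 2 * norm (z - P)
        - t * (?Q P + G \<bullet> (z - P)) - t * (\<sigma> * norm (z - P))"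
      using cone[OF zN] unfolding \<phi>_def distrib_left[of t "?g z"] by linarith
    also have "\<dots> = t * (c + a \<bullet> (z - P) - \<sigma> / 2 * norm (z - P))"
      using t by (simp add: c_def a_def inner_diff_left algebra_simps)
    finally show ?thesis using t by simp
  qed
  have reg\<rho>: "cball P \<rho> - {P} \<subseteq> regular x r"
    using reg(1) subset_cball[OF \<rho>(3), of P] by blast
  have half: "cball P (\<rho>/2) \<subseteq> cball P \<rho>" using \<rho> by (intro subset_cball) simp
  obtain C where C: "\<And>z. z \<in> ball P d - {P} \<Longrightarrow> ?g z \<le> C"
    using conf_inv_locally_bounded[OF r d reg(1)] by blast
  \<comment> \<open>The gap on the sphere of radius \<open>\<rho> / 2\<close> is carried to all
    interior points, whereas along \<open>Y\<close> the values of \<open>g\<close> tend to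
    \<open>c\<close>, the value of the affine function at \<open>P\<close> without the gap.\<close>
  have inside: "?g z \<le> (c - \<sigma> / 2 * (\<rho>/2)) + a \<bullet> (z - P)" if z: "z \<in> ball P (\<rho>/2) - {P}" for z
  proof (rule punctured_max_principle[OF n_ge_3 _ _ _ _ z])
    show "continuous_on (cball P (\<rho>/2) - {P}) ?g"
      using reg\<rho> half by (intro continuous_on_conf_inv r) blast
    show "?g z \<le> C" if "z \<in> cball P (\<rho>/2) - {P}" for z using that \<rho> by (intro C) auto
    show "0 \<le> trace H" if "z \<in> ball P (\<rho>/2) - {P}" "superjet ?g z p H" for z p H
    proof (rule conf_inv_trace_hessian[OF r _ that(2)])
      have "z \<in> cball P (\<rho>/2) - {P}" using that(1) by auto
      then show "z \<in> regular x r" using reg\<rho> half by blast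
    qed
    show "?g z \<le> (c - \<sigma> / 2 * (\<rho>/2)) + a \<bullet> (z - P)" if "dist P z = \<rho>/2" for z
      using upper[of z] that \<rho> by (auto simp: dist_norm norm_minus_commute)
  qed
  have fY: "(\<lambda>k. f (Y k)) \<longlonglongrightarrow> f P"
  proof (rule continuous_on_tendsto_compose[OF f_cont Y(2)])
    have "Y k \<noteq> 0" for k using Y(1)[of k] reg(2) by (cases "Y k = 0") auto
    then show "\<forall>\<^sub>F k in sequentially. Y k \<in> - {0}" by simp
  qed (use P in simp)
  have QP: "?Q P = paraboloid e b \<mu> P" unfolding Q by simp
  have "(\<lambda>k. (f (Y k) - (f (Y k) - t * (?g (Y k) + paraboloid e b \<mu> (Y k)))) / t - paraboloid e b \<mu> (Y k))
      \<longlonglongrightarrow> (f P - 0) / t - paraboloid e b \<mu> P"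
    using t by (intro tendsto_intros fY Y tendsto_paraboloid) auto
  then have gY: "(\<lambda>k. ?g (Y k)) \<longlonglongrightarrow> c" using t by (simp add: c_def QP)
  have "(\<lambda>k. (c - \<sigma> / 2 * (\<rho>/2)) + a \<bullet> (Y k - P)) \<longlonglongrightarrow> (c - \<sigma> / 2 * (\<rho>/2)) + a \<bullet> (P - P)"
    by (intro tendsto_intros Y)
  moreover have "\<forall>\<^sub>F k in sequentially. ?g (Y k) \<le> (c - \<sigma> / 2 * (\<rho>/2)) + a \<bullet> (Y k - P)"
  proof -
    have "\<rho> / 2 > 0" using \<rho> by simp
    from tendstoD[OF Y(2) this] show ?thesis
      by eventually_elim (use inside Y(1) in \<open>auto simp: dist_commute\<close>)
  qed
  ultimately have "c \<le> (c - \<sigma> / 2 * (\<rho>/2)) + a \<bullet> (P - P)"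
    by (intro tendsto_le[OF _ _ gY]) auto
  then show False using \<sigma> \<rho> by (simp add: mult_le_0_iff)
qed

section \<open>Comparison in the ball\<close>

text \<open>Let \<open>t\<close> be the infimum of \<open>f / (g + Q)\<close> over the ball without
  its two singular points. A minimising sequence accumulates at an interior regular point, at a
  singular point or on the sphere; the first two cases fall under the two contact lemmas, the last
  is excluded by the size of \<open>Q\<close>.\<close>

lemma conf_inv_le:
  assumes r: "r > 0" "r < norm x" and w1: "w1 \<in> cball x r" "w1 \<in> regular x r"
  shows "conf_inv x r f w1 \<le> f w1"
proof (rule ccontr)
  let ?g = "conf_inv x r f"
  assume "\<not> ?g w1 \<le> f w1"
  then have gf: "f w1 < ?g w1" by simp
  define P where "P = inversion x r 0"
  have x0: "x \<noteq> 0" using r by auto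
  have P: "P \<noteq> x" "inversion x r P = 0" "dist x P < r"
  proof -
    show "P \<noteq> x" "inversion x r P = 0"
      unfolding P_def using inversion_involution[of 0 x r] x0 r by auto
    have "norm (P - x) = r\<^sup>2 / norm x"
      unfolding P_def using inversion_involution(3)[of 0 x r] x0 r by simp
    also have "\<dots> < r" using r by (simp add: power2_eq_square divide_less_eq)
    finally show "dist x P < r" by (simp add: dist_norm norm_minus_commute)
  qed
  have regular: "z \<in> regular x r \<longleftrightarrow> z \<noteq> x \<and> z \<noteq> P" for z
    using inversion_involution[of z x r] P r by (auto simp: regular_def P_def)
  have nz: "z \<noteq> 0" if "z \<in> cball x r" for z using that r by auto
  define B where "B = cball x r - {x, P}"
  have B: "z \<in> B \<longleftrightarrow> z \<in> cball x r \<and> z \<in> regular x r" for z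
    by (auto simp: B_def regular)
  have ball_sub: "\<exists>d>0. cball p d - {p} \<subseteq> B" if p: "p = x \<or> p = P" for p
  proof -
    obtain d0 where d0: "d0 > 0" "\<And>q. q \<in> {x, P} \<Longrightarrow> q \<noteq> p \<Longrightarrow> d0 \<le> dist p q"
      using finite_set_avoid[of "{x, P}" p] by blast
    define d where "d = min (d0 / 2) (r - dist x p)"
    have "d > 0" using d0 p P r by (auto simp: d_def)
    moreover have "z \<in> B" if z: "z \<in> cball p d - {p}" for z
    proof -
      have "dist p z \<le> d" "z \<noteq> p" using z by auto
      then have "dist x z \<le> r" using dist_triangle[of x z p] by (simp add: d_def)
      moreover have "z \<noteq> q" if q: "q \<in> {x, P}" for q
        using \<open>dist p z \<le> d\<close> \<open>z \<noteq> p\<close> d0(2)[OF q] d0(1) by (auto simp: d_def)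
      ultimately show ?thesis by (auto simp: B_def)
    qed
    ultimately show ?thesis by blast
  qed
  have g_cont: "continuous_on S ?g" if "S \<subseteq> B" for S
    using that B by (intro continuous_on_conf_inv r) auto
  have fB_cont: "continuous_on (cball x r) f" using nz by (intro continuous_on_subset[OF f_cont]) blast
  obtain C where C: "\<And>z. z \<in> B \<Longrightarrow> ?g z \<le> C"
  proof -
    obtain d1 where d1: "d1 > 0" "cball x d1 - {x} \<subseteq> B" using ball_sub by blast
    obtain d2 where d2: "d2 > 0" "cball P d2 - {P} \<subseteq> B" using ball_sub by blast
    obtain C1 where C1: "\<And>z. z \<in> ball x d1 - {x} \<Longrightarrow> ?g z \<le> C1"
      using conf_inv_locally_bounded[OF r(1) d1(1)] d1(2) B by blast
    obtain C2 where C2: "\<And>z. z \<in> ball P d2 - {P} \<Longrightarrow> ?g z \<le> C2"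
      using conf_inv_locally_bounded[OF r(1) d2(1)] d2(2) B by blast
    define K where "K = cball x r - ball x d1 - ball P d2"
    have "compact K" unfolding K_def by (intro compact_diff) auto
    moreover have "K \<subseteq> B" using d1 d2 by (auto simp: K_def B_def)
    ultimately have "bounded (?g ` K)"
      by (intro compact_imp_bounded compact_continuous_image g_cont)
    then obtain C3 where C3: "\<And>z. z \<in> K \<Longrightarrow> \<bar>?g z\<bar> \<le> C3" unfolding bounded_iff by auto
    show thesis
    proof (rule that[of "max C1 (max C2 C3)"])
      fix z assume z: "z \<in> B"
      then consider "z \<in> ball x d1 - {x}" | "z \<in> ball P d2 - {P}" | "z \<in> K"
        by (auto simp: B_def K_def)
      then show "?g z \<le> max C1 (max C2 C3)"
        using C1 C2 C3 by cases (auto simp: le_max_iff_disj abs_le_iff)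
    qed
  qed
  obtain y0 where y0: "y0 \<in> cball x r" "\<And>z. z \<in> cball x r \<Longrightarrow> f y0 \<le> f z"
    using continuous_attains_inf[OF compact_cball _ fB_cont] r by auto
  define fm where "fm = f y0"
  have fm: "fm > 0" "\<And>z. z \<in> cball x r \<Longrightarrow> fm \<le> f z"
    using y0 f_pos[of y0] nz by (auto simp: fm_def)
  have w1B: "w1 \<in> B" using w1 B by simp
  have g_pos: "z \<in> B \<Longrightarrow> ?g z > 0" for z using conf_inv_pos[OF r(1)] B by blast
  \<comment> \<open>Below one because the claim is assumed to fail at \<open>w1\<close>. As
    \<open>Q\<close> is positive, the infimum \<open>t\<close> will be below \<open>\<tau>\<close>
    for every choice of \<open>Q\<close>.\<close>
  define \<tau> where "\<tau> = f w1 / ?g w1"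
  have \<tau>: "0 < \<tau>" "\<tau> < 1" using gf f_pos[of w1] nz[OF w1(1)] by (auto simp: \<tau>_def divide_simps)
  define M where "M = 1 + (norm x + r)\<^sup>2 / 2"
  have M: "M > 0" by (simp add: M_def add_pos_nonneg)
  \<comment> \<open>\<open>M\<close> bounds \<open>1 + (norm z)\<^sup>2 / 2\<close> on the ball, so
    \<open>Q\<close> is at most \<open>(1 - \<tau>) * fm / 2\<close> there: too little for
    \<open>f = t (f + Q)\<close> at a point of the sphere, where \<open>g = f\<close>.\<close>
  define \<kappa> where "\<kappa> = (1 - \<tau>) * fm / (2 * M)"
  have \<kappa>: "\<kappa> > 0" using \<tau> fm M by (simp add: \<kappa>_def)
  let ?Q = "paraboloid \<kappa> 0 \<kappa> :: real^'n \<Rightarrow> real"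
  have Q: "0 < ?Q z" "?Q z \<le> \<kappa> * M" if "z \<in> cball x r" for z
  proof -
    show "0 < ?Q z" using \<kappa> by (simp add: paraboloid_def add_pos_nonneg)
    have "norm z \<le> norm x + r"
      using that norm_triangle_ineq[of x "z - x"] by (simp add: dist_norm norm_minus_commute)
    then have "(norm z)\<^sup>2 \<le> (norm x + r)\<^sup>2" by (intro power_mono) auto
    then have "\<kappa> * (1 + (norm z)\<^sup>2 / 2) \<le> \<kappa> * M" unfolding M_def using \<kappa> by (intro mult_left_mono) auto
    then show "?Q z \<le> \<kappa> * M" by (simp add: paraboloid_def distrib_left)
  qed
  define R where "R z = f z / (?g z + ?Q z)" for z
  have den: "?g z + ?Q z > 0" if "z \<in> B" for z
    using g_pos[OF that] Q(1)[of z] that B by (simp add: add_pos_pos)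
  have R_pos: "R z > 0" if "z \<in> B" for z
    using den[OF that] f_pos[of z] nz[of z] that B by (simp add: R_def)
  define t where "t = Inf (R ` B)"
  have bdd: "bdd_below (R ` B)" by (rule bdd_belowI[of _ 0]) (auto intro: less_imp_le R_pos)
  have tR: "t \<le> R z" if "z \<in> B" for z unfolding t_def using that by (intro cInf_lower bdd) auto
  have "R w1 < \<tau>"
    unfolding R_def \<tau>_def using g_pos[OF w1B] Q(1)[OF w1(1)] f_pos[of w1] nz[OF w1(1)]
    by (intro divide_strict_left_mono) (auto intro: add_pos_pos)
  then have t\<tau>: "t < \<tau>" using tR[OF w1B] by simp
  \<comment> \<open>A bound for \<open>g + Q\<close>. It makes \<open>t\<close> positive, and it
    turns convergence of the quotients to \<open>t\<close> into convergence of
    \<open>f - t (g + Q)\<close> to zero along the minimising sequence.\<close>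
  define C' where "C' = max C 1 + \<kappa> * M"
  have C': "C' > 0" using \<kappa> M by (simp add: C'_def add_pos_pos)
  have denC: "?g z + ?Q z \<le> C'" if "z \<in> B" for z
    using C[OF that] Q(2)[of z] that B by (simp add: C'_def)
  have t: "t > 0"
  proof -
    have "fm / C' \<le> R z" if "z \<in> B" for z
      unfolding R_def using fm den[OF that] denC[OF that] f_pos[of z] nz[of z] that B
      by (intro frac_le) auto
    then have "fm / C' \<le> t" unfolding t_def using w1B by (intro cInf_greatest) auto
    then show ?thesis using fm C' by (meson divide_pos_pos less_le_trans)
  qed
  have below: "t * (?g z + ?Q z) \<le> f z" if "z \<in> B" for z
    using tR[OF that] den[OF that] by (simp add: R_def pos_le_divide_eq)
  have "\<exists>z\<in>B. R z < t + 1 / real (Suc k)" for k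
  proof -
    have "Inf (R ` B) < t + 1 / real (Suc k)" by (simp add: t_def)
    then show ?thesis using cInf_less_iff[OF _ bdd] w1B by auto
  qed
  then obtain W where W: "\<And>k. W k \<in> B" "\<And>k. R (W k) < t + 1 / real (Suc k)" by metis
  obtain y s where s: "y \<in> cball x r" "strict_mono s" "(W \<circ> s) \<longlonglongrightarrow> y"
  proof -
    have "\<forall>k. W k \<in> cball x r" using W(1) B by blast
    then show thesis using that compact_cball[of x r] unfolding compact_def by blast
  qed
  define Y where "Y k = W (s k)" for k
  have Y: "Y \<longlonglongrightarrow> y" "\<And>k. Y k \<in> B" using s W by (auto simp: Y_def[abs_def] o_def)
  define z where "z w = f w - t * (?g w + ?Q w)" for w
  have "(\<lambda>k. z (W k)) \<longlonglongrightarrow> 0"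
  proof (rule tendsto_sandwich[where f = "\<lambda>_. 0" and h = "\<lambda>k. C' * (1 / real (Suc k))"])
    show "\<forall>\<^sub>F k in sequentially. 0 \<le> z (W k)" using below[OF W(1)] by (simp add: z_def)
    show "\<forall>\<^sub>F k in sequentially. z (W k) \<le> C' * (1 / real (Suc k))"
    proof (rule always_eventually, rule allI)
      fix k
      have "z (W k) = (?g (W k) + ?Q (W k)) * (R (W k) - t)"
        using den[OF W(1)[of k]] by (simp add: z_def R_def right_diff_distrib)
      also have "\<dots> \<le> C' * (1 / real (Suc k))"
        using den[OF W(1)[of k]] denC[OF W(1)[of k]] W(2)[of k] tR[OF W(1)[of k]] C'
        by (intro mult_mono) auto
      finally show "z (W k) \<le> C' * (1 / real (Suc k))" .
    qed
    have "(\<lambda>k. C' * (1 / real (Suc k))) \<longlonglongrightarrow> C' * 0"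
      by (intro tendsto_intros LIMSEQ_Suc[OF lim_1_over_n])
    then show "(\<lambda>k. C' * (1 / real (Suc k))) \<longlonglongrightarrow> 0" by simp
  qed simp
  then have zY: "(\<lambda>k. z (Y k)) \<longlonglongrightarrow> 0"
    unfolding Y_def using LIMSEQ_subseq_LIMSEQ[OF _ s(2)] by (simp add: o_def)
  have disc: "2 * \<kappa> * \<kappa> - (norm (0::real^'n))\<^sup>2 > 0" using \<kappa> by simp
  show False
  proof (cases "y \<in> B")
    case False
    then have y: "y = x \<or> y = P" using s(1) by (auto simp: B_def)
    obtain d where d: "d > 0" "cball y d - {y} \<subseteq> B" using ball_sub[OF y] by blast
    have "\<forall>\<^sub>F k in sequentially. Y k \<in> cball y d"
      using tendstoD[OF Y(1) d(1)] by eventually_elim (simp add: dist_commute)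
    then obtain N where N: "\<And>k. k \<ge> N \<Longrightarrow> Y k \<in> cball y d"
      unfolding eventually_sequentially by blast
    show False
    proof (rule no_singular_touching[OF r(1) t _ d(1) _ _ \<kappa> disc])
      show "y \<noteq> 0" using nz s by blast
      show "cball y d - {y} \<subseteq> regular x r" using d B by blast
      show "0 \<notin> cball y d"
      proof
        assume "0 \<in> cball y d"
        then have "0 \<in> B" using d(2) \<open>y \<noteq> 0\<close> by blast
        then show False using nz B by blast
      qed
      show "t * (?g w + ?Q w) \<le> f w" if "w \<in> cball y d - {y}" for w using below d that by blast
      show "Y (k + N) \<in> cball y d - {y}" for k
        using N[of "k + N"] Y(2)[of "k + N"] False by auto
      show "(\<lambda>k. Y (k + N)) \<longlonglongrightarrow> y" by (rule LIMSEQ_ignore_initial_segment[OF Y(1)])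
      show "(\<lambda>k. f (Y (k + N)) - t * (?g (Y (k + N)) + ?Q (Y (k + N)))) \<longlonglongrightarrow> 0"
        using LIMSEQ_ignore_initial_segment[OF zY, of N] by (simp add: z_def)
    qed
  next
    case True
    have "continuous_on B z"
      unfolding z_def
      by (intro continuous_intros g_cont continuous_on_paraboloid continuous_on_subset[OF fB_cont])
         (auto simp: B_def)
    then have "(\<lambda>k. z (Y k)) \<longlonglongrightarrow> z y"
      using Y True by (intro continuous_on_tendsto_compose[of B z]) auto
    then have zy: "z y = 0" using zY LIMSEQ_unique by blast
    have "dist x y \<noteq> r"
    proof
      assume dy: "dist x y = r"
      then have n: "norm (y - x) = r" by (simp add: dist_norm norm_minus_commute)
      have "?g y = f y" using n r by (simp add: conf_inv_def inversion_def)
      then have "f y = t * (f y + ?Q y)" using zy by (simp add: z_def)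
      also have "\<dots> \<le> \<tau> * (f y + ?Q y)"
        using t\<tau> Q(1)[OF s(1)] fm(2)[OF s(1)] fm(1) by (intro mult_right_mono) auto
      also have "\<dots> \<le> \<tau> * f y + 1 * (\<kappa> * M)"
        unfolding distrib_left using \<tau> Q[OF s(1)] \<kappa> M by (intro add_left_mono mult_mono) auto
      finally have "(1 - \<tau>) * f y \<le> \<kappa> * M" by (simp add: left_diff_distrib)
      moreover have "(1 - \<tau>) * fm \<le> (1 - \<tau>) * f y" using fm(2)[OF s(1)] \<tau> by (intro mult_left_mono) auto
      moreover have "\<kappa> * M = (1 - \<tau>) * fm / 2" using M by (simp add: \<kappa>_def)
      moreover have "(1 - \<tau>) * fm > 0" using \<tau> fm by simp
      ultimately show False by linarith
    qed
    then have yr: "dist x y < r" using s(1) by simp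
    have yreg: "y \<in> regular x r" using True B by blast
    show False
    proof (rule no_regular_touching[OF r(1) t _ _ _ \<kappa> disc])
      show "y \<in> - {0}" "y \<noteq> x" "inversion x r y \<in> - {0}"
        using nz[OF s(1)] yreg by (auto simp: regular_def)
      show "f y = t * (?g y + ?Q y)" using zy by (simp add: z_def)
      have "\<forall>\<^sub>F w in nhds y. w \<in> ball x r - {x, P}"
        using yr yreg by (intro eventually_nhds_in_open) (auto simp: regular)
      then show "\<forall>\<^sub>F w in nhds y. t * (?g w + ?Q w) \<le> f w"
        by eventually_elim (rule below, auto simp: B_def)
    qed
  qed
qed

end

section \<open>Jets of distributional superharmonic functions\<close>

text \<open>With \<open>s = 1 / t\<close>, differentiating \<open>p(s) exp (- s)\<close> in
  \<open>t\<close> yields \<open>s^2 (p(s) - p'(s)) exp (- s)\<close>.\<close>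

primrec bump_poly :: "nat \<Rightarrow> real poly" where
  "bump_poly 0 = 1"
| "bump_poly (Suc j) = [:0, 0, 1:] * (bump_poly j - pderiv (bump_poly j))"

text \<open>\<open>bump j\<close> is the \<open>j\<close>-th derivative of the smooth function equal to \<open>exp (- 1 / t)\<close> for \<open>t > 0\<close>
  and to \<open>0\<close> elsewhere.\<close>

definition bump :: "nat \<Rightarrow> real \<Rightarrow> real" where
  "bump j t = (if t > 0 then poly (bump_poly j) (1 / t) * exp (- (1 / t)) else 0)"

lemma poly_times_exp_tendsto_0: "((\<lambda>s::real. poly p s * exp (- s)) \<longlongrightarrow> 0) at_top"
proof -
  have "((\<lambda>s. \<Sum>i\<le>degree p. coeff p i * (s ^ i / exp s)) \<longlongrightarrow> (\<Sum>i\<le>degree p. coeff p i * 0)) at_top"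
    by (intro tendsto_intros tendsto_power_div_exp_0)
  moreover have "(\<Sum>i\<le>degree p. coeff p i * (s ^ i / exp s)) = poly p s * exp (- s)" for s
    by (simp add: poly_altdef sum_distrib_right exp_minus divide_inverse mult.assoc)
  ultimately show ?thesis by simp
qed

lemma DERIV_bump: "(bump j has_real_derivative bump (Suc j) t) (at t)"
proof -
  consider "t > 0" | "t < 0" | "t = 0" by linarith
  then show ?thesis
  proof cases
    case 1
    have "((\<lambda>t. poly (bump_poly j) (1 / t) * exp (- (1 / t))) has_real_derivative bump (Suc j) t) (at t)"
    proof -
      have "((\<lambda>t. poly (bump_poly j) (1 / t) * exp (- (1 / t))) has_real_derivative
         poly (pderiv (bump_poly j)) (1 / t) * (- (1 / t\<^sup>2)) * exp (- (1 / t))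
          + poly (bump_poly j) (1 / t) * (exp (- (1 / t)) * (1 / t\<^sup>2))) (at t)"
        using 1 by (auto intro!: derivative_eq_intros DERIV_chain2[OF poly_DERIV]
            simp: power2_eq_square field_simps)
      moreover have "bump (Suc j) t = poly (pderiv (bump_poly j)) (1 / t) * (- (1 / t\<^sup>2)) * exp (- (1 / t))
          + poly (bump_poly j) (1 / t) * (exp (- (1 / t)) * (1 / t\<^sup>2))"
        using 1 by (simp add: bump_def power2_eq_square algebra_simps)
      ultimately show ?thesis by simp
    qed
    then show ?thesis
      by (rule has_field_derivative_transform_within_open[of _ _ _ "{0<..}"])
         (use 1 in \<open>auto simp: bump_def\<close>)
  next
    case 2
    have "((\<lambda>_. 0) has_real_derivative bump (Suc j) t) (at t)"
      using 2 by (simp add: bump_def)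
    then show ?thesis
      by (rule has_field_derivative_transform_within_open[of _ _ _ "{..<0}"])
         (use 2 in \<open>auto simp: bump_def\<close>)
  next
    case 3
    have "((\<lambda>h. bump j h / h) \<longlongrightarrow> 0) (at 0)"
    proof (rule filterlim_split_at)
      have "\<forall>\<^sub>F h in at_left 0. bump j h / h = 0"
        by (auto simp: eventually_at_filter bump_def)
      then show "((\<lambda>h. bump j h / h) \<longlongrightarrow> 0) (at_left 0)"
        by (simp add: tendsto_eventually)
      have "((\<lambda>h::real. poly ([:0, 1:] * bump_poly j) (inverse h) * exp (- inverse h)) \<longlongrightarrow> 0) (at_right 0)"
        by (rule filterlim_compose[OF poly_times_exp_tendsto_0 filterlim_inverse_at_top_right])
      moreover have "\<forall>\<^sub>F h in at_right 0. poly ([:0, 1:] * bump_poly j) (inverse h) * exp (- inverse h) = bump j h / h"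
        using eventually_at_right_real[of 0 1]
        by (auto simp: bump_def divide_inverse elim!: eventually_mono)
      ultimately show "((\<lambda>h. bump j h / h) \<longlongrightarrow> 0) (at_right 0)"
        by (rule Lim_transform_eventually)
    qed
    then show ?thesis unfolding 3 has_field_derivative_iff by (simp add: bump_def)
  qed
qed

lemma bump_nonneg: "bump 0 t \<ge> 0"
  and bump_eq_0: "t \<le> 0 \<Longrightarrow> bump j t = 0"
  and bump_pos: "t > 0 \<Longrightarrow> bump 0 t > 0"
  by (auto simp: bump_def)

lemma continuous_on_bump [continuous_intros]:
  assumes "continuous_on S f"
  shows "continuous_on S (\<lambda>x. bump j (f x))"
proof -
  have "continuous_on UNIV (bump j)"
    using DERIV_bump DERIV_isCont continuous_at_imp_continuous_on by blast
  then show ?thesis using continuous_on_compose2[OF _ assms] by blast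
qed

lemma partial_eq: "(\<phi> has_derivative \<phi>') (at x) \<Longrightarrow> partial i \<phi> x = \<phi>' (axis i 1)"
  unfolding partial_def by (metis frechet_derivative_at)

text \<open>A class that contains the radial bump and is closed under partial derivatives;
  smoothness of every order then follows by induction with no formula for higher derivatives. All
  \<open>bump j\<close> are generators because differentiation raises the index.\<close>

inductive_set bump_algebra :: "real \<Rightarrow> real^'n \<Rightarrow> (real^'n \<Rightarrow> real) set" for c :: real and a :: "real^'n" where
  const: "(\<lambda>x. k) \<in> bump_algebra c a"
| coord: "(\<lambda>x. x $ i) \<in> bump_algebra c a"
| add: "\<phi> \<in> bump_algebra c a \<Longrightarrow> \<psi> \<in> bump_algebra c a \<Longrightarrow> (\<lambda>x. \<phi> x + \<psi> x) \<in> bump_algebra c a"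
| mult: "\<phi> \<in> bump_algebra c a \<Longrightarrow> \<psi> \<in> bump_algebra c a \<Longrightarrow> (\<lambda>x. \<phi> x * \<psi> x) \<in> bump_algebra c a"
| bump: "(\<lambda>x. bump j (c - (norm (x - a))\<^sup>2)) \<in> bump_algebra c a"

lemma bump_radial_derivative:
  "((\<lambda>x. bump j (c - (norm (x - a))\<^sup>2)) has_derivative
     (\<lambda>h. bump (Suc j) (c - (norm (x - a))\<^sup>2) * (- 2 * ((x - a) \<bullet> h)))) (at (x::real^'n))"
proof -
  have 1: "((\<lambda>x. c - (norm (x - a))\<^sup>2) has_derivative (\<lambda>h. - 2 * ((x - a) \<bullet> h))) (at x)"
  proof -
    have d: "((\<lambda>x. x - a) has_derivative (\<lambda>h. h)) (at x)"
      by (rule has_derivative_eq_rhs[OF has_derivative_diff[OF has_derivative_ident has_derivative_const]])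
         simp
    have "((\<lambda>x. c - (x - a) \<bullet> (x - a)) has_derivative
        (\<lambda>h. 0 - ((x - a) \<bullet> h + h \<bullet> (x - a)))) (at x)"
      by (intro has_derivative_diff has_derivative_const has_derivative_inner d)
    moreover have "0 - ((x - a) \<bullet> h + h \<bullet> (x - a)) = - 2 * ((x - a) \<bullet> h)" for h
      by (simp add: inner_commute)
    ultimately show ?thesis by (simp only: power2_norm_eq_inner)
  qed
  have "(bump j has_derivative (*) (bump (Suc j) (c - (norm (x - a))\<^sup>2))) (at (c - (norm (x - a))\<^sup>2))"
    using DERIV_bump by (simp add: has_field_derivative_def)
  from has_derivative_compose[OF 1 this] show ?thesis .
qed

lemma bump_algebra_partial:
  assumes "\<phi> \<in> bump_algebra c a"
  shows "(\<forall>x. \<phi> differentiable (at x)) \<and> (\<forall>i. partial i \<phi> \<in> bump_algebra c a)"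
  using assms
proof induction
  case (const k)
  have "partial i (\<lambda>x. k) = (\<lambda>x. 0)" for i :: 'a
    by (rule ext, subst partial_eq[OF has_derivative_const]) simp
  then show ?case using bump_algebra.const[of 0] by simp
next
  case (coord j)
  have d: "((\<lambda>x. x $ j) has_derivative (\<lambda>h. h $ j)) (at x)" for x :: "real^'a"
    by (rule bounded_linear_imp_has_derivative[OF bounded_linear_vec_nth])
  have "partial i (\<lambda>x. x $ j) = (\<lambda>x. axis i 1 $ j)" for i :: 'a
    by (rule ext, subst partial_eq[OF d]) simp
  then show ?case using d bump_algebra.const by (metis differentiableI)
next
  case (add \<phi> \<psi>)
  have d: "(\<phi> has_derivative frechet_derivative \<phi> (at x)) (at x)"
    "(\<psi> has_derivative frechet_derivative \<psi> (at x)) (at x)" for x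
    using add.IH frechet_derivative_works by blast+
  have "partial i (\<lambda>x. \<phi> x + \<psi> x) = (\<lambda>x. partial i \<phi> x + partial i \<psi> x)" for i
    by (rule ext, subst partial_eq[OF has_derivative_add[OF d]]) (simp add: partial_def)
  then show ?case using add.IH by (auto intro: bump_algebra.add)
next
  case (mult \<phi> \<psi>)
  have d: "(\<phi> has_derivative frechet_derivative \<phi> (at x)) (at x)"
    "(\<psi> has_derivative frechet_derivative \<psi> (at x)) (at x)" for x
    using mult.IH frechet_derivative_works by blast+
  have "partial i (\<lambda>x. \<phi> x * \<psi> x) = (\<lambda>x. \<phi> x * partial i \<psi> x + partial i \<phi> x * \<psi> x)" for i
    by (rule ext, subst partial_eq[OF has_derivative_mult[OF d]]) (simp add: partial_def)
  moreover have "(\<lambda>x. \<phi> x * partial i \<psi> x + partial i \<phi> x * \<psi> x) \<in> bump_algebra c a" for i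
    using mult.IH mult.hyps by (intro bump_algebra.add bump_algebra.mult) auto
  ultimately show ?case using mult.IH by auto
next
  case (bump j)
  have "partial i (\<lambda>x. bump j (c - (norm (x - a))\<^sup>2))
      = (\<lambda>x. bump (Suc j) (c - (norm (x - a))\<^sup>2) * (- 2 * x $ i + 2 * a $ i))" for i
    by (rule ext, subst partial_eq[OF bump_radial_derivative]) (simp add: inner_axis algebra_simps)
  moreover have "(\<lambda>x. bump (Suc j) (c - (norm (x - a))\<^sup>2) * (- 2 * x $ i + 2 * a $ i)) \<in> bump_algebra c a" for i
    by (intro bump_algebra.intros)
  ultimately show ?case using bump_radial_derivative[of j c a] by (auto intro: differentiableI)
qed

lemma bump_algebra_Ck: "\<phi> \<in> bump_algebra c a \<Longrightarrow> Ck_on k \<Omega> \<phi>"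
proof (induction k arbitrary: \<phi>)
  case 0
  then have "\<forall>x. \<phi> differentiable (at x)" using bump_algebra_partial by blast
  then show ?case
    by (auto intro!: continuous_at_imp_continuous_on differentiable_imp_continuous_within)
next
  case (Suc k)
  then show ?case using bump_algebra_partial[OF Suc.prems] by simp
qed

text \<open>The terms are left under the sum over coordinates so that each is the second derivative
  in a single direction, to be matched with second differences of a mollified function.\<close>

lemma laplacian_bump:
  "laplacian (\<lambda>x. bump 0 (c - (norm (x - a))\<^sup>2)) x
    = (\<Sum>i\<in>UNIV. bump 2 (c - (norm (x - a))\<^sup>2) * (4 * ((x - a) $ i)\<^sup>2) - 2 * bump 1 (c - (norm (x - a))\<^sup>2))"
proof -
  have p1: "partial i (\<lambda>x. bump 0 (c - (norm (x - a))\<^sup>2))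
      = (\<lambda>x. bump 1 (c - (norm (x - a))\<^sup>2) * (- 2 * (x - a) $ i))" for i
    by (rule ext, subst partial_eq[OF bump_radial_derivative]) (simp add: inner_axis)
  have p2: "partial i (\<lambda>x. bump 1 (c - (norm (x - a))\<^sup>2) * (- 2 * (x - a) $ i)) x
      = bump 2 (c - (norm (x - a))\<^sup>2) * (4 * ((x - a) $ i)\<^sup>2) - 2 * bump 1 (c - (norm (x - a))\<^sup>2)" for i
  proof -
    have c: "((\<lambda>x. - 2 * (x - a) $ i) has_derivative (\<lambda>h. - 2 * h $ i)) (at x)"
    proof -
      have "((\<lambda>x. - 2 * (x $ i - a $ i)) has_derivative (\<lambda>h. - 2 * (h $ i - 0))) (at x)"
        by (intro has_derivative_mult_right has_derivative_diff has_derivative_const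
            bounded_linear_imp_has_derivative[OF bounded_linear_vec_nth])
      then show ?thesis by simp
    qed
    show ?thesis
      by (subst partial_eq[OF has_derivative_mult[OF bump_radial_derivative c]])
         (simp add: inner_axis numeral_2_eq_2 power2_eq_square algebra_simps)
  qed
  show ?thesis unfolding laplacian_def p1 p2 ..
qed

lemma integral_on_support:
  fixes f :: "real^'n \<Rightarrow> real"
  assumes "continuous_on (cbox a b) f" "\<And>x. x \<notin> cbox a b \<Longrightarrow> f x = 0" "cbox a b \<subseteq> T"
  shows "integral T f = integral (cbox a b) f"
  using has_integral_on_superset[OF integrable_integral[OF integrable_continuous[OF assms(1)]] assms(2,3)]
  by (rule integral_unique)

section \<open>From the distributional inequality to jets\<close>

text \<open>In \<open>g s + g (- s)\<close> the odd Taylor terms cancel, which leaves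
  \<open>2 * g 0 + g2 * s\<^sup>2\<close> up to \<open>e * s\<^sup>2\<close>.\<close>

lemma second_difference_bound:
  fixes g g' :: "real \<Rightarrow> real"
  assumes g: "\<And>s. (g has_real_derivative g' s) (at s)" and g': "(g' has_real_derivative g2) (at 0)"
    and d: "d > 0" "\<And>s. \<bar>s\<bar> < d \<Longrightarrow> s\<^sup>2 * C \<le> g s + g (- s) - 2 * g 0"
  shows "C \<le> g2"
proof (rule field_le_epsilon)
  fix e :: real assume e: "e > 0"
  have "\<forall>\<^sub>F h in nhds 0. \<bar>g (0 + h) - g 0 - g' 0 \<bullet> h - (h \<bullet> (g2 * h)) / 2\<bar> \<le> e / 2 * (norm h)\<^sup>2"
  proof (rule taylor2_peano)
    show "\<forall>\<^sub>F x in nhds 0. (g has_derivative (\<bullet>) (g' x)) (at x)"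
    proof (rule always_eventually, rule allI)
      show "(g has_derivative (\<bullet>) (g' x)) (at x)" for x
        using g[of x] by (simp add: has_field_derivative_def inner_real_def[abs_def])
    qed
    show "(g' has_derivative (*) g2) (at 0)" using g' by (simp add: has_field_derivative_def)
  qed (use e in auto)
  then obtain \<delta> where \<delta>: "\<delta> > 0" "\<And>h. \<bar>h\<bar> < \<delta> \<Longrightarrow> \<bar>g h - g 0 - g' 0 * h - (h * (g2 * h)) / 2\<bar> \<le> e / 2 * h\<^sup>2"
    unfolding eventually_nhds_metric by (auto simp: dist_norm)
  define s where "s = min d \<delta> / 2"
  have s: "s > 0" "\<bar>s\<bar> < d" "\<bar>s\<bar> < \<delta>" "\<bar>- s\<bar> < \<delta>" using d \<delta> by (auto simp: s_def)
  have "g s + g (- s) - 2 * g 0 \<le> (g2 + e) * s\<^sup>2"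
  proof -
    have "s * (g2 * s) = g2 * s\<^sup>2" "(- s) * (g2 * (- s)) = g2 * s\<^sup>2" "(- s)\<^sup>2 = s\<^sup>2"
      "g' 0 * (- s) = - (g' 0 * s)" "(g2 + e) * s\<^sup>2 = g2 * s\<^sup>2 + e * s\<^sup>2" "e / 2 * s\<^sup>2 = e * s\<^sup>2 / 2"
      by (simp_all add: power2_eq_square algebra_simps)
    note eqs = this
    show ?thesis using \<delta>(2)[OF s(3)] \<delta>(2)[OF s(4)] unfolding eqs by linarith
  qed
  then have "s\<^sup>2 * C \<le> s\<^sup>2 * (g2 + e)" using d(2)[OF s(2)] by (simp add: mult.commute)
  then show "C \<le> g2 + e" using s by simp
qed

lemma norm_le_card_mult:
  fixes h :: "real^'n" and R :: real
  assumes "\<And>i. \<bar>h $ i\<bar> \<le> R"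
  shows "norm h \<le> CARD('n) * R"
proof -
  have "norm h \<le> (\<Sum>i\<in>UNIV. \<bar>h $ i\<bar>)" by (rule norm_le_l1_cart)
  also have "\<dots> \<le> (\<Sum>i\<in>(UNIV::'n set). R)" by (intro sum_mono assms)
  finally show ?thesis by simp
qed

text \<open>Mollify \<open>u\<close> minus the touching quadratic with the bump: the result has an interior minimum,
  where its second derivatives in the coordinate directions are nonnegative.\<close>

lemma superharmonic_jet:
  fixes u :: "real^'n \<Rightarrow> real"
  assumes sh: "laplacian_nonpos_distr \<Omega> u" and \<Omega>: "open \<Omega>" and u_cont: "continuous_on \<Omega> u"
    and y: "y \<in> \<Omega>" and jet: "subjet u y p H"
  shows "trace H \<le> 0"
proof (rule ccontr)
  assume "\<not> trace H \<le> 0"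
  then have tr: "trace H > 0" by simp
  \<comment> \<open>Half of the trace is given up for strict contact: \<open>K\<close> still has
    trace \<open>trace H / 2\<close>.\<close>
  define \<eta> where "\<eta> = trace H / (2 * real CARD('n))"
  have \<eta>: "\<eta> > 0" using tr by (simp add: \<eta>_def)
  define K where "K = H - \<eta> *\<^sub>R mat 1"
  have trK: "trace K > 0" using tr by (simp add: K_def trace_sub trace_scaleR trace_mat_1 \<eta>_def)
  define q where "q x = u y + p \<bullet> (x - y) + ((x - y) \<bullet> (K *v (x - y))) / 2" for x
  have q_cont: "continuous_on S q" for S
    unfolding q_def by (intro continuous_intros matrix_vector_mult_linear_continuous_on
       continuous_on_compose2[OF matrix_vector_mult_linear_continuous_on[of UNIV K]]) auto
  have q_diff2: "q (w + s *\<^sub>R axis i 1) + q (w - s *\<^sub>R axis i 1) - 2 * q w = s\<^sup>2 * K $ i $ i" for w s i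
  proof -
    define z where "z = w - y"
    define e where "e = (axis i 1 :: real^'n)"
    have e: "e \<bullet> (K *v e) = K $ i $ i"
      by (simp add: e_def inner_axis' matrix_vector_mul_component inner_axis)
    have z: "w + s *\<^sub>R e - y = z + s *\<^sub>R e" "w - s *\<^sub>R e - y = z - s *\<^sub>R e" by (simp_all add: z_def)
    show ?thesis
      unfolding q_def e_def[symmetric] z z_def[symmetric] e[symmetric]
      by (simp add: matrix_vector_right_distrib matrix_vector_mult_diff_distrib matrix_vector_mult_scaleR
          inner_add_left inner_add_right inner_diff_left inner_diff_right power2_eq_square
          add_divide_distrib diff_divide_distrib distrib_left right_diff_distrib)
  qed
  have "\<forall>\<^sub>F h in nhds 0. q (y + h) + \<eta> / 4 * (norm h)\<^sup>2 \<le> u (y + h)"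
  proof -
    have "\<forall>\<^sub>F h in nhds 0. u y + p \<bullet> h + (h \<bullet> (H *v h)) / 2 - \<eta> / 4 * (norm h)\<^sup>2 \<le> u (y + h)"
      using jet \<eta>(1) unfolding subjet_iff by (elim allE[of _ "\<eta> / 4"]) simp
    then show ?thesis
      by eventually_elim (simp add: q_def K_def mat_mult_simps inner_diff_right power2_norm_eq_inner
          field_simps)
  qed
  then have "\<forall>\<^sub>F h in nhds 0. q (y + h) + \<eta> / 4 * (norm h)\<^sup>2 \<le> u (y + h) \<and> y + h \<in> \<Omega>"
    using eventually_shift[OF \<Omega> y] by (rule eventually_conj)
  then obtain R0 where R0: "R0 > 0"
    "\<And>h. norm h < R0 \<Longrightarrow> q (y + h) + \<eta> / 4 * (norm h)\<^sup>2 \<le> u (y + h) \<and> y + h \<in> \<Omega>"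
    unfolding eventually_nhds_metric by (auto simp: dist_norm)
  \<comment> \<open>The cube \<open>B\<close> of half side \<open>2 * R\<close> lies in the ball of
    radius \<open>R0\<close>, since the Euclidean norm is at most \<open>CARD('n)\<close> times the
    largest coordinate.\<close>
  define R where "R = R0 / (4 * real CARD('n))"
  have R: "R > 0" using R0 by (simp add: R_def)
  define one :: "real^'n" where "one = (\<chi> i. 1)"
  define B where "B = cbox (y - (2 * R) *\<^sub>R one) (y + (2 * R) *\<^sub>R one)"
  have memB: "x \<in> B \<longleftrightarrow> (\<forall>i. \<bar>(x - y) $ i\<bar> \<le> 2 * R)" for x
    unfolding B_def mem_box_cart one_def by (auto simp: abs_le_iff algebra_simps)
  have below: "q x + \<eta> / 4 * (norm (x - y))\<^sup>2 \<le> u x" and B\<Omega>: "x \<in> \<Omega>" if "x \<in> B" for x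
  proof -
    have "norm (x - y) \<le> CARD('n) * (2 * R)"
      using that by (intro norm_le_card_mult) (simp add: memB)
    also have "\<dots> < R0" using R0 by (simp add: R_def)
    finally show "q x + \<eta> / 4 * (norm (x - y))\<^sup>2 \<le> u x" "x \<in> \<Omega>" using R0(2)[of "x - y"] by auto
  qed
  have yB: "y \<in> B" using R by (simp add: memB)
  have uB: "continuous_on B u" using B\<Omega> by (intro continuous_on_subset[OF u_cont]) auto
  have ball_B: "x \<in> B" if "norm (x - y) \<le> 2 * R" for x
    using that component_le_norm_cart[of "x - y"] by (auto simp: memB intro: order_trans)
  \<comment> \<open>On bumps centred at distance \<open>R\<close> from \<open>y\<close> the
    difference \<open>u - q\<close> is at least \<open>\<eta> * R\<^sup>2 / 16\<close>, as their
    support stays at distance \<open>R / 2\<close>. Half of this bounds it on the bump at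
    \<open>y\<close>, so the mollified difference has its minimum in the interior.\<close>
  obtain \<epsilon> where \<epsilon>: "\<epsilon> > 0" "\<epsilon> \<le> R / 2" "\<And>x. norm (x - y) \<le> \<epsilon> \<Longrightarrow> u x - q x \<le> \<eta> * R\<^sup>2 / 32"
  proof -
    have "continuous_on B (\<lambda>x. u x - q x)" by (intro continuous_intros uB q_cont)
    moreover have "\<eta> * R\<^sup>2 / 32 > 0" using \<eta> R by simp
    ultimately obtain \<delta> where \<delta>: "\<delta> > 0"
      "\<And>x. x \<in> B \<Longrightarrow> dist x y < \<delta> \<Longrightarrow> dist (u x - q x) (u y - q y) < \<eta> * R\<^sup>2 / 32"
      using yB unfolding continuous_on_iff by meson
    show thesis
    proof (rule that[of "min (R / 2) (\<delta> / 2)"])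
      fix x assume x: "norm (x - y) \<le> min (R / 2) (\<delta> / 2)"
      then have "x \<in> B" using R by (intro ball_B) auto
      moreover have "dist x y < \<delta>" using x \<delta>(1) by (simp add: dist_norm)
      ultimately have "dist (u x - q x) (u y - q y) < \<eta> * R\<^sup>2 / 32" by (rule \<delta>(2))
      moreover have "u y - q y = 0" by (simp add: q_def)
      ultimately show "u x - q x \<le> \<eta> * R\<^sup>2 / 32" unfolding dist_real_def by linarith
    qed (use \<delta> R in auto)
  qed
  define \<beta> where "\<beta> a x = bump 0 (\<epsilon>\<^sup>2 - (norm (x - a))\<^sup>2)" for a x :: "real^'n"
  have \<beta>_nonneg: "\<beta> a x \<ge> 0" for a x by (simp add: \<beta>_def bump_nonneg)
  have bump_supp: "bump j (\<epsilon>\<^sup>2 - (norm (x - a))\<^sup>2) = 0" if "norm (x - a) \<ge> \<epsilon>" for j a and x :: "real^'n"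
    using that \<epsilon> power_mono[of \<epsilon> "norm (x - a)" 2] by (intro bump_eq_0) auto
  have \<beta>_supp: "\<beta> a x = 0" if "norm (x - a) \<ge> \<epsilon>" for a x
    using bump_supp that by (simp add: \<beta>_def)
  define C0 where "C0 = cbox (- (\<epsilon> *\<^sub>R one)) (\<epsilon> *\<^sub>R one)"
  have memC0: "x \<in> C0 \<longleftrightarrow> (\<forall>i. \<bar>x $ i\<bar> \<le> \<epsilon>)" for x
    unfolding C0_def mem_box_cart one_def by (auto simp: abs_le_iff) (metis minus_le_iff)+
  define I where "I = integral C0 (\<beta> 0)"
  have \<beta>0_cont: "continuous_on S (\<beta> 0)" for S
    unfolding \<beta>_def by (intro continuous_intros)
  have I: "I > 0"
  proof -
    have "integral C0 (\<beta> 0) \<noteq> 0"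
    proof
      assume "integral C0 (\<beta> 0) = 0"
      then have "(\<beta> 0 has_integral 0) C0"
        using integrable_integral[OF integrable_continuous[OF \<beta>0_cont]] unfolding C0_def by metis
      moreover have "0 \<in> box (- (\<epsilon> *\<^sub>R one)) (\<epsilon> *\<^sub>R one)"
        using \<epsilon> by (simp add: mem_box_cart one_def)
      then have "box (- (\<epsilon> *\<^sub>R one)) (\<epsilon> *\<^sub>R one) \<noteq> {}" by blast
      moreover have "0 \<in> C0" using \<epsilon> by (simp add: memC0)
      ultimately have "\<beta> 0 0 = 0"
        unfolding C0_def by (intro has_integral_0_cbox_imp_0[OF \<beta>0_cont]) (auto simp: \<beta>_nonneg)
      moreover have "\<beta> 0 0 > 0" unfolding \<beta>_def using \<epsilon> by (intro bump_pos) simp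
      ultimately show False by simp
    qed
    moreover have "integral C0 (\<beta> 0) \<ge> 0"
      using \<beta>_nonneg by (intro Henstock_Kurzweil_Integration.integral_nonneg)
        (auto simp: C0_def intro: integrable_continuous \<beta>0_cont)
    ultimately show ?thesis by (simp add: I_def)
  qed
  \<comment> \<open>For centres this close to \<open>y\<close> the support of the bump lies in
    \<open>B\<close>, as \<open>R + 2 * \<epsilon> \<le> 2 * R\<close>, so the integral can be
    translated to a fixed cube. The bump is not normalised; \<open>I\<close> is its mass.\<close>
  have shift: "integral B (\<lambda>x. k x * \<beta> a x) = integral C0 (\<lambda>h. k (a + h) * \<beta> 0 h)"
    if k: "continuous_on UNIV k" and a: "norm (a - y) \<le> R + \<epsilon>" for k :: "real^'n \<Rightarrow> real" and a
  proof -
    have "integral B (\<lambda>x. k x * \<beta> a x) = integral (cbox (- (\<epsilon> *\<^sub>R one) + a) (\<epsilon> *\<^sub>R one + a)) (\<lambda>x. k x * \<beta> a x)"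
    proof (rule integral_on_support)
      show "continuous_on (cbox (- (\<epsilon> *\<^sub>R one) + a) (\<epsilon> *\<^sub>R one + a)) (\<lambda>x. k x * \<beta> a x)"
        unfolding \<beta>_def by (intro continuous_intros continuous_on_subset[OF k]) auto
      have mem: "x \<in> cbox (- (\<epsilon> *\<^sub>R one) + a) (\<epsilon> *\<^sub>R one + a) \<longleftrightarrow> (\<forall>i. \<bar>(x - a) $ i\<bar> \<le> \<epsilon>)" for x
        unfolding mem_box_cart one_def by (auto simp: abs_le_iff algebra_simps)
      show "k x * \<beta> a x = 0" if x: "x \<notin> cbox (- (\<epsilon> *\<^sub>R one) + a) (\<epsilon> *\<^sub>R one + a)" for x
      proof -
        obtain i where "\<bar>(x - a) $ i\<bar> > \<epsilon>" using x unfolding mem by (meson not_le)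
        then have "norm (x - a) \<ge> \<epsilon>" using component_le_norm_cart[of "x - a" i] by linarith
        then show ?thesis by (simp add: \<beta>_supp)
      qed
      show "cbox (- (\<epsilon> *\<^sub>R one) + a) (\<epsilon> *\<^sub>R one + a) \<subseteq> B"
      proof
        fix x assume x: "x \<in> cbox (- (\<epsilon> *\<^sub>R one) + a) (\<epsilon> *\<^sub>R one + a)"
        have "\<bar>(x - y) $ i\<bar> \<le> 2 * R" for i
        proof -
          have "\<bar>(x - a) $ i\<bar> \<le> \<epsilon>" using x unfolding mem by blast
          moreover have "\<bar>(a - y) $ i\<bar> \<le> R + \<epsilon>" using a component_le_norm_cart[of "a - y" i] by linarith
          moreover have "(x - y) $ i = (x - a) $ i + (a - y) $ i" by simp
          ultimately show ?thesis using \<epsilon>(2) by linarith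
        qed
        then show "x \<in> B" by (simp add: memB)
      qed
    qed
    also have "\<dots> = integral C0 ((\<lambda>x. k x * \<beta> a x) \<circ> ((+) a))"
      unfolding C0_def integral_shift_cbox_plus ..
    also have "((\<lambda>x. k x * \<beta> a x) \<circ> ((+) a)) = (\<lambda>h. k (a + h) * \<beta> 0 h)"
      by (auto simp: \<beta>_def)
    finally show ?thesis .
  qed
  have I_B: "integral B (\<beta> a) = I" if "norm (a - y) \<le> R" for a
    using shift[of "\<lambda>_. 1" a] that \<epsilon> by (simp add: I_def continuous_on_const)
  define Zu where "Zu a = integral B (\<lambda>x. u x * \<beta> a x)" for a
  define Zq where "Zq a = integral B (\<lambda>x. q x * \<beta> a x)" for a
  define D where "D = cball y R"
  have int: "(\<lambda>x. k x * \<beta> a x) integrable_on B" if "continuous_on B k" for k a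
    unfolding B_def using that
    by (intro integrable_continuous continuous_intros) (auto simp: B_def \<beta>_def intro!: continuous_intros)
  have Z_eq: "Zu a - Zq a = integral B (\<lambda>x. (u x - q x) * \<beta> a x)" for a
    unfolding Zu_def Zq_def left_diff_distrib
    by (rule Henstock_Kurzweil_Integration.integral_diff[symmetric]) (intro int uB q_cont)+
  have Z_cont: "continuous_on D (\<lambda>a. Zu a - Zq a)"
    unfolding Z_eq
    unfolding B_def
  proof (rule integral_continuous_on_param)
    have "continuous_on (D \<times> B) (\<lambda>z. (u (snd z) - q (snd z)) * \<beta> (fst z) (snd z))"
      unfolding \<beta>_def
      by (intro continuous_intros continuous_on_compose2[OF uB] continuous_on_compose2[OF q_cont[of UNIV]]) auto
    then show "continuous_on (D \<times> cbox (y - (2 * R) *\<^sub>R one) (y + (2 * R) *\<^sub>R one))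
       (\<lambda>(a, x). (u x - q x) * \<beta> a x)"
      by (simp add: B_def case_prod_unfold)
  qed
  have yD: "y \<in> D" using R by (simp add: D_def)
  obtain a where a: "a \<in> D" "\<And>b. b \<in> D \<Longrightarrow> Zu a - Zq a \<le> Zu b - Zq b"
  proof -
    have "\<exists>a\<in>D. \<forall>b\<in>D. Zu a - Zq a \<le> Zu b - Zq b"
      using yD by (intro continuous_attains_inf[OF _ _ Z_cont]) (auto simp: D_def)
    then show thesis using that by blast
  qed
  have Zy: "Zu y - Zq y \<le> \<eta> * R\<^sup>2 / 32 * I"
  proof -
    have "integral B (\<lambda>x. (u x - q x) * \<beta> y x) \<le> integral B (\<lambda>x. \<eta> * R\<^sup>2 / 32 * \<beta> y x)"
    proof (rule integral_le)
      show "(u x - q x) * \<beta> y x \<le> \<eta> * R\<^sup>2 / 32 * \<beta> y x" for x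
      proof (cases "norm (x - y) \<le> \<epsilon>")
        case True
        then show ?thesis by (intro mult_right_mono \<epsilon>(3) \<beta>_nonneg)
      qed (use \<beta>_supp in auto)
    qed (intro int continuous_intros uB q_cont)+
    then show ?thesis unfolding Z_eq using I_B[of y] R by simp
  qed
  have Zbd: "\<eta> * R\<^sup>2 / 16 * I \<le> Zu b - Zq b" if b: "norm (b - y) = R" for b
  proof -
    have "integral B (\<lambda>x. \<eta> * R\<^sup>2 / 16 * \<beta> b x) \<le> integral B (\<lambda>x. (u x - q x) * \<beta> b x)"
    proof (rule integral_le)
      fix x assume x: "x \<in> B"
      show "\<eta> * R\<^sup>2 / 16 * \<beta> b x \<le> (u x - q x) * \<beta> b x"
      proof (cases "norm (x - b) \<le> \<epsilon>")
        case True
        have "R \<le> norm (x - y) + norm (x - b)"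
          using norm_triangle_ineq4[of "x - y" "x - b"] b by (simp add: norm_minus_commute)
        then have "R / 2 \<le> norm (x - y)" using True \<epsilon>(2) by linarith
        then have "(R / 2)\<^sup>2 \<le> (norm (x - y))\<^sup>2" using R by (intro power_mono) auto
        then have "\<eta> / 4 * (R / 2)\<^sup>2 \<le> \<eta> / 4 * (norm (x - y))\<^sup>2" using \<eta> by (intro mult_left_mono) auto
        then have "\<eta> * R\<^sup>2 / 16 \<le> u x - q x" using below[OF x] by (simp add: power_divide)
        then show ?thesis using \<beta>_nonneg by (intro mult_right_mono) auto
      qed (use \<beta>_supp in auto)
    qed (intro int continuous_intros uB q_cont)+
    then show ?thesis unfolding Z_eq using I_B[of b] b by simp
  qed
  have aR: "norm (a - y) < R"
  proof (rule ccontr)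
    assume "\<not> norm (a - y) < R"
    then have "norm (a - y) = R" using a(1) by (simp add: D_def dist_norm norm_minus_commute)
    then have "\<eta> * R\<^sup>2 / 16 * I \<le> \<eta> * R\<^sup>2 / 32 * I"
      using Zbd[of a] a(2)[OF yD] Zy by linarith
    moreover have "\<eta> * R\<^sup>2 * I > 0" using \<eta> R I by simp
    ultimately show False by (simp add: mult_ac)
  qed
  define \<Delta> where "\<Delta> i x = bump 2 (\<epsilon>\<^sup>2 - (norm (x - a))\<^sup>2) * (4 * ((x - a) $ i)\<^sup>2)
      - 2 * bump 1 (\<epsilon>\<^sup>2 - (norm (x - a))\<^sup>2)" for i x
  define D1 where "D1 i s x = bump 1 (\<epsilon>\<^sup>2 - (norm (x - (a + s *\<^sub>R axis i 1)))\<^sup>2)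
      * (2 * (x - (a + s *\<^sub>R axis i 1)) $ i)" for i s x
  \<comment> \<open>At the minimum \<open>a\<close> the second differences of \<open>Zu\<close>
    dominate those of \<open>Zq\<close>, and the latter are exactly
    \<open>s\<^sup>2 * K $ i $ i * I\<close> because \<open>q\<close> is quadratic. The second
    derivative of \<open>Zu\<close> in the centre falls on the bump, where it equals the one in
    \<open>x\<close>.\<close>
  have dir: "K $ i $ i * I \<le> integral B (\<lambda>x. u x * \<Delta> i x)" for i
  proof (rule second_difference_bound[where g = "\<lambda>s. Zu (a + s *\<^sub>R axis i 1)"
        and g' = "\<lambda>s. integral B (\<lambda>x. u x * D1 i s x)" and d = "R - norm (a - y)"])
    have der: "((\<lambda>s. bump j (\<epsilon>\<^sup>2 - (norm (x - (a + s *\<^sub>R axis i 1)))\<^sup>2)) has_real_derivative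
       bump (Suc j) (\<epsilon>\<^sup>2 - (norm (x - (a + s *\<^sub>R axis i 1)))\<^sup>2) * (2 * (x - (a + s *\<^sub>R axis i 1)) $ i)) (at s)"
      for j s and x :: "real^'n"
    proof -
      have 1: "norm (x - (a + s *\<^sub>R axis i 1)) = norm (s *\<^sub>R axis i 1 - (x - a))" for s
        by (simp add: norm_minus_commute algebra_simps)
      have 2: "((\<lambda>s. s *\<^sub>R axis i 1 :: real^'n) has_derivative (\<lambda>h. h *\<^sub>R axis i 1)) (at s)"
        by (rule bounded_linear_imp_has_derivative[OF bounded_linear_scaleR_left])
      show ?thesis
        unfolding 1 has_field_derivative_def
        by (rule has_derivative_eq_rhs[OF has_derivative_compose[OF 2 bump_radial_derivative]])
           (auto simp: inner_axis algebra_simps)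
    qed
    show "((\<lambda>s. Zu (a + s *\<^sub>R axis i 1)) has_real_derivative
        integral B (\<lambda>x. u x * D1 i s x)) (at s)" for s
      unfolding Zu_def B_def
    proof (rule leibniz_rule_field_derivative[where U = UNIV, simplified])
      show "((\<lambda>s. u x * \<beta> (a + s *\<^sub>R axis i 1) x) has_real_derivative
         u x * D1 i s x) (at s)" for s x
        unfolding \<beta>_def D1_def using DERIV_cmult[OF der[of 0 x s]] by simp
      show "(\<lambda>x. u x * \<beta> (a + s *\<^sub>R axis i 1) x) integrable_on
          cbox (y - (2 * R) *\<^sub>R one) (y + (2 * R) *\<^sub>R one)" for s
        using int[OF uB] by (simp add: B_def)
      have "continuous_on (UNIV \<times> B) (\<lambda>z. u (snd z) *
          (bump 1 (\<epsilon>\<^sup>2 - (norm (snd z - (a + fst z *\<^sub>R axis i 1)))\<^sup>2) * (2 * (snd z - (a + fst z *\<^sub>R axis i 1)) $ i)))"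
        by (intro continuous_intros continuous_on_compose2[OF uB]) auto
      then show "continuous_on (UNIV \<times> cbox (y - (2 * R) *\<^sub>R one) (y + (2 * R) *\<^sub>R one))
          (\<lambda>(s, x). u x * D1 i s x)"
        by (simp add: B_def D1_def case_prod_unfold)
    qed
    show "((\<lambda>s. integral B (\<lambda>x. u x * D1 i s x)) has_real_derivative
        integral B (\<lambda>x. u x * \<Delta> i x)) (at 0)"
    proof -
      define \<Delta>' where "\<Delta>' s x = bump 2 (\<epsilon>\<^sup>2 - (norm (x - (a + s *\<^sub>R axis i 1)))\<^sup>2) * (4 * ((x - (a + s *\<^sub>R axis i 1)) $ i)\<^sup>2)
          - 2 * bump 1 (\<epsilon>\<^sup>2 - (norm (x - (a + s *\<^sub>R axis i 1)))\<^sup>2)" for s and x :: "real^'n"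
      have der2: "((\<lambda>s. D1 i s x)
          has_real_derivative \<Delta>' s x) (at s)" for s x
      proof -
        have lin: "((\<lambda>s. 2 * (x - (a + s *\<^sub>R axis i 1)) $ i) has_real_derivative - 2) (at s)"
          by (auto intro!: derivative_eq_intros)
        show ?thesis
          unfolding D1_def
          by (rule DERIV_cong[OF DERIV_mult[OF der lin]])
             (simp add: \<Delta>'_def numeral_2_eq_2 power2_eq_square algebra_simps)
      qed
      have "((\<lambda>s. integral B (\<lambda>x. u x * D1 i s x)) has_real_derivative
          integral B (\<lambda>x. u x * \<Delta>' 0 x)) (at 0)"
        unfolding B_def
      proof (rule leibniz_rule_field_derivative[where U = UNIV, simplified])
        show "((\<lambda>s. u x * D1 i s x) has_real_derivative u x * \<Delta>' s x) (at s)" for s x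
          using DERIV_cmult[OF der2[of x s]] by simp
        show "(\<lambda>x. u x * D1 i s x) integrable_on
             cbox (y - (2 * R) *\<^sub>R one) (y + (2 * R) *\<^sub>R one)" for s
          unfolding D1_def using uB by (intro integrable_continuous continuous_intros) (auto simp: B_def)
        have "continuous_on (UNIV \<times> B) (\<lambda>z. u (snd z) * \<Delta>' (fst z) (snd z))"
          unfolding \<Delta>'_def by (intro continuous_intros continuous_on_compose2[OF uB]) auto
        then show "continuous_on (UNIV \<times> cbox (y - (2 * R) *\<^sub>R one) (y + (2 * R) *\<^sub>R one))
            (\<lambda>(s, x). u x * \<Delta>' s x)"
          by (simp add: B_def case_prod_unfold)
      qed
      then show ?thesis by (simp add: \<Delta>'_def \<Delta>_def[abs_def])
    qed
    show "R - norm (a - y) > 0" using aR by simp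
    fix s assume s: "\<bar>s\<bar> < R - norm (a - y)"
    define e where "e = (axis i 1 :: real^'n)"
    have ne: "norm (s *\<^sub>R e) = \<bar>s\<bar>" by (simp add: e_def)
    have ps: "norm (a + s *\<^sub>R e - y) \<le> R" "norm (a - s *\<^sub>R e - y) \<le> R"
    proof -
      have eq: "a + s *\<^sub>R e - y = (a - y) + s *\<^sub>R e" "a - s *\<^sub>R e - y = (a - y) - s *\<^sub>R e" by simp_all
      show "norm (a + s *\<^sub>R e - y) \<le> R" unfolding eq using s ne norm_triangle_ineq[of "a - y" "s *\<^sub>R e"] by linarith
      show "norm (a - s *\<^sub>R e - y) \<le> R" unfolding eq using s ne norm_triangle_ineq4[of "a - y" "s *\<^sub>R e"] by linarith
    qed
    have "Zq (a + s *\<^sub>R e) + Zq (a - s *\<^sub>R e) - 2 * Zq a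
       = integral C0 (\<lambda>h. q (a + s *\<^sub>R e + h) * \<beta> 0 h) + integral C0 (\<lambda>h. q (a - s *\<^sub>R e + h) * \<beta> 0 h)
         - integral C0 (\<lambda>h. 2 * (q (a + h) * \<beta> 0 h))"
      unfolding Zq_def using ps aR \<epsilon> by (simp add: shift[OF q_cont])
    also have "\<dots> = integral C0 (\<lambda>h. q (a + s *\<^sub>R e + h) * \<beta> 0 h + q (a - s *\<^sub>R e + h) * \<beta> 0 h
          - 2 * (q (a + h) * \<beta> 0 h))"
    proof -
      have i: "(\<lambda>h. q (b + h) * \<beta> 0 h) integrable_on C0" for b
        unfolding C0_def
        by (intro integrable_continuous continuous_intros \<beta>0_cont continuous_on_compose2[OF q_cont[of UNIV]]) auto
      show ?thesis
        by (simp add: Henstock_Kurzweil_Integration.integral_add Henstock_Kurzweil_Integration.integral_diff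
            i integrable_add integrable_on_cmult_left)
    qed
    also have "\<dots> = integral C0 (\<lambda>h. s\<^sup>2 * K $ i $ i * \<beta> 0 h)"
    proof (rule arg_cong[where f = "integral C0"], rule ext)
      fix h
      have "q (a + s *\<^sub>R e + h) * \<beta> 0 h + q (a - s *\<^sub>R e + h) * \<beta> 0 h - 2 * (q (a + h) * \<beta> 0 h)
         = (q (a + h + s *\<^sub>R e) + q (a + h - s *\<^sub>R e) - 2 * q (a + h)) * \<beta> 0 h"
        by (simp add: algebra_simps)
      then show "q (a + s *\<^sub>R e + h) * \<beta> 0 h + q (a - s *\<^sub>R e + h) * \<beta> 0 h - 2 * (q (a + h) * \<beta> 0 h)
         = s\<^sup>2 * K $ i $ i * \<beta> 0 h"
        unfolding e_def q_diff2 .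
    qed
    also have "\<dots> = s\<^sup>2 * (K $ i $ i * I)" by (simp add: I_def)
    finally have "s\<^sup>2 * (K $ i $ i * I) = Zq (a + s *\<^sub>R e) + Zq (a - s *\<^sub>R e) - 2 * Zq a" by simp
    moreover have "Zu a - Zq a \<le> Zu (a + s *\<^sub>R e) - Zq (a + s *\<^sub>R e)"
      "Zu a - Zq a \<le> Zu (a - s *\<^sub>R e) - Zq (a - s *\<^sub>R e)"
      using ps by (auto intro!: a(2) simp: D_def dist_norm norm_minus_commute)
    ultimately show "s\<^sup>2 * (K $ i $ i * I) \<le> Zu (a + s *\<^sub>R axis i 1) + Zu (a + - s *\<^sub>R axis i 1)
        - 2 * Zu (a + 0 *\<^sub>R axis i 1)"
      unfolding e_def by simp
  qed
  \<comment> \<open>Summing over the coordinates produces the Laplacian of the bump at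
    \<open>a\<close>, an admissible nonnegative test function, so the positive number
    \<open>trace K * I\<close> would be at most zero.\<close>
  have "trace K * I = (\<Sum>i\<in>UNIV. K $ i $ i * I)" by (simp add: trace_def sum_distrib_right)
  also have "\<dots> \<le> (\<Sum>i\<in>UNIV. integral B (\<lambda>x. u x * \<Delta> i x))" by (intro sum_mono dir)
  also have "\<dots> = integral B (\<lambda>x. \<Sum>i\<in>UNIV. u x * \<Delta> i x)"
  proof (rule Henstock_Kurzweil_Integration.integral_sum[symmetric])
    show "(\<lambda>x. u x * \<Delta> i x) integrable_on B" for i
      unfolding B_def \<Delta>_def using uB by (intro integrable_continuous continuous_intros) (auto simp: B_def)
  qed simp
  also have "(\<lambda>x. \<Sum>i\<in>UNIV. u x * \<Delta> i x) = (\<lambda>x. u x * laplacian (\<beta> a) x)"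
    unfolding \<beta>_def laplacian_bump \<Delta>_def sum_distrib_left ..
  also have "integral B (\<lambda>x. u x * laplacian (\<beta> a) x) = (LINT x:B|lborel. u x * laplacian (\<beta> a) x)"
  proof (rule set_borel_integral_eq_integral(2)[symmetric])
    have "continuous_on B (\<lambda>x. u x * laplacian (\<beta> a) x)"
      unfolding \<beta>_def laplacian_bump by (intro continuous_intros uB)
    then show "set_integrable lborel B (\<lambda>x. u x * laplacian (\<beta> a) x)"
      unfolding set_integrable_def by (intro borel_integrable_compact) (auto simp: B_def)
  qed
  also have "\<dots> = (LINT x:\<Omega>|lborel. u x * laplacian (\<beta> a) x)"
  proof -
    have "laplacian (\<beta> a) x = 0" if "x \<notin> B" for x
    proof -
      have "norm (x - y) > 2 * R" using ball_B[of x] that by (meson not_le)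
      then have "norm (x - a) \<ge> \<epsilon>"
        using norm_triangle_ineq[of "x - a" "a - y"] aR \<epsilon>(2) R by simp
      then show ?thesis unfolding \<beta>_def laplacian_bump by (simp add: bump_supp)
    qed
    then have "(\<lambda>x. indicator B x *\<^sub>R (u x * laplacian (\<beta> a) x)) = (\<lambda>x. indicator \<Omega> x *\<^sub>R (u x * laplacian (\<beta> a) x))"
      using B\<Omega> by (auto simp: indicator_def fun_eq_iff)
    then show ?thesis unfolding set_lebesgue_integral_def by simp
  qed
  also have "\<dots> \<le> 0"
  proof -
    have "closure {x. \<beta> a x \<noteq> 0} \<subseteq> cball a \<epsilon>"
    proof (rule closure_minimal)
      show "{x. \<beta> a x \<noteq> 0} \<subseteq> cball a \<epsilon>"
        using \<beta>_supp by (force simp: dist_norm norm_minus_commute not_le)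
    qed simp
    moreover have "cball a \<epsilon> \<subseteq> \<Omega>"
    proof
      fix x assume "x \<in> cball a \<epsilon>"
      then have "norm (x - y) \<le> 2 * R"
        using norm_triangle_ineq[of "x - a" "a - y"] aR \<epsilon>(2) R by (simp add: dist_norm norm_minus_commute)
      then show "x \<in> \<Omega>" using ball_B B\<Omega> by blast
    qed
    moreover have "compact (closure {x. \<beta> a x \<noteq> 0})"
      using calculation(1) bounded_subset[OF bounded_cball] compact_eq_bounded_closed by blast
    moreover have "Ck_on k UNIV (\<beta> a)" for k
      unfolding \<beta>_def
      by (rule bump_algebra_Ck[where c = "\<epsilon>\<^sup>2" and a = a]) (rule bump_algebra.bump)
    ultimately have "test_function \<Omega> (\<beta> a)" by (auto simp: test_function_def)
    then show ?thesis using sh \<beta>_nonneg unfolding laplacian_nonpos_distr_def by blast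
  qed
  finally have "trace K * I \<le> 0" .
  then show False using mult_pos_pos[OF trK I] by simp
qed

section \<open>Kelvin transforms and radial symmetry\<close>

text \<open>The second and third argument are gradient and Hessian of \<open>v powr a\<close> by the
  chain rule. The power of \<open>v\<close> in front of the Hessian is
  \<open>2 * a - 1 = - (n + 2) / (n - 2)\<close>, and both gradient terms carry
  \<open>2 * a - 2 = - 2 * n / (n - 2)\<close>.\<close>

lemma conf_hessian_eq_schouten:
  fixes v :: "real^'n \<Rightarrow> real"
  assumes n: "CARD('n) \<ge> 3" and v: "v x > 0"
  defines "a \<equiv> - 2 / (real CARD('n) - 2)"
  shows "schouten (v x powr a) ((a * v x powr (a - 1)) *\<^sub>R gradient v x)
      ((a * v x powr (a - 1)) *\<^sub>R hessian v x
        + (a * (a - 1) * v x powr (a - 2)) *\<^sub>R outer (gradient v x) (gradient v x))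
    = conf_hessian v x"
proof -
  define n where "n = real CARD('n)"
  define m where "m = n - 2"
  have m: "m > 0" using assms(1) by (simp add: m_def n_def)
  have nm: "n = m + 2" by (simp add: m_def)
  have am: "a = - 2 / m" by (simp add: a_def m_def n_def)
  define s where "s = v x"
  have e1: "s powr a * (a * s powr (a - 1)) = - (2 / m) * s powr (- ((n + 2) / m))"
  proof -
    have "a + (a - 1) = - ((n + 2) / m)" unfolding am nm using m by (simp add: field_simps)
    then have "s powr a * s powr (a - 1) = s powr (- ((n + 2) / m))" by (simp add: powr_add[symmetric])
    then show ?thesis by (simp add: am)
  qed
  have two: "a + (a - 2) = - (2 * n / m)" unfolding am nm using m by (simp add: field_simps)
  have e2: "s powr a * (a * (a - 1) * s powr (a - 2)) = 2 * n / m\<^sup>2 * s powr (- (2 * n / m))"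
  proof -
    have "s powr a * s powr (a - 2) = s powr (- (2 * n / m))" unfolding two[symmetric] by (rule powr_add[symmetric])
    moreover have "a * (a - 1) = 2 * n / m\<^sup>2" unfolding am nm using m by (simp add: field_simps power2_eq_square)
    moreover have "s powr a * (a * (a - 1) * s powr (a - 2)) = a * (a - 1) * (s powr a * s powr (a - 2))"
      by (rule mult.left_commute)
    ultimately show ?thesis by (simp only:)
  qed
  have e3: "(norm ((a * s powr (a - 1)) *\<^sub>R gradient v x))\<^sup>2 / 2
     = 2 / m\<^sup>2 * s powr (- (2 * n / m)) * (norm (gradient v x))\<^sup>2"
  proof -
    have "(s powr (a - 1))\<^sup>2 = s powr (- (2 * n / m))"
      unfolding two[symmetric] by (simp add: power2_eq_square powr_add[symmetric])
    moreover have "a\<^sup>2 = 4 / m\<^sup>2" by (simp add: am power_divide)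
    ultimately show ?thesis by (simp add: power_mult_distrib)
  qed
  have "schouten (s powr a) ((a * s powr (a - 1)) *\<^sub>R gradient v x)
      ((a * s powr (a - 1)) *\<^sub>R hessian v x
        + (a * (a - 1) * s powr (a - 2)) *\<^sub>R outer (gradient v x) (gradient v x))
    = (s powr a * (a * s powr (a - 1))) *\<^sub>R hessian v x
      + (s powr a * (a * (a - 1) * s powr (a - 2))) *\<^sub>R outer (gradient v x) (gradient v x)
      - ((norm ((a * s powr (a - 1)) *\<^sub>R gradient v x))\<^sup>2 / 2) *\<^sub>R mat 1"
    unfolding schouten_def by (simp only: scaleR_add_right scaleR_scaleR)
  also have "\<dots> = conf_hessian v x"
    unfolding e1 e2 e3 unfolding conf_hessian_def Let_def n_def[symmetric] m_def[symmetric] s_def outer_def by simp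
  finally show ?thesis unfolding s_def .
qed

text \<open>Uniform convergence is used on the compact set formed by the sequence \<open>y\<close>
  and its limit.\<close>

lemma uniform_limit_along_sequence:
  fixes X :: "nat \<Rightarrow> 'a::heine_borel \<Rightarrow> 'b::metric_space"
  assumes lim: "\<And>K. compact K \<Longrightarrow> K \<subseteq> \<Omega> \<Longrightarrow> uniform_limit K X l sequentially"
    and l: "continuous_on \<Omega> l" and s: "strict_mono s"
    and y: "\<And>k. y k \<in> \<Omega>" "y \<longlonglongrightarrow> x" "x \<in> \<Omega>"
  shows "(\<lambda>k. X (s k) (y k)) \<longlonglongrightarrow> l x"
proof (rule tendstoI)
  fix e :: real assume e: "e > 0"
  have "uniform_limit (insert x (range y)) X l sequentially"
    using y by (intro lim compact_sequence_with_limit[OF y(2)]) auto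
  then have "\<forall>\<^sub>F n in sequentially. \<forall>z\<in>insert x (range y). dist (X n z) (l z) < e / 2"
    using e by (intro uniform_limitD) auto
  then have "\<forall>\<^sub>F k in sequentially. \<forall>z\<in>insert x (range y). dist (X (s k) z) (l z) < e / 2"
    by (rule eventually_compose_filterlim[OF _ filterlim_subseq[OF s]])
  moreover have "(\<lambda>k. l (y k)) \<longlonglongrightarrow> l x"
    using y by (intro continuous_on_tendsto_compose[OF l]) auto
  then have "\<forall>\<^sub>F k in sequentially. dist (l (y k)) (l x) < e / 2" using e by (intro tendstoD) auto
  ultimately show "\<forall>\<^sub>F k in sequentially. dist (X (s k) (y k)) (l x) < e"
  proof eventually_elim
    case (elim k)
    have "dist (X (s k) (y k)) (l x) \<le> dist (X (s k) (y k)) (l (y k)) + dist (l (y k)) (l x)"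
      by (rule dist_triangle)
    moreover have "dist (X (s k) (y k)) (l (y k)) < e / 2" using elim(1) by blast
    ultimately show ?case using elim(2) by linarith
  qed
qed

text \<open>Symmetry is inferred backwards: from the conformal Hessian to \<open>?H\<close>, and
  from there, after removal of the rank-one term, to the Hessian of \<open>v\<close>, which makes
  the second-order expansion available.\<close>

lemma Ck2_powr_jets:
  fixes v :: "real^'n \<Rightarrow> real"
  assumes n: "CARD('n) \<ge> 3" and v: "Ck_on 2 \<Omega> v" "\<And>x. x \<in> \<Omega> \<Longrightarrow> 0 < v x"
    and \<Omega>: "open \<Omega>" "x \<in> \<Omega>" and sym: "conf_hessian v x \<in> sym_matrices"
  defines "a \<equiv> - 2 / (real CARD('n) - 2)"
  shows "\<exists>p H. superjet (\<lambda>x. v x powr a) x p H \<and> subjet (\<lambda>x. v x powr a) x p H \<and>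
      H \<in> sym_matrices \<and> schouten (v x powr a) p H = conf_hessian v x"
proof -
  have a: "a < 0" using n by (simp add: a_def)
  define s where "s = v x"
  have s: "s > 0" using v \<Omega> by (simp add: s_def)
  let ?p = "(a * s powr (a - 1)) *\<^sub>R gradient v x"
  let ?O = "(a * (a - 1) * s powr (a - 2)) *\<^sub>R outer (gradient v x) (gradient v x)"
  let ?H = "(a * s powr (a - 1)) *\<^sub>R hessian v x + ?O"
  have S: "schouten (s powr a) ?p ?H = conf_hessian v x"
    unfolding s_def a_def using conf_hessian_eq_schouten[OF n] s by (simp add: s_def)
  have Hsym: "?H \<in> sym_matrices"
    by (rule sym_of_schouten[of "s powr a" ?p]) (use S sym s in auto)
  have "hessian v x = (1 / (a * s powr (a - 1))) *\<^sub>R (?H - ?O)" using a s by simp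
  also have "\<dots> \<in> sym_matrices"
    by (intro sym_matrices_scaleR sym_matrices_diff sym_matrices_outer Hsym)
  finally have hs: "hessian v x \<in> sym_matrices" .
  note j = Ck2_jets[OF v(1) \<Omega> hs]
  have "\<forall>\<^sub>F h in nhds 0. v (x + h) > 0"
    using eventually_shift[OF \<Omega>] by eventually_elim (rule v(2))
  then have "subjet (\<lambda>x. v x powr a) x ?p ?H"
    unfolding s_def using subjet_powr[OF j(1) _ _ a] s by (simp add: s_def)
  moreover have "superjet (\<lambda>x. v x powr a) x ?p ?H"
    unfolding s_def using superjet_powr[OF j(2) _ a] s by (simp add: s_def)
  ultimately show ?thesis using Hsym S unfolding s_def by blast
qed

text \<open>The sphere centred at \<open>y + s (y' - y)\<close> which inverts \<open>y\<close> to \<open>y'\<close> does not enclose the origin;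
  for \<open>s \<longrightarrow> \<infinity>\<close> its conformal factor at \<open>y\<close> tends to \<open>1\<close>.\<close>

lemma kelvin_le_imp_radial:
  fixes u :: "real^'n \<Rightarrow> real"
  assumes K: "\<And>x r y. x \<noteq> 0 \<Longrightarrow> 0 < r \<Longrightarrow> r < norm x \<Longrightarrow> r \<le> norm (y - x) \<Longrightarrow> y \<noteq> 0 \<Longrightarrow>
      kelvin u x r y \<le> u y"
  shows "radially_symmetric_on (- {0}) 0 u"
proof -
  have le: "u y' \<le> u y" if y: "y \<noteq> 0" and eq: "norm y' = norm y" for y y'
  proof (cases "y' = y")
    case False
    define \<Delta> where "\<Delta> = y' - y"
    define N where "N = CARD('n) - 2"
    have d: "norm \<Delta> > 0" using False by (simp add: \<Delta>_def)
    have y\<Delta>: "2 * (y \<bullet> \<Delta>) = - ((norm \<Delta>)\<^sup>2)"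
    proof -
      have "(norm (y + \<Delta>))\<^sup>2 = (norm y)\<^sup>2" using eq by (simp add: \<Delta>_def)
      then show ?thesis
        unfolding power2_norm_eq_inner by (simp add: inner_add_left inner_add_right inner_commute)
    qed
    have key: "(sqrt (1 - 1 / s)) ^ N * u y' \<le> u y" if s: "s > 1" for s
    proof -
      define x where "x = y + s *\<^sub>R \<Delta>"
      \<comment> \<open>The distances of \<open>x\<close> to \<open>y\<close> and to
        \<open>y'\<close> are \<open>s * norm \<Delta>\<close> and
        \<open>(s - 1) * norm \<Delta>\<close>, and \<open>r\<^sup>2\<close> is their product. The
        norms of \<open>y\<close> and \<open>y'\<close> being equal,
        \<open>(norm x)\<^sup>2 = (norm y)\<^sup>2 + r\<^sup>2\<close>, which is why the radius is
        admissible.\<close>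
      define r where "r = sqrt (s * (s - 1)) * norm \<Delta>"
      have r2: "r\<^sup>2 = s * (s - 1) * (norm \<Delta>)\<^sup>2" using s by (simp add: r_def power_mult_distrib)
      have r: "r > 0" using s d by (simp add: r_def)
      have "(norm x)\<^sup>2 = (norm y)\<^sup>2 + s * (2 * (y \<bullet> \<Delta>)) + s\<^sup>2 * (norm \<Delta>)\<^sup>2"
        unfolding x_def power2_norm_eq_inner
        by (simp add: inner_add_left inner_add_right inner_commute power2_eq_square algebra_simps)
      also have "\<dots> = (norm y)\<^sup>2 + r\<^sup>2"
        unfolding y\<Delta> r2 by (simp add: power2_eq_square algebra_simps)
      also have "\<dots> > r\<^sup>2" using y by simp
      finally have rx: "r < norm x" by (rule power_less_imp_less_base) simp
      have yx: "y - x = - (s *\<^sub>R \<Delta>)" by (simp add: x_def)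
      have n: "norm (y - x) = s * norm \<Delta>" using s by (simp add: yx)
      have q: "r / norm (y - x) = sqrt (1 - 1 / s)"
      proof -
        have "r / norm (y - x) = sqrt (s * (s - 1)) / s" using d by (simp add: r_def n)
        also have "\<dots> = sqrt (s * (s - 1) / s\<^sup>2)" using s by (simp add: real_sqrt_divide)
        also have "s * (s - 1) / s\<^sup>2 = 1 - 1 / s" using s by (simp add: power2_eq_square field_simps)
        finally show ?thesis .
      qed
      have "sqrt (1 - 1 / s) \<le> 1" using s by (simp add: real_sqrt_le_1_iff)
      then have ry: "r \<le> norm (y - x)" unfolding q[symmetric] using s d by (simp add: n)
      have "r\<^sup>2 / (norm (y - x))\<^sup>2 = (s - 1) / s"
        unfolding r2 n using s d by (simp add: power_mult_distrib power2_eq_square)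
      then have "x + (r\<^sup>2 / (norm (y - x))\<^sup>2) *\<^sub>R (y - x) = y + s *\<^sub>R \<Delta> - ((s - 1) / s * s) *\<^sub>R \<Delta>"
        by (simp add: yx x_def)
      also have "\<dots> = y'" using s by (simp add: \<Delta>_def scaleR_diff_left)
      finally have img: "x + (r\<^sup>2 / (norm (y - x))\<^sup>2) *\<^sub>R (y - x) = y'" .
      have "x \<noteq> 0" using rx r by auto
      from K[OF this r rx ry y] show ?thesis
        unfolding kelvin_def img N_def q[symmetric] power_divide by simp
    qed
    have lim: "(\<lambda>k. (sqrt (1 - 1 / (2 + real k))) ^ N * u y') \<longlonglongrightarrow> (sqrt (1 - 0)) ^ N * u y'"
    proof -
      have "(\<lambda>k. 1 / (2 + real k)) \<longlonglongrightarrow> 0"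
        using LIMSEQ_ignore_initial_segment[OF lim_1_over_n[where 'a = real], of 2] by (simp add: add.commute)
      then show ?thesis by (intro tendsto_intros)
    qed
    have "(sqrt (1 - 0)) ^ N * u y' \<le> u y"
      by (rule LIMSEQ_le_const2[OF lim]) (auto intro!: key)
    then show ?thesis by simp
  qed simp
  show ?thesis
    unfolding radially_symmetric_on_def
  proof (intro exI[of _ "\<lambda>\<rho>. u (SOME z. z \<noteq> 0 \<and> norm z = \<rho>)"] ballI)
    fix x :: "real^'n" assume x: "x \<in> - {0}"
    define z :: "real^'n" where "z = (SOME z. z \<noteq> 0 \<and> norm z = norm x)"
    have "z \<noteq> 0 \<and> norm z = norm x" unfolding z_def 
      by (rule someI[of "\<lambda>z. z \<noteq> 0 \<and> norm z = norm x" x]) (use x in auto)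
    then have "u x = u z" using le[of x z] le[of z x] x by (intro antisym) auto
    then show "u x = u (SOME z. z \<noteq> 0 \<and> norm z = norm (x - 0))" by (simp add: z_def)
  qed
qed

theorem theorem1p4:
  fixes U :: "(real^'n^'n) set"
    and F :: "real^'n^'n \<Rightarrow> real"
    and u :: "real^'n \<Rightarrow> real"
  assumes n_ge_3: "CARD('n) \<ge> 3"
    and U_open: "openin (top_of_set sym_matrices) U"
    and F_C1: "C1_on_sym U F"
    and F_C0: "continuous_on (closure U) F"
    and U_inv: "\<And>Q :: real^'n^'n. orthogonal_matrix Q \<Longrightarrow> (\<lambda>M. matrix_inv Q ** M ** Q) ` U = U"
    and U_add: "\<And>M N. M \<in> U \<Longrightarrow> pos_def_matrix N \<Longrightarrow> M + N \<in> U"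
    and U_cone: "\<And>M a. M \<in> U \<Longrightarrow> 0 < a \<Longrightarrow> a *\<^sub>R M \<in> U"
    and U_bdry: "{a *\<^sub>R mat 1 | a. 0 < a} \<inter> (top_of_set sym_matrices frontier_of U) = {}"
    and F_inv: "\<And>M Q. M \<in> U \<Longrightarrow> orthogonal_matrix Q \<Longrightarrow> F (matrix_inv Q ** M ** Q) = F M"
    and F_ellip: "\<And>M. M \<in> U \<Longrightarrow> pos_def_matrix (matrix_partials F M)"
    and F_pos: "\<And>M. M \<in> U \<Longrightarrow> 0 < F M"
    and F_bdry: "\<And>M. M \<in> top_of_set sym_matrices frontier_of U \<Longrightarrow> F M = 0"
    and u_pos: "\<And>x. x \<noteq> 0 \<Longrightarrow> 0 < u x"
    and u_C1: "Ck_on 1 (- {0}) u"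
    and u_weak: "weak_solution U F (- {0}) u"
    and u_superharm: "laplacian_nonpos_distr (- {0}) u"
  shows "(\<forall>x r y. x \<noteq> 0 \<and> 0 < r \<and> r < norm x \<and> norm (y - x) \<ge> r \<and> y \<noteq> 0
            \<longrightarrow> kelvin u x r y \<le> u y)
       \<and> radially_symmetric_on (- {0}) 0 u"
proof -
  define a where "a = - 2 / (real CARD('n) - 2)"
  have a: "a < 0" using n_ge_3 by (simp add: a_def)
  define f where "f x = u x powr a" for x
  have u_cont: "continuous_on (- {0}) u" using u_weak by (simp add: weak_solution_def)
  obtain v \<beta> where approx:
    "\<forall>i. Ck_on 2 (- {0}) (v i) \<and> continuous_on (- {0}) (\<beta> i) \<and> \<beta> i ` (- {0}) \<subseteq> sym_matrices"
    "\<forall>i. \<forall>x\<in>- {0}. 0 < v i x \<and> conf_hessian (v i) x + \<beta> i x \<in> U"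
    "\<forall>K. compact K \<and> K \<subseteq> - {0} \<longrightarrow>
       uniform_limit K v u sequentially \<and>
       uniform_limit K \<beta> (\<lambda>x. 0) sequentially \<and>
       uniform_limit K (\<lambda>i x. F (conf_hessian (v i) x + \<beta> i x)) (\<lambda>x. 0) sequentially"
    using u_weak unfolding weak_solution_def by (elim conjE exE) (rule that)
  have v: "Ck_on 2 (- {0}) (v i)" "x \<noteq> 0 \<Longrightarrow> 0 < v i x" for i x using approx by simp_all
  have \<beta>: "\<beta> i ` (- {0}) \<subseteq> sym_matrices" for i using approx(1) by blast
  have vU: "x \<noteq> 0 \<Longrightarrow> conf_hessian (v i) x + \<beta> i x \<in> U" for i x using approx(2) by simp
  have lim: "uniform_limit K v u sequentially" "uniform_limit K \<beta> (\<lambda>x. 0) sequentially"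
    "uniform_limit K (\<lambda>i x. F (conf_hessian (v i) x + \<beta> i x)) (\<lambda>x. 0) sequentially"
    if "compact K" "K \<subseteq> - {0}" for K using approx(3) that by simp_all
  interpret elliptic_cone U F
    by unfold_locales (fact U_open F_C1 U_inv U_add U_cone F_ellip F_pos)+
  have u_diff: "u differentiable (at x)" if "x \<noteq> 0" for x using u_C1 that by simp
  interpret punctured_solution U F f "\<lambda>j x. v j x powr a" \<beta> "\<lambda>j. conf_hessian (v j)"
  proof unfold_locales
    show "continuous_on (- {0}) f"
      unfolding f_def using u_pos by (intro continuous_intros u_cont) (auto simp: less_imp_neq[symmetric])
    show "0 < f x" if "x \<in> - {0}" for x using u_pos[of x] that by (simp add: f_def)
    show "continuous_on (- {0}) (\<lambda>x. v j x powr a)" for j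
    proof (intro continuous_intros)
      show "continuous_on (- {0}) (v j)"
        using v(1)[of j] by (auto simp: numeral_2_eq_2 intro!: continuous_at_imp_continuous_on
            differentiable_imp_continuous_within)
      show "\<forall>x\<in>- {0}. v j x \<noteq> 0" using v(2)[of _ j] by (auto simp: less_imp_neq[symmetric])
    qed
    show "0 < v j x powr a" if "x \<in> - {0}" for j x using v(2)[of x j] that by simp
    show \<beta>s: "\<beta> j x \<in> sym_matrices" if "x \<in> - {0}" for j x using \<beta> that by blast
    show "conf_hessian (v j) x + \<beta> j x \<in> U" if "x \<in> - {0}" for j x using vU that by simp
    show "\<exists>p H. superjet (\<lambda>x. v j x powr a) x p H \<and> subjet (\<lambda>x. v j x powr a) x p H \<and>
        H \<in> sym_matrices \<and> schouten (v j x powr a) p H = conf_hessian (v j) x" if x: "x \<in> - {0}" for j x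
      unfolding a_def
    proof (rule Ck2_powr_jets[OF n_ge_3 v(1) _ _ x])
      have "(conf_hessian (v j) x + \<beta> j x) - \<beta> j x \<in> sym_matrices"
        using x vU U_sym \<beta>s by (intro sym_matrices_diff) auto
      then show "conf_hessian (v j) x \<in> sym_matrices" by simp
    qed (use v(2) in auto)
    fix s :: "nat \<Rightarrow> nat" and y :: "nat \<Rightarrow> real^'n" and x
    assume s: "strict_mono s" and y: "\<And>k. y k \<in> - {0}" "y \<longlonglongrightarrow> x" "x \<in> - {0}"
    show "(\<lambda>k. v (s k) (y k) powr a) \<longlonglongrightarrow> f x"
      unfolding f_def using u_pos[of x] y(3)
      by (intro tendsto_powr tendsto_const uniform_limit_along_sequence[OF lim(1) u_cont s y]) auto
    show "(\<lambda>k. \<beta> (s k) (y k)) \<longlonglongrightarrow> 0"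
      by (rule uniform_limit_along_sequence[OF lim(2) continuous_on_const s y])
    show "(\<lambda>k. F (conf_hessian (v (s k)) (y k) + \<beta> (s k) (y k))) \<longlonglongrightarrow> 0"
      by (rule uniform_limit_along_sequence[OF lim(3) continuous_on_const s y])
  next
    fix x :: "real^'n" assume x: "x \<noteq> 0"
    have "((\<lambda>t. t powr a) has_real_derivative a * u x powr (a - 1)) (at (u x))"
      using u_pos[OF x] by (auto intro!: derivative_eq_intros)
    then have "((\<lambda>t. t powr a) has_derivative (*) (a * u x powr (a - 1))) (at (u x))"
      by (simp add: has_field_derivative_def)
    from has_derivative_compose[OF frechet_gradient[OF u_diff[OF x]] this]
    show "f differentiable (at x)" unfolding f_def differentiable_def by blast
  next
    fix y p and H :: "real^'n^'n" assume y: "y \<noteq> 0" and jet: "superjet f y p H"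
    \<comment> \<open>The exponent that leads from \<open>f\<close> back to \<open>u\<close>. As it
      is negative, a superjet of \<open>f\<close> gives a subjet of \<open>u\<close>, on which
      \<open>superharmonic_jet\<close> acts.\<close>
    define b where "b = 1 / a"
    have b: "b < 0" using a by (simp add: b_def)
    have fu: "f x powr b = u x" if "x \<noteq> 0" for x
      using u_pos[OF that] a by (simp add: f_def powr_powr b_def)
    have fp: "f x > 0" if "x \<noteq> 0" for x using u_pos[OF that] by (simp add: f_def)
    have nz: "\<forall>\<^sub>F h in nhds 0. y + h \<in> - {0}" using y by (intro eventually_shift) auto
    define s where "s = f y"
    have s: "s > 0" using fp[OF y] by (simp add: s_def)
    have "\<forall>\<^sub>F h in nhds 0. 0 < f (y + h)" using nz by eventually_elim (simp add: fp)
    from subjet_powr[OF jet fp[OF y] this b]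
    have j: "subjet (\<lambda>x. f x powr b) y ((b * s powr (b - 1)) *\<^sub>R p)
      ((b * s powr (b - 1)) *\<^sub>R H + (b * (b - 1) * s powr (b - 2)) *\<^sub>R outer p p)"
      (is "subjet _ y ?p ?H")
      unfolding s_def .
    have "subjet u y ?p ?H"
    proof (rule subjet_touch[OF j])
      show "\<forall>\<^sub>F h in nhds 0. f (y + h) powr b - f y powr b \<le> u (y + h) - u y"
        using nz by eventually_elim (simp add: fu y)
    qed
    then have "trace ?H \<le> 0"
      using superharmonic_jet[OF u_superharm _ u_cont] y by auto
    moreover have "trace ?H = b * s powr (b - 2) * trace (schouten (f y) p H)"
    proof -
      have 1: "s powr (b - 1) = s powr (b - 2) * s"
        using s powr_add[of s "b - 2" 1] by simp
      \<comment> \<open>With this value the gradient terms of the Laplacian of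
        \<open>f powr b\<close> combine to the trace of the Schouten matrix.\<close>
      have 2: "b - 1 = - real CARD('n) / 2"
        using n_ge_3 by (simp add: b_def a_def field_simps)
      have "trace ?H = b * s powr (b - 1) * trace H + b * (b - 1) * s powr (b - 2) * (norm p)\<^sup>2"
        by (simp add: trace_add trace_scaleR trace_outer power2_norm_eq_inner)
      also have "\<dots> = b * s powr (b - 2) * (s * trace H - CARD('n) * (norm p)\<^sup>2 / 2)"
        unfolding 1 unfolding 2 by (simp add: algebra_simps)
      finally show ?thesis by (simp add: trace_schouten s_def)
    qed
    ultimately have "b * s powr (b - 2) * trace (schouten (f y) p H) \<le> 0" by simp
    moreover have "b * s powr (b - 2) < 0" using b s by (simp add: mult_neg_pos)
    ultimately show "0 \<le> trace (schouten (f y) p H)" by (simp only: mult_le_0_iff) auto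
  qed (use n_ge_3 in auto)
  have "kelvin u x r y \<le> u y"
    if "x \<noteq> 0" and r: "0 < r" "r < norm x" and y: "r \<le> norm (y - x)" "y \<noteq> 0" for x r y
  proof -
    have yx: "y \<noteq> x" using r y by auto
    \<comment> \<open>The point \<open>y\<close> lies outside the sphere and its inverse
      \<open>w\<close> inside, where \<open>conf_inv_le\<close> applies. Raising that inequality to
      the negative power \<open>1 / a\<close> reverses it and gives the Kelvin inequality at
      \<open>y\<close>, with
      \<open>(k\<^sup>2) powr (1 / a) = 1 / k ^ (CARD('n) - 2)\<close>.\<close>
    define w where "w = inversion x r y"
    define k where "k = r / norm (y - x)"
    have k: "k > 0" using r yx by (simp add: k_def)
    note w = inversion_involution[OF yx r(1), folded w_def]
    have "norm (w - x) \<le> r"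
      unfolding w(3) using y(1) r yx by (simp add: power2_eq_square divide_le_eq mult_left_mono)
    then have wB: "w \<in> cball x r" by (simp add: dist_norm norm_minus_commute)
    then have w0: "w \<noteq> 0" using r by auto
    have "conf_inv x r f w \<le> f w"
      using w y by (intro conf_inv_le r wB) (auto simp: regular_def)
    moreover have "(norm (w - x))\<^sup>2 / r\<^sup>2 = k\<^sup>2"
      unfolding w(3) k_def using r yx by (simp add: power_divide power2_eq_square)
    ultimately have "k\<^sup>2 * u y powr a \<le> u w powr a"
      unfolding conf_inv_def w(1) f_def by simp
    then have "(u w powr a) powr (1 / a) \<le> (k\<^sup>2 * u y powr a) powr (1 / a)"
      using a k u_pos[OF y(2)] by (intro powr_mono2') auto
    then have "u w \<le> (k\<^sup>2) powr (1 / a) * u y"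
      using a u_pos[OF w0] u_pos[OF y(2)] by (simp add: powr_mult powr_powr)
    moreover have "(k\<^sup>2) powr (1 / a) = 1 / k ^ (CARD('n) - 2)"
    proof -
      have "(k\<^sup>2) powr (1 / a) = (k powr 2) powr (1 / a)" using k by simp
      also have "\<dots> = k powr (- real (CARD('n) - 2))"
      proof -
        have "2 * (1 / a) = - real (CARD('n) - 2)"
          using n_ge_3 by (simp add: a_def of_nat_diff field_simps)
        then show ?thesis unfolding powr_powr by (rule arg_cong)
      qed
      also have "\<dots> = 1 / k ^ (CARD('n) - 2)"
        using k by (simp add: powr_minus powr_realpow divide_inverse)
      finally show ?thesis .
    qed
    ultimately have "k ^ (CARD('n) - 2) * u w \<le> u y"
      using k by (simp add: field_simps)
    then show ?thesis
      unfolding kelvin_def w_def inversion_def k_def power_divide by simp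
  qed
  then show ?thesis using kelvin_le_imp_radial[of u] by blast
qed

end
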